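(* Let $C^s$ and $C^t$ be two constrained least-squares assignments (constrained LSAs) of $X$ with site vectors $s,t\in\mathbb{R}^{d\cdot k}$, respectively. The overall transition algorithm (described in the context), applied to $C^s,C^t,s,t$, returns a sequence of clusterings $$(C^{s,0},C^{s,1},\dots,C^{s,p},C^{\lambda_1},\dots,C^{\lambda_m},C^{t,q-1},\dots,C^{t,1},C^{t,0})$$ and a sequence of power diagrams $$(P^{s,0},\overline{P}^{s,1},\dots,\overline{P}^{s,p},P^{s,p},\overline{P}^{\lambda_1},\dots,P^{\lambda_{m-1}},\overline{P}^{\lambda_m},P^{t,q},\overline{P}^{t,q},P^{t,q-1},\dots,\overline{P}^{t,1},P^{t,0})$$ that satisfy the following properties. 1. $C^{s,0}=C^s$ and $C^{t,0}=C^t$. 2. All clusterings in the sequence are constrained LSAs (and thus separable, i.e., each admits a separating power diagram). 3. All clusterings $C$ in the sequence have cluster sizes satisfying $\kappa_i^-:=\min\{|C^s_i|,|C^t_i|\}\le|C_i|\le\kappa_i^+:=\max\{|C^s_i|,|C^t_i|\}$ for all $i\le k$. 4. Consecutive clusterings differ by a single cyclical or sequential exchange of items. 5. The power diagrams satisfy: $P^{s,i}$ is a separating power diagram for sites $s$ for $C^{s,i}$; $P^{\lambda_i}$ is a separating power diagram for $C^{\lambda_i}$; $P^{t,i}$ is a separating power diagram for sites $t$ for $C^{t,i}$. 6. For consecutive clusterings $C^{s,i-1},C^{s,i}$, $\overline{P}^{s,i}$ is a shared power diagram for sites $s$; for consecutive clusterings $C^{\lambda_{i-1}},C^{\lambda_i}$,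 $\overline{P}^{\lambda_i}$ is a shared power diagram for sites $(1-\lambda_i)s+\lambda_i t$; for consecutive clusterings $C^{t,i},C^{t,i-1}$, $\overline{P}^{t,i}$ is a shared power diagram for sites $t$. 7. $C^s_{\mathrm{rad}}=C^{s,p}=C^{\lambda_0},C^{\lambda_1},\dots,C^{\lambda_m}=C^{t,q}=C^t_{\mathrm{rad}}$ are radial clusterings for sites $(1-\lambda_i)s+\lambda_i t$ for all $i\ge0$, with respect to $\mathcal{P}^{\pm}(\kappa^-,\kappa^+)$ and $\mathcal{T}^{\pm}(\kappa^-,\kappa^+)$ (with $\kappa^\pm$ as in 3). 8. $C^{s,0},C^{s,1},\dots,C^{s,p}$ are constrained LSAs for sites $s$. 9. $C^{t,q-1},\dots,C^{t,1},C^{t,0}$ are constrained LSAs for sites $t$. 10. The shapes $|C^{s,i}|$ of $C^{s,0},C^{s,1},\dots,C^{s,p}$ are all distinct; the number of clusterings in this part of the sequence is bounded by the number of (feasible) shapes. 11. The shapes $|C^{t,i}|$ of $C^{t,q},C^{t,q-1},\dots,C^{t,0}$ are all distinct; the number of clusterings in this part of the sequence is bounded by the number of (feasible) shapes.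
   Context: $X=\{x_1,\dots,x_n\}\subset\mathbb{R}^d$ is a finite set of $n$ distinct items with $\sum_{j=1}^n x_j=0$, and $[k]=\{1,\dots,k\}$. Clusterings. A clustering of $X$ is a partition $C=(C_1,\dots,C_k)$ of $X$ into $k$ (possibly empty) clusters. Its shape is $|C|:=(|C_1|,\dots,|C_k|)$; its clustering vector is $w(C):=(\sum_{x\in C_1}x,\dots,\sum_{x\in C_k}x)\in\mathbb{R}^{d\cdot k}$. Given bounds $\kappa^-,\kappa^+$, a shape is feasible if it lies componentwise between them. Site vectors and constrained LSAs. A site vector is $a=(a_1^T,\dots,a_k^T)^T\in\mathbb{R}^{d\cdot k}$ with sites $a_i\in\mathbb{R}^d$. A clustering $C$ is a constrained LSA for $a$ if it minimizes $\sum_{i=1}^k\sum_{x\in C_i}\|x-a_i\|^2$ over all clusterings with the same shape as $C$; it is a constrained LSA if it is one for some site vector. Polytopes and radial clusterings. For bounds $\kappa^-\le\kappa^+$ in $\mathbb{Z}_{\ge0}^k$, $\mathcal{P}^{\pm}(\kappa^-,\kappa^+)=\mathrm{conv}\{w(C):\kappa^-\le|C|\le\kappa^+\}$ (bounded-shape partition polytope) and $\mathcal{T}^{\pm}(\kappa^-,\kappa^+)=\{y\in\mathbb{R}^{n\cdot k}_{\ge 0}:\sum_i y_{ij}=1\ \forall j,\ \kappa_i^-\le\sum_j y_{ij}\le\kappa_i^+\ \forall i\}$ (bounded-shape transportation polytope). Write $\mathcal{T}^=(\kappa)=\mathcal{T}^{\pm}(\kappa,\kappa)$. The vertices of $\mathcal{T}^\pm$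 are exactly the 0/1-vectors $y$ of clusterings with sizes within the bounds ($y_{ij}=1$ iff $x_j\in C_i$), and are identified with these clusterings; clusterings are adjacent if the corresponding vertices share an edge of $\mathcal{T}^\pm$. For a site vector $a$ let $c(a)\in\mathbb{R}^{n\cdot k}$, $c(a)_{ij}=x_j^Ta_i$. A clustering $C$ within the bounds is radial for sites $a$ if $w(C)$ maximizes $a^Tw$ over $\mathcal{P}^{\pm}(\kappa^-,\kappa^+)$; equivalently, if its 0/1-vector maximizes $c(a)^Ty$ over $\mathcal{T}^{\pm}(\kappa^-,\kappa^+)$. $N_{\mathcal{T}^\pm}(C)$ denotes the normal cone of $\mathcal{T}^{\pm}(\kappa^-,\kappa^+)$ at the vertex $C$, i.e. the set of all objective vectors maximized over $\mathcal{T}^\pm$ at $C$. Power diagrams. For a site vector $a$ and $\gamma_1,\dots,\gamma_k\in\mathbb{R}$, the power diagram with sites $a$ is $(P_1,\dots,P_k)$ with cells $P_i=\{x\in\mathbb{R}^d:(a_\ell-a_i)^Tx\le\gamma_\ell-\gamma_i\ \forall \ell\in[k]\setminus\{i\}\}$. It is a separating power diagram for $C$ if $C_i\subseteq P_i$ for all $i$, and a shared power diagram for two clusterings if it is separating for both. Exchanges. The clustering difference graph $CDG(C,C')$ is the labeled directed multigraph on $[k]$ with one arc $(i,\ell)$ labeled $x$ for each $i\ne\ell$ and $x\in C_i\cap C'_\ell$. $C$ and $C'$ differ by a single cyclical (sequential) exchange if, up to isolated nodes, $CDG(C,C')$ consists of a single directed cycle (path). Power diagram subroutines. Margin LP for clustering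 $C$ and sites $a$: maximize $\varepsilon\ge0$ over $\gamma\in\mathbb{R}^k$ with $\gamma_1=0$ subject to $\frac{\max_{x\in C_i}(a_\ell-a_i)^Tx}{\|a_\ell-a_i\|}+\varepsilon\le\frac{\gamma_\ell-\gamma_i}{\|a_\ell-a_i\|}$ for all $i\ne\ell$. Shared system for clusterings $C,C'$ and sites $a$: find $\gamma\in\mathbb{R}^k$ with $\gamma_1=0$, $\max_{x\in C_i}(a_\ell-a_i)^Tx\le\gamma_\ell-\gamma_i$ and $\max_{x\in C'_i}(a_\ell-a_i)^Tx\le\gamma_\ell-\gamma_i$ for all $i\ne\ell$. In both cases $a$ and the solution $\gamma$ define a power diagram. AlgoLSAtoRad$(C,a,\kappa^-,\kappa^+)$, for a constrained LSA $C$ for sites $a$: set $r=0$, $C^0=C$. While $C^r$ is not optimal in $\mathcal{T}^{\pm}(\kappa^-,\kappa^+)$ in direction $c(a)$: (i) perform an (improving) simplex step from $C^r$ with respect to $\max c(a)^Ty$ in $\mathcal{T}^{\pm}(\kappa^-,\kappa^+)$ to an adjacent vertex/clustering $C$; (ii) find a clustering optimal with respect to $c(a)$ in $\mathcal{T}^=(|C|)$ that differs from $C^r$ by a single sequential exchange, and let it be the next clustering $C^{r+1}$; increase $r$ by 1. For each clustering $C^i$ found, $P^i$ is obtained from the margin LP for $C^i$ and sites $a$; for each consecutive pair, $\overline{P}^i$ is obtained from the shared system for $C^{i-1},C^i$ and sites $a$. Return $(C^0,\dots,C^r)$ and $(P^0,\overline{P}^1,P^1,\dots,\overline{P}^r,P^r)$.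 AlgoRadToRad$(C^s_{\mathrm{rad}},C^t_{\mathrm{rad}},s,t,\kappa^-,\kappa^+)$, for radial clusterings for sites $s$ and $t$: write $s^\lambda=(1-\lambda)s+\lambda t$. Set $\lambda=\lambda_0=0$, $r=0$, $C^{\lambda_0}=C^s_{\mathrm{rad}}$. While $C^{\lambda_r}\ne C^t_{\mathrm{rad}}$: increase $\lambda$ to the next ranging breakpoint (the value beyond which the current vertex $C^{\lambda_r}$ is no longer optimal for $c(s^\lambda)$), such that $c(s^\lambda)\in N_{\mathcal{T}^{\pm}}(C^{\lambda_r})\cap N_{\mathcal{T}^{\pm}}(C^\lambda)$ for some adjacent vertex/clustering $C^\lambda\ne C^{\lambda_r}$; set $r\leftarrow r+1$, $\lambda_r\leftarrow\lambda$, $C^{\lambda_r}\leftarrow C^\lambda$; obtain $\overline{P}^{\lambda_r}$ from the shared system for $C^{\lambda_{r-1}},C^{\lambda_r}$ and sites $s^{\lambda_r}$; if $r\ge2$, obtain $P^{\lambda_{r-1}}$ from the margin LP for $C^{\lambda_{r-1}}$ and sites $\frac12(s^{\lambda_{r-1}}+s^{\lambda_r})$. Return $(C^{\lambda_0},\dots,C^{\lambda_r})$ and $(\overline{P}^{\lambda_1},P^{\lambda_1},\overline{P}^{\lambda_2},\dots,P^{\lambda_{r-1}},\overline{P}^{\lambda_r})$. Overall transition algorithm. Input: constrained LSAs $C^s,C^t$ for sites $s,t$. Set $\kappa^-_i=\min\{|C^s_i|,|C^t_i|\}$, $\kappa^+_i=\max\{|C^s_i|,|C^t_i|\}$ for all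 $i$. Call AlgoLSAtoRad$(C^s,s,\kappa^-,\kappa^+)$, returning $(C^{s,0},\dots,C^{s,p})$ with $C^{s,0}=C^s$ and $(P^{s,0},\overline{P}^{s,1},\dots,\overline{P}^{s,p},P^{s,p})$; set $C^s_{\mathrm{rad}}=C^{s,p}$. Call AlgoLSAtoRad$(C^t,t,\kappa^-,\kappa^+)$, returning $(C^{t,0},\dots,C^{t,q})$ with $C^{t,0}=C^t$ and $(P^{t,0},\overline{P}^{t,1},\dots,\overline{P}^{t,q},P^{t,q})$; set $C^t_{\mathrm{rad}}=C^{t,q}$. Call AlgoRadToRad$(C^s_{\mathrm{rad}},C^t_{\mathrm{rad}},s,t,\kappa^-,\kappa^+)$, returning $(C^{\lambda_0},\dots,C^{\lambda_m})$ with $C^{\lambda_0}=C^s_{\mathrm{rad}}$, $C^{\lambda_m}=C^t_{\mathrm{rad}}$ and $(\overline{P}^{\lambda_1},P^{\lambda_1},\dots,P^{\lambda_{m-1}},\overline{P}^{\lambda_m})$. Return the concatenated sequences displayed in the claim (the $t$-part in reversed order).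
   Formalization: With ties AlgoRadToRad can cycle, so "returns" there means: every partial run can be completed, and an infinite run stays at one λ. Also λ is capped at 1, and the margin LP is multiplied by the site distance; if it has no optimum, any feasible γ is allowed. *)

theory Defs
  imports "HOL-Analysis.Analysis" "Graph_Theory.Arc_Walk"
begin

text \<open>
  The items are \<open>x j\<close> for \<open>j :: 'n\<close>, the item set is \<open>range x\<close>, and the clusters are indexed by
  \<open>'k\<close>; so \<open>n\<close>, \<open>d\<close>, \<open>k\<close> are the cardinalities of the index types. Site vectors and clustering
  vectors live in \<open>(real^'d)^'k\<close>, assignment vectors \<open>y\<close> in \<open>(real^'n)^'k\<close>, with \<open>y $ i $ j\<close> for the
  entry of cluster \<open>i\<close> and item \<open>j\<close>.
\<close>

type_synonym ('d, 'k) clustering = "'k \<Rightarrow> (real^'d) set"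
type_synonym ('d, 'k) diagram = "'k \<Rightarrow> (real^'d) set"
type_synonym ('d, 'k) sites = "(real^'d)^'k"

section \<open>Clusterings and constrained least-squares assignments\<close>

definition clustering :: "(real^'d) set \<Rightarrow> ('d::finite, 'k::finite) clustering \<Rightarrow> bool" where
  "clustering X C \<longleftrightarrow> (\<Union>i. C i) = X \<and> (\<forall>i l. i \<noteq> l \<longrightarrow> C i \<inter> C l = {})"

definition shape :: "('d::finite, 'k::finite) clustering \<Rightarrow> 'k \<Rightarrow> nat" where
  "shape C = (\<lambda>i. card (C i))"

definition feasible_shape :: "('k \<Rightarrow> nat) \<Rightarrow> ('k \<Rightarrow> nat) \<Rightarrow> ('k::finite \<Rightarrow> nat) \<Rightarrow> bool" where
  "feasible_shape lo up \<sigma> \<longleftrightarrow> (\<forall>i. lo i \<le> \<sigma> i \<and> \<sigma> i \<le> up i)"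

definition feasible_clustering ::
  "(real^'d) set \<Rightarrow> ('k \<Rightarrow> nat) \<Rightarrow> ('k \<Rightarrow> nat) \<Rightarrow> ('d::finite, 'k::finite) clustering \<Rightarrow> bool" where
  "feasible_clustering X lo up C \<longleftrightarrow> clustering X C \<and> feasible_shape lo up (shape C)"

definition feasible_shapes ::
  "(real^'d::finite) set \<Rightarrow> ('k \<Rightarrow> nat) \<Rightarrow> ('k \<Rightarrow> nat) \<Rightarrow> ('k::finite \<Rightarrow> nat) set" where
  "feasible_shapes X lo up = shape ` {C. feasible_clustering X lo up C}"

definition lsa_cost :: "('d, 'k) sites \<Rightarrow> ('d::finite, 'k::finite) clustering \<Rightarrow> real" where
  "lsa_cost a C = (\<Sum>i\<in>UNIV. \<Sum>z\<in>C i. (norm (z - a $ i))\<^sup>2)"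

definition constrained_LSA_for ::
  "(real^'d) set \<Rightarrow> ('d, 'k) sites \<Rightarrow> ('d::finite, 'k::finite) clustering \<Rightarrow> bool" where
  "constrained_LSA_for X a C \<longleftrightarrow> clustering X C \<and>
     (\<forall>D. clustering X D \<and> shape D = shape C \<longrightarrow> lsa_cost a C \<le> lsa_cost a D)"

definition constrained_LSA :: "(real^'d) set \<Rightarrow> ('d::finite, 'k::finite) clustering \<Rightarrow> bool" where
  "constrained_LSA X C \<longleftrightarrow> (\<exists>a. constrained_LSA_for X a C)"


section \<open>Partition and transportation polytopes\<close>

definition clustering_vector :: "('d::finite, 'k::finite) clustering \<Rightarrow> (real^'d)^'k" where
  "clustering_vector C = (\<chi> i. \<Sum>z\<in>C i. z)"

definition partition_polytope ::
  "(real^'d::finite) set \<Rightarrow> ('k \<Rightarrow> nat) \<Rightarrow> ('k::finite \<Rightarrow> nat) \<Rightarrow> ((real^'d)^'k) set" where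
  "partition_polytope X lo up = convex hull (clustering_vector ` {C. feasible_clustering X lo up C})"

definition transportation_polytope ::
  "('k \<Rightarrow> nat) \<Rightarrow> ('k::finite \<Rightarrow> nat) \<Rightarrow> ((real^'n::finite)^'k) set" where
  "transportation_polytope lo up =
     {y. (\<forall>i j. 0 \<le> y $ i $ j) \<and> (\<forall>j. (\<Sum>i\<in>UNIV. y $ i $ j) = 1) \<and>
         (\<forall>i. real (lo i) \<le> (\<Sum>j\<in>UNIV. y $ i $ j) \<and> (\<Sum>j\<in>UNIV. y $ i $ j) \<le> real (up i))}"

definition assignment_vector ::
  "('n \<Rightarrow> real^'d) \<Rightarrow> ('d::finite, 'k::finite) clustering \<Rightarrow> (real^'n::finite)^'k" where
  "assignment_vector x C = (\<chi> i j. if x j \<in> C i then 1 else 0)"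

definition objective :: "('n \<Rightarrow> real^'d) \<Rightarrow> ('d::finite, 'k::finite) sites \<Rightarrow> (real^'n::finite)^'k" where
  "objective x a = (\<chi> i j. x j \<bullet> a $ i)"

definition maximizes_over :: "'v::real_inner \<Rightarrow> 'v set \<Rightarrow> 'v \<Rightarrow> bool" where
  "maximizes_over c S v \<longleftrightarrow> v \<in> S \<and> (\<forall>w\<in>S. c \<bullet> w \<le> c \<bullet> v)"

definition normal_cone :: "'v::real_inner set \<Rightarrow> 'v \<Rightarrow> 'v set" where
  "normal_cone S v = {c. maximizes_over c S v}"

text \<open>Clusterings within the bounds stand for the vertices of the transportation polytope.\<close>

definition adjacent ::
  "('n::finite \<Rightarrow> real^'d) \<Rightarrow> ('k \<Rightarrow> nat) \<Rightarrow> ('k \<Rightarrow> nat) \<Rightarrow>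
   ('d::finite, 'k::finite) clustering \<Rightarrow> ('d, 'k) clustering \<Rightarrow> bool" where
  "adjacent x lo up C D \<longleftrightarrow>
     feasible_clustering (range x) lo up C \<and> feasible_clustering (range x) lo up D \<and> C \<noteq> D \<and>
     (\<exists>e. e edge_of (transportation_polytope lo up :: ((real^'n)^'k) set) \<and>
          assignment_vector x C \<in> e \<and> assignment_vector x D \<in> e)"

definition radial_in_partition ::
  "(real^'d) set \<Rightarrow> ('k \<Rightarrow> nat) \<Rightarrow> ('k \<Rightarrow> nat) \<Rightarrow> ('d, 'k) sites \<Rightarrow>
   ('d::finite, 'k::finite) clustering \<Rightarrow> bool" where
  "radial_in_partition X lo up a C \<longleftrightarrow> feasible_clustering X lo up C \<and>
     maximizes_over a (partition_polytope X lo up) (clustering_vector C)"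

definition radial_in_transportation ::
  "('n::finite \<Rightarrow> real^'d) \<Rightarrow> ('k \<Rightarrow> nat) \<Rightarrow> ('k \<Rightarrow> nat) \<Rightarrow> ('d, 'k) sites \<Rightarrow>
   ('d::finite, 'k::finite) clustering \<Rightarrow> bool" where
  "radial_in_transportation x lo up a C \<longleftrightarrow> feasible_clustering (range x) lo up C \<and>
     maximizes_over (objective x a) (transportation_polytope lo up) (assignment_vector x C)"


section \<open>Power diagrams\<close>

definition power_diagram ::
  "('d, 'k) sites \<Rightarrow> real^'k \<Rightarrow> ('d::finite, 'k::finite) diagram" where
  "power_diagram a \<gamma> =
     (\<lambda>i. {z. \<forall>l. l \<noteq> i \<longrightarrow> (a $ l - a $ i) \<bullet> z \<le> \<gamma> $ l - \<gamma> $ i})"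

definition separating_for ::
  "('d, 'k) sites \<Rightarrow> ('d, 'k) diagram \<Rightarrow> ('d::finite, 'k::finite) clustering \<Rightarrow> bool" where
  "separating_for a P C \<longleftrightarrow> (\<exists>\<gamma>. P = power_diagram a \<gamma>) \<and> (\<forall>i. C i \<subseteq> P i)"

definition separating :: "('d, 'k) diagram \<Rightarrow> ('d::finite, 'k::finite) clustering \<Rightarrow> bool" where
  "separating P C \<longleftrightarrow> (\<exists>a. separating_for a P C)"

definition separable :: "('d::finite, 'k::finite) clustering \<Rightarrow> bool" where
  "separable C \<longleftrightarrow> (\<exists>P. separating P C)"

definition shared_for ::
  "('d, 'k) sites \<Rightarrow> ('d, 'k) diagram \<Rightarrow>
   ('d::finite, 'k::finite) clustering \<Rightarrow> ('d, 'k) clustering \<Rightarrow> bool" where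
  "shared_for a P C D \<longleftrightarrow> separating_for a P C \<and> separating_for a P D"

text \<open>
  The index \<open>i1\<close> is the cluster whose parameter is normalized to \<open>0\<close>. A maximum over an empty
  cluster is read as minus infinity, so that it gives no constraint.

  The constraints of the margin LP are multiplied by the norm of \<open>a $ l - a $ i\<close>, which changes
  nothing for distinct sites and gives a meaning to them for coinciding sites. The LP is feasible
  but has no optimal solution exactly if the margin is unbounded (for instance with empty
  clusters); then any feasible solution may be taken.
\<close>

definition margin_feasible ::
  "'k \<Rightarrow> ('d, 'k) sites \<Rightarrow> ('d::finite, 'k::finite) clustering \<Rightarrow> real \<Rightarrow> real^'k \<Rightarrow> bool" where
  "margin_feasible i1 a C \<epsilon> \<gamma> \<longleftrightarrow> 0 \<le> \<epsilon> \<and> \<gamma> $ i1 = 0 \<and>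
     (\<forall>i l. i \<noteq> l \<longrightarrow>
        (\<forall>z\<in>C i. (a $ l - a $ i) \<bullet> z + \<epsilon> * norm (a $ l - a $ i) \<le> \<gamma> $ l - \<gamma> $ i))"

definition margin_optimal ::
  "'k \<Rightarrow> ('d, 'k) sites \<Rightarrow> ('d::finite, 'k::finite) clustering \<Rightarrow> real \<Rightarrow> real^'k \<Rightarrow> bool" where
  "margin_optimal i1 a C \<epsilon> \<gamma> \<longleftrightarrow> margin_feasible i1 a C \<epsilon> \<gamma> \<and>
     (\<forall>\<epsilon>' \<gamma>'. margin_feasible i1 a C \<epsilon>' \<gamma>' \<longrightarrow> \<epsilon>' \<le> \<epsilon>)"

definition from_margin_LP ::
  "'k \<Rightarrow> ('d, 'k) sites \<Rightarrow> ('d::finite, 'k::finite) clustering \<Rightarrow> ('d, 'k) diagram \<Rightarrow> bool" where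
  "from_margin_LP i1 a C P \<longleftrightarrow>
     (\<exists>\<epsilon> \<gamma>. margin_feasible i1 a C \<epsilon> \<gamma> \<and>
        ((\<exists>\<epsilon>' \<gamma>'. margin_optimal i1 a C \<epsilon>' \<gamma>') \<longrightarrow> margin_optimal i1 a C \<epsilon> \<gamma>) \<and>
        P = power_diagram a \<gamma>)"

definition from_shared_system ::
  "'k \<Rightarrow> ('d, 'k) sites \<Rightarrow> ('d::finite, 'k::finite) clustering \<Rightarrow> ('d, 'k) clustering \<Rightarrow>
   ('d, 'k) diagram \<Rightarrow> bool" where
  "from_shared_system i1 a C D P \<longleftrightarrow>
     (\<exists>\<gamma>. \<gamma> $ i1 = 0 \<and>
        (\<forall>i l. i \<noteq> l \<longrightarrow>
           (\<forall>z\<in>C i. (a $ l - a $ i) \<bullet> z \<le> \<gamma> $ l - \<gamma> $ i) \<and>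
           (\<forall>z\<in>D i. (a $ l - a $ i) \<bullet> z \<le> \<gamma> $ l - \<gamma> $ i)) \<and>
        P = power_diagram a \<gamma>)"


section \<open>Exchanges\<close>

text \<open>The arc \<open>(i, z, l)\<close> goes from \<open>i\<close> to \<open>l\<close> and has label \<open>z\<close>.\<close>

definition CDG ::
  "('d::finite, 'k::finite) clustering \<Rightarrow> ('d, 'k) clustering \<Rightarrow>
   ('k, 'k \<times> (real^'d) \<times> 'k) pre_digraph" where
  "CDG C D = \<lparr>verts = UNIV, arcs = {(i, z, l). i \<noteq> l \<and> z \<in> C i \<inter> D l},
              tail = (\<lambda>(i, z, l). i), head = (\<lambda>(i, z, l). l)\<rparr>"

definition cyclical_exchange ::
  "('d::finite, 'k::finite) clustering \<Rightarrow> ('d, 'k) clustering \<Rightarrow> bool" where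
  "cyclical_exchange C D \<longleftrightarrow> (\<exists>p. pre_digraph.cycle (CDG C D) p \<and> set p = arcs (CDG C D))"

definition sequential_exchange ::
  "('d::finite, 'k::finite) clustering \<Rightarrow> ('d, 'k) clustering \<Rightarrow> bool" where
  "sequential_exchange C D \<longleftrightarrow>
     (\<exists>u p v. p \<noteq> [] \<and> pre_digraph.apath (CDG C D) u p v \<and> set p = arcs (CDG C D))"


section \<open>Nondeterministic loops\<close>

text \<open>
  A loop is given by its possible initial states, its possible iterations, and its exit condition.
  In a loop that completes, every partial run can be continued until the loop is left; in
  particular no partial run gets stuck.
\<close>

definition loop_returns ::
  "('\<sigma> \<Rightarrow> bool) \<Rightarrow> ('\<sigma> \<Rightarrow> '\<sigma> \<Rightarrow> bool) \<Rightarrow> ('\<sigma> \<Rightarrow> bool) \<Rightarrow> '\<sigma> \<Rightarrow> bool" where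
  "loop_returns start iter exit \<sigma> \<longleftrightarrow> (\<exists>\<sigma>\<^sub>0. start \<sigma>\<^sub>0 \<and> iter\<^sup>*\<^sup>* \<sigma>\<^sub>0 \<sigma> \<and> exit \<sigma>)"

definition loop_completes ::
  "('\<sigma> \<Rightarrow> bool) \<Rightarrow> ('\<sigma> \<Rightarrow> '\<sigma> \<Rightarrow> bool) \<Rightarrow> ('\<sigma> \<Rightarrow> bool) \<Rightarrow> bool" where
  "loop_completes start iter exit \<longleftrightarrow> (\<exists>\<sigma>. start \<sigma>) \<and>
     (\<forall>\<sigma>\<^sub>0 \<sigma>. start \<sigma>\<^sub>0 \<and> iter\<^sup>*\<^sup>* \<sigma>\<^sub>0 \<sigma> \<longrightarrow> (\<exists>\<sigma>'. iter\<^sup>*\<^sup>* \<sigma> \<sigma>' \<and> exit \<sigma>'))"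

definition infinite_run ::
  "('\<sigma> \<Rightarrow> bool) \<Rightarrow> ('\<sigma> \<Rightarrow> '\<sigma> \<Rightarrow> bool) \<Rightarrow> (nat \<Rightarrow> '\<sigma>) \<Rightarrow> bool" where
  "infinite_run start iter f \<longleftrightarrow> start (f 0) \<and> (\<forall>r. iter (f r) (f (Suc r)))"


section \<open>From a constrained LSA to a radial clustering\<close>

text \<open>
  A state consists of the clusterings \<open>C\<^sup>0, \<dots>, C\<^sup>r\<close> and of the alternating sequence of \<open>2 r + 1\<close>
  diagrams in which position \<open>2 i\<close> belongs to \<open>C\<^sup>i\<close> and position \<open>2 i - 1\<close> to the pair
  \<open>C\<^sup>i\<^sup>-\<^sup>1, C\<^sup>i\<close>.
\<close>

type_synonym ('d, 'k) LSA_state = "('d, 'k) clustering list \<times> ('d, 'k) diagram list"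

definition LSAtoRad_start ::
  "'k \<Rightarrow> ('d::finite, 'k::finite) sites \<Rightarrow> ('d, 'k) clustering \<Rightarrow> ('d, 'k) LSA_state \<Rightarrow> bool" where
  "LSAtoRad_start i1 a C \<sigma> \<longleftrightarrow> (\<exists>P. from_margin_LP i1 a C P \<and> \<sigma> = ([C], [P]))"

definition LSAtoRad_exit ::
  "('n::finite \<Rightarrow> real^'d) \<Rightarrow> ('d::finite, 'k::finite) sites \<Rightarrow> ('k \<Rightarrow> nat) \<Rightarrow> ('k \<Rightarrow> nat) \<Rightarrow>
   ('d, 'k) LSA_state \<Rightarrow> bool" where
  "LSAtoRad_exit x a lo up \<sigma> \<longleftrightarrow>
     maximizes_over (objective x a) (transportation_polytope lo up)
       (assignment_vector x (last (fst \<sigma>)))"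

text \<open>In the rule, \<open>D\<close> is the result of the simplex step and \<open>C'\<close> is the next clustering.\<close>

inductive LSAtoRad_iter ::
  "('n::finite \<Rightarrow> real^'d) \<Rightarrow> 'k \<Rightarrow> ('d::finite, 'k::finite) sites \<Rightarrow> ('k \<Rightarrow> nat) \<Rightarrow> ('k \<Rightarrow> nat) \<Rightarrow>
   ('d, 'k) LSA_state \<Rightarrow> ('d, 'k) LSA_state \<Rightarrow> bool"
  for x i1 a lo up where
  "LSAtoRad_iter x i1 a lo up (Cs, Ps) (Cs @ [C'], Ps @ [Q, P])"
  if "\<not> LSAtoRad_exit x a lo up (Cs, Ps)"
    and "adjacent x lo up (last Cs) D"
    and "objective x a \<bullet> assignment_vector x (last Cs) < objective x a \<bullet> assignment_vector x D"
    and "clustering (range x) C'"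
    and "maximizes_over (objective x a) (transportation_polytope (shape D) (shape D))
           (assignment_vector x C')"
    and "sequential_exchange (last Cs) C'"
    and "from_shared_system i1 a (last Cs) C' Q"
    and "from_margin_LP i1 a C' P"


section \<open>From a radial clustering to a radial clustering\<close>

text \<open>
  A state consists of \<open>\<tau>\<^sub>0, \<dots>, \<tau>\<^sub>r\<close>, starting with \<open>0\<close>, the corresponding clusterings, and the alternating sequence of
  \<open>2 r - 1\<close> diagrams (none if \<open>r = 0\<close>), in which position \<open>2 (i - 1)\<close> belongs to the pair of
  clusterings \<open>i - 1\<close> and \<open>i\<close>, and position \<open>2 i - 1\<close> belongs to clustering \<open>i\<close>.
\<close>

type_synonym ('d, 'k) Rad_state =
  "real list \<times> ('d, 'k) clustering list \<times> ('d, 'k) diagram list"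

definition sites_at ::
  "('d::finite, 'k::finite) sites \<Rightarrow> ('d, 'k) sites \<Rightarrow> real \<Rightarrow> ('d, 'k) sites" where
  "sites_at s t \<tau> = (1 - \<tau>) *\<^sub>R s + \<tau> *\<^sub>R t"

text \<open>
  The parameter ranges over \<open>{0..1}\<close>: a clustering that stays optimal up to the target sites has
  the breakpoint \<open>1\<close>. With ties, the breakpoint can be equal to the current parameter \<open>\<mu>\<close>.
\<close>

definition ranging_breakpoint ::
  "('n::finite \<Rightarrow> real^'d) \<Rightarrow> ('k \<Rightarrow> nat) \<Rightarrow> ('k \<Rightarrow> nat) \<Rightarrow> ('d, 'k) sites \<Rightarrow> ('d, 'k) sites \<Rightarrow>
   ('d::finite, 'k::finite) clustering \<Rightarrow> real \<Rightarrow> real \<Rightarrow> bool" where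
  "ranging_breakpoint x lo up s t C \<mu> \<tau> \<longleftrightarrow>
     (let N = normal_cone (transportation_polytope lo up) (assignment_vector x C)
      in \<tau> \<in> {\<mu>..1} \<and> objective x (sites_at s t \<tau>) \<in> N \<and>
         (\<forall>\<nu>\<in>{\<tau><..1}. objective x (sites_at s t \<nu>) \<notin> N))"

definition RadToRad_start ::
  "('d::finite, 'k::finite) clustering \<Rightarrow> ('d, 'k) Rad_state \<Rightarrow> bool" where
  "RadToRad_start C \<sigma> \<longleftrightarrow> \<sigma> = ([0], [C], [])"

definition RadToRad_exit ::
  "('d::finite, 'k::finite) clustering \<Rightarrow> ('d, 'k) Rad_state \<Rightarrow> bool" where
  "RadToRad_exit Ct \<sigma> \<longleftrightarrow> last (fst (snd \<sigma>)) = Ct"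

inductive RadToRad_iter ::
  "('n::finite \<Rightarrow> real^'d) \<Rightarrow> 'k \<Rightarrow> ('d, 'k) sites \<Rightarrow> ('d, 'k) sites \<Rightarrow> ('k \<Rightarrow> nat) \<Rightarrow> ('k \<Rightarrow> nat) \<Rightarrow>
   ('d::finite, 'k::finite) clustering \<Rightarrow> ('d, 'k) Rad_state \<Rightarrow> ('d, 'k) Rad_state \<Rightarrow> bool"
  for x i1 s t lo up Ct where
  "RadToRad_iter x i1 s t lo up Ct (Ls, Cs, Ps) (Ls @ [\<tau>], Cs @ [C'], Ps @ Ms @ [Q])"
  if "\<not> RadToRad_exit Ct (Ls, Cs, Ps)"
    and "ranging_breakpoint x lo up s t (last Cs) (last Ls) \<tau>"
    and "adjacent x lo up (last Cs) C'"
    and "objective x (sites_at s t \<tau>) \<in>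
           normal_cone (transportation_polytope lo up) (assignment_vector x (last Cs)) \<inter>
           normal_cone (transportation_polytope lo up) (assignment_vector x C')"
    and "from_shared_system i1 (sites_at s t \<tau>) (last Cs) C' Q"
    and "if length Cs = 1 then Ms = []
         else \<exists>P. Ms = [P] \<and>
           from_margin_LP i1 ((1/2) *\<^sub>R (sites_at s t (last Ls) + sites_at s t \<tau>)) (last Cs) P"


section \<open>The overall transition\<close>

definition lower_sizes ::
  "('d::finite, 'k::finite) clustering \<Rightarrow> ('d, 'k) clustering \<Rightarrow> 'k \<Rightarrow> nat" where
  "lower_sizes C D = (\<lambda>i. min (card (C i)) (card (D i)))"

definition upper_sizes ::
  "('d::finite, 'k::finite) clustering \<Rightarrow> ('d, 'k) clustering \<Rightarrow> 'k \<Rightarrow> nat" where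
  "upper_sizes C D = (\<lambda>i. max (card (C i)) (card (D i)))"

text \<open>
  \<open>transition_returns\<close> holds if some run yields the outputs \<open>(CS, PS)\<close>, \<open>(CT, PT)\<close> and
  \<open>(Ls, CL, PL)\<close> of the three subroutine calls and the overall output \<open>(Cout, Pout)\<close>.
\<close>

definition transition_returns ::
  "('n::finite \<Rightarrow> real^'d) \<Rightarrow> 'k \<Rightarrow> ('d::finite, 'k::finite) clustering \<Rightarrow> ('d, 'k) clustering \<Rightarrow>
   ('d, 'k) sites \<Rightarrow> ('d, 'k) sites \<Rightarrow> ('d, 'k) LSA_state \<Rightarrow> ('d, 'k) LSA_state \<Rightarrow>
   ('d, 'k) Rad_state \<Rightarrow> ('d, 'k) clustering list \<times> ('d, 'k) diagram list \<Rightarrow> bool" where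
  "transition_returns x i1 Cs Ct s t = (\<lambda>(CS, PS) (CT, PT) (Ls, CL, PL) (Cout, Pout).
     let lo = lower_sizes Cs Ct; up = upper_sizes Cs Ct
     in loop_returns (LSAtoRad_start i1 s Cs) (LSAtoRad_iter x i1 s lo up)
          (LSAtoRad_exit x s lo up) (CS, PS) \<and>
        loop_returns (LSAtoRad_start i1 t Ct) (LSAtoRad_iter x i1 t lo up)
          (LSAtoRad_exit x t lo up) (CT, PT) \<and>
        loop_returns (RadToRad_start (last CS)) (RadToRad_iter x i1 s t lo up (last CT))
          (RadToRad_exit (last CT)) (Ls, CL, PL) \<and>
        Cout = CS @ tl CL @ tl (rev CT) \<and>
        Pout = PS @ PL @ rev PT)"

end

theory Submission
  imports Defs
begin

text \<open>
  Clusterings are assignments \<open>f\<close> of items to clusters, and an exchange is a walk in the difference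
  graph. If no cycle (and no path between clusters that may shrink and grow) improves \<open>f\<close>, then
  longest-path potentials \<open>\<gamma>\<close> exist. They certify optimality over the transportation polytope, which
  is therefore the hull of the assignments, and they define separating power diagrams; by
  complementary slackness one \<open>\<gamma>\<close> serves all optimal assignments, which gives the shared diagrams.

  Two assignments span an edge of the polytope iff their difference cannot be split into two
  feasible parts, so an edge is a single cycle or path. Minimal differences yield improving edges,
  edges between optimal assignments, and, for an assignment optimal in its shape, an optimal
  assignment of a neighbouring shape that is one path away. The first loop thus strictly increases
  the objective. In the second one a clustering determines its breakpoint, so there are finitely
  many breakpoints; at each of them one can walk inside the optimal face to a clustering that stays
  optimal beyond it.
\<close>

section \<open>Assignments of items to clusters\<close>

text \<open>All splitting arguments rest on one identity: for a set \<open>J\<close> of items,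
  \<open>override_on f g J\<close> and \<open>override_on g f J\<close> carry out a part of the
  change from \<open>f\<close> to \<open>g\<close> and the complementary part, and their sizes and
  objective values add up to those of \<open>f\<close> and \<open>g\<close>. So if both parts are
  feasible, one of them improves on \<open>f\<close> whenever \<open>g\<close> does, and both are
  optimal whenever \<open>f\<close> and \<open>g\<close> are. Choosing \<open>g\<close> with as few
  differing items as possible therefore yields edges, without bases or pivot rules. Two obstacles
  shape the rest. Consecutive clusterings of the first loop have different shapes and different
  values, so complementary slackness for the given objective does not produce their shared diagram;
  the objective is first changed on one cluster. In the second loop ties are allowed: a breakpoint
  may repeat, and a run may go back and forth between clusterings that are optimal for the same
  parameter. Hence the claim there is that each partial run can be continued to the exit, and that
  the parameters of an infinite run become constant.\<close>

definition psize :: "('n::finite \<Rightarrow> 'k::finite) \<Rightarrow> 'k \<Rightarrow> nat" where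
  "psize f i = card {j. f j = i}"

definition avec :: "('n::finite \<Rightarrow> 'k::finite) \<Rightarrow> (real^'n)^'k" where
  "avec f = (\<chi> i j. if f j = i then 1 else 0)"

lemma inner_avec: "c \<bullet> avec f = (\<Sum>j\<in>UNIV. c $ f j $ j)"
proof -
  have "c \<bullet> avec f = (\<Sum>i\<in>UNIV. \<Sum>j\<in>UNIV. if f j = i then c $ i $ j else 0)"
    by (simp add: inner_vec_def avec_def if_distrib cong: if_cong)
  also have "\<dots> = (\<Sum>j\<in>UNIV. \<Sum>i\<in>UNIV. if f j = i then c $ i $ j else 0)"
    by (rule sum.swap)
  finally show ?thesis by simp
qed

lemma psize_eq_sum: "int (psize f i) = (\<Sum>j\<in>UNIV. of_bool (f j = i))"
  by (simp add: psize_def of_bool_def sum.If_cases)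

lemma sum_psize: "(\<Sum>i\<in>UNIV. psize f i) = CARD('n)" for f :: "'n::finite \<Rightarrow> 'k::finite"
  unfolding psize_def by (subst card_UN_disjoint[symmetric]) (auto intro!: arg_cong[of _ _ card])

lemma psize_override_on:
  "psize (override_on f g J) i + psize (override_on g f J) i = psize f i + psize g i"
proof -
  have "int (psize (override_on f g J) i + psize (override_on g f J) i) = int (psize f i + psize g i)"
    unfolding of_nat_add psize_eq_sum sum.distrib[symmetric]
    by (rule sum.cong) (auto simp: override_on_def)
  then show ?thesis by (simp only: of_nat_eq_iff)
qed

lemma inner_avec_override_on:
  "c \<bullet> avec (override_on f g J) + c \<bullet> avec (override_on g f J) = c \<bullet> avec f + c \<bullet> avec g"
  unfolding inner_avec sum.distrib[symmetric]
  by (rule sum.cong) (auto simp: override_on_def)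

section \<open>Walks of exchanges\<close>

fun walk :: "'k \<Rightarrow> ('k \<times> 'n \<times> 'k) list \<Rightarrow> 'k \<Rightarrow> bool" where
  "walk u [] v \<longleftrightarrow> u = v"
| "walk u ((i, j, l) # ps) v \<longleftrightarrow> i = u \<and> walk l ps v"

fun move :: "('k \<times> 'n \<times> 'k) list \<Rightarrow> ('n \<Rightarrow> 'k) \<Rightarrow> 'n \<Rightarrow> 'k" where
  "move [] f = f"
| "move ((i, j, l) # ps) f = (move ps f)(j := l)"

text \<open>With the objective as \<open>h\<close> this is the gain of the moves; with the indicator
  of a cluster as \<open>h\<close> it is the change of its size. The values are in an arbitrary
  abelian group to cover both the real and the integer case.\<close>

definition weight :: "('k \<Rightarrow> 'n \<Rightarrow> 'a::ab_group_add) \<Rightarrow> ('k \<times> 'n \<times> 'k) list \<Rightarrow> 'a" where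
  "weight h ps = (\<Sum>(i, j, l)\<leftarrow>ps. h l j - h i j)"

text \<open>Stationary moves (\<open>l = f j\<close>) are included, so that the inequality for
  potentials can be proved for all \<open>l\<close> at once.\<close>

definition arcs_from :: "('n \<Rightarrow> 'k) \<Rightarrow> ('k \<times> 'n \<times> 'k) set" where
  "arcs_from f = {(f j, j, l) | j l. True}"

definition exchange_arcs :: "('n \<Rightarrow> 'k) \<Rightarrow> ('n \<Rightarrow> 'k) \<Rightarrow> ('k \<times> 'n \<times> 'k) set" where
  "exchange_arcs f g = {(f j, j, g j) | j. f j \<noteq> g j}"

lemma exchange_arcs_subset: "exchange_arcs f g \<subseteq> arcs_from f"
  by (auto simp: exchange_arcs_def arcs_from_def)

lemma weight_simps [simp]:
  "weight h [] = 0"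
  "weight h ((i, j, l) # ps) = h l j - h i j + weight h ps"
  "weight h (ps @ qs) = weight h ps + weight h qs"
  by (simp_all add: weight_def)

lemma weight_telescope: "walk u ps v \<Longrightarrow> weight (\<lambda>i j. h i) ps = h v - h u"
  by (induction ps arbitrary: u) auto

lemma walk_append [simp]: "walk u (ps @ qs) v \<longleftrightarrow> (\<exists>w. walk u ps w \<and> walk w qs v)"
  by (induction ps arbitrary: u) auto

lemma walk_nodes: "walk u ps v \<Longrightarrow> u # map (snd \<circ> snd) ps = map fst ps @ [v]"
  by (induction ps arbitrary: u) auto

text \<open>Cutting at the first visit to \<open>w\<close> keeps \<open>w\<close> out of the tails
  of the prefix, so that an arc leaving \<open>w\<close> can close the prefix to a cycle without
  repeating a tail.\<close>

lemma walk_split: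
  assumes "walk u ps v" "w \<in> set (map fst ps @ [v])"
  obtains qs rs where "ps = qs @ rs" "walk u qs w" "walk w rs v" "w \<notin> set (map fst qs)"
  using assms
proof (induction ps arbitrary: u thesis)
  case Nil
  then show ?case by (metis append_Nil empty_iff empty_set list.simps(8) self_append_conv2 set_ConsD walk.simps(1))
next
  case (Cons a ps)
  obtain i j l where a: "a = (i, j, l)" by (cases a) auto
  show ?case
  proof (cases "w = u")
    case True
    then show ?thesis using Cons.prems by (intro Cons.prems(1)[of "[]" "a # ps"]) auto
  next
    case False
    then have "walk l ps v" "w \<in> set (map fst ps @ [v])" using Cons.prems a by auto
    then obtain qs rs where "ps = qs @ rs" "walk l qs w" "walk w rs v" "w \<notin> set (map fst qs)"
      using Cons.IH by blast
    then show ?thesis using Cons.prems a False by (intro Cons.prems(1)[of "a # qs" rs]) auto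
  qed
qed

lemma sum_fun_upd:
  fixes h :: "'k \<Rightarrow> 'n::finite \<Rightarrow> 'a::ab_group_add"
  shows "(\<Sum>j\<in>UNIV. h ((f(j0 := l)) j) j) = (\<Sum>j\<in>UNIV. h (f j) j) + (h l j0 - h (f j0) j0)"
proof -
  have "(\<Sum>j\<in>UNIV. h ((f(j0 := l)) j) j) = h l j0 + (\<Sum>j\<in>UNIV-{j0}. h ((f(j0 := l)) j) j)"
    by (subst sum.remove[of _ j0]) auto
  also have "(\<Sum>j\<in>UNIV-{j0}. h ((f(j0 := l)) j) j) = (\<Sum>j\<in>UNIV-{j0}. h (f j) j)"
    by (rule sum.cong) auto
  also have "(\<Sum>j\<in>UNIV. h (f j) j) = h (f j0) j0 + (\<Sum>j\<in>UNIV-{j0}. h (f j) j)"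
    by (subst sum.remove[of _ j0]) auto
  ultimately show ?thesis by (simp add: algebra_simps)
qed

lemma move_notin: "j \<notin> (fst \<circ> snd) ` set ps \<Longrightarrow> move ps f j = f j"
  by (induction ps) auto

text \<open>The tail of an arc in \<open>arcs_from f\<close> is the cluster of its item, so equal
  items would have equal tails.\<close>

lemma distinct_items:
  assumes "set ps \<subseteq> arcs_from f" "distinct (map fst ps)"
  shows "distinct (map (fst \<circ> snd) ps)"
  using assms
proof (induction ps)
  case (Cons a ps)
  have "fst (snd a) \<notin> (fst \<circ> snd) ` set ps"
  proof
    assume "fst (snd a) \<in> (fst \<circ> snd) ` set ps"
    then obtain b where b: "b \<in> set ps" "fst (snd a) = fst (snd b)" by auto
    moreover have "fst a = f (fst (snd a))" "fst b = f (fst (snd b))"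
      using Cons.prems b by (auto simp: arcs_from_def)
    ultimately have "fst a \<in> fst ` set ps" by (metis imageI)
    with Cons.prems show False by simp
  qed
  with Cons show ?case by simp
qed simp

text \<open>No item is moved twice, so each arc acts on an item that is still in its original
  cluster, and the contributions simply add up.\<close>

lemma sum_move:
  fixes h :: "'k \<Rightarrow> 'n::finite \<Rightarrow> 'a::ab_group_add"
  assumes "set ps \<subseteq> arcs_from f" "distinct (map fst ps)"
  shows "(\<Sum>j\<in>UNIV. h (move ps f j) j) = (\<Sum>j\<in>UNIV. h (f j) j) + weight h ps"
  using assms
proof (induction ps)
  case (Cons a ps)
  obtain i j l where a: "a = (i, j, l)" by (cases a) auto
  have "j \<notin> (fst \<circ> snd) ` set ps" using distinct_items[OF Cons.prems] a by auto
  then have "move ps f j = i" using Cons.prems a by (auto simp: move_notin arcs_from_def)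
  then show ?case using Cons a sum_fun_upd[of h "move ps f" j l] by (simp add: algebra_simps)
qed simp

lemma inner_move:
  assumes "set ps \<subseteq> arcs_from f" "distinct (map fst ps)"
  shows "c \<bullet> avec (move ps f) = c \<bullet> avec f + weight (\<lambda>i j. c $ i $ j) ps"
  unfolding inner_avec using sum_move[OF assms, of "\<lambda>i j. c $ i $ j"] by simp

lemma psize_move:
  assumes "set ps \<subseteq> arcs_from f" "distinct (map fst ps)" "walk u ps v"
  shows "int (psize (move ps f) i) = int (psize f i) + of_bool (v = i) - of_bool (u = i)"
  unfolding psize_eq_sum
  using sum_move[OF assms(1,2), of "\<lambda>l j. of_bool (l = i) :: int"] weight_telescope[OF assms(3), of "\<lambda>l. of_bool (l = i) :: int"]
  by linarith

lemma move_exchange: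
  assumes "set ps \<subseteq> exchange_arcs f g"
  shows "move ps f = override_on f g ((fst \<circ> snd) ` set ps)"
  using assms
proof (induction ps)
  case (Cons a ps)
  then obtain j where "a = (f j, j, g j)" by (auto simp: exchange_arcs_def)
  with Cons show ?case by (auto simp: override_on_def)
qed simp

text \<open>Otherwise the fibre of \<open>v\<close> under \<open>f\<close> would be a proper subset
  of its fibre under \<open>g\<close>. In the longest-path argument this supplies an arc out of an
  end cluster that does not grow.\<close>

lemma distinct_psize_leave:
  assumes "psize f v \<ge> psize g v" "g j = v" "f j \<noteq> v"
  shows "\<exists>j. f j = v \<and> g j \<noteq> v"
proof (rule ccontr)
  assume "\<not> ?thesis"
  then have "{j. f j = v} \<subset> {j. g j = v}" using assms(2,3) by (intro psubsetI) auto
  then have "card {j. f j = v} < card {j. g j = v}" by (intro psubset_card_mono) auto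
  then show False using assms(1) by (simp add: psize_def)
qed

text \<open>A longest path in the difference graph that starts in a shrinking cluster either ends in a
  growing cluster or can be closed to a cycle.\<close>

lemma ex_simple_exchange:
  fixes f g :: "'n::finite \<Rightarrow> 'k::finite"
  assumes "f \<noteq> g"
  obtains ps u v where "ps \<noteq> []" "set ps \<subseteq> exchange_arcs f g" "walk u ps v" "distinct (map fst ps)"
    "u = v \<or> distinct (map fst ps @ [v]) \<and> psize g u < psize f u \<and> psize f v < psize g v"
proof -
  \<comment> \<open>The walk has to start in a shrinking cluster unless no size changes at all. Both
    size vectors have the same total, so if no cluster shrinks, all sizes agree and any differing
    item will do.\<close>
  have "\<exists>j. f j \<noteq> g j \<and> (psize g (f j) < psize f (f j) \<or> psize f = psize g)"
  proof (cases "\<exists>u. psize g u < psize f u")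
    case True
    then obtain u where u: "psize g u < psize f u" by blast
    then have "\<not> {j. f j = u} \<subseteq> {j. g j = u}" using card_mono[of "{j. g j = u}" "{j. f j = u}"]
      by (auto simp: psize_def)
    then obtain j where "f j = u" "g j \<noteq> u" by blast
    then show ?thesis using u by (intro exI[of _ j]) auto
  next
    case False
    then have "\<forall>i\<in>UNIV. psize f i \<le> psize g i" by (simp add: not_less)
    have "psize f i = psize g i" for i
      by (rule sum_mono_inv[of "psize f" UNIV "psize g"])
        (use \<open>\<forall>i\<in>UNIV. psize f i \<le> psize g i\<close> in \<open>auto simp only: sum_psize finite UNIV_I\<close>)
    then have "psize f = psize g" by auto
    with assms show ?thesis by auto
  qed
  then obtain j0 where j0: "f j0 \<noteq> g j0" "psize g (f j0) < psize f (f j0) \<or> psize f = psize g" by blast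
  define u where "u = f j0"
  define R where "R = exchange_arcs f g"
  define good where "good ps \<longleftrightarrow> (\<exists>v. set ps \<subseteq> R \<and> walk u ps v \<and> distinct (map fst ps @ [v]))" for ps
  have "length ps < Suc (card R)" if "good ps" for ps
  proof -
    have "distinct ps" "set ps \<subseteq> R" using that by (auto simp: good_def distinct_map)
    then show ?thesis using distinct_card[of ps] card_mono[of R "set ps"] by simp
  qed
  moreover have "good []" by (simp add: good_def)
  ultimately obtain ps where ps: "good ps" "\<And>qs. good qs \<Longrightarrow> length qs \<le> length ps"
    using ex_has_greatest_nat[of good "[]" length "Suc (card R)"] by metis
  then obtain v where v: "set ps \<subseteq> R" "walk u ps v" "distinct (map fst ps @ [v])"
    by (auto simp: good_def)
  show thesis
  proof (cases "psize f v < psize g v")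
    case True
    then have "psize g u < psize f u" using j0 u_def by auto
    moreover from this True have "ps \<noteq> []" using v by auto
    ultimately show ?thesis using that v True R_def by auto
  next
    case False
    have "\<exists>j. f j = v \<and> g j \<noteq> v"
    proof (cases "ps = []")
      case True
      then show ?thesis using v j0 u_def by auto
    next
      case ne: False
      have "last (u # map (snd \<circ> snd) ps) = v" using walk_nodes[OF v(2)] by simp
      with ne have "snd (snd (last ps)) = v" by (simp add: last_map)
      moreover have "last ps \<in> R" using v ne by auto
      ultimately obtain j where "f j \<noteq> g j" "g j = v" by (auto simp: R_def exchange_arcs_def)
      then show ?thesis using distinct_psize_leave[of g v f j] False by auto
    qed
    then obtain j where j: "f j = v" "g j \<noteq> v" by blast
    have jR: "(v, j, g j) \<in> R" using j by (auto simp: R_def exchange_arcs_def)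
    define qs where "qs = ps @ [(v, j, g j)]"
    have "\<not> good qs" using ps(2)[of qs] qs_def by auto
    then have "g j \<in> set (map fst ps @ [v])"
      using v jR unfolding good_def qs_def by auto
    then obtain as bs where ab: "ps = as @ bs" "walk u as (g j)" "walk (g j) bs v"
      using walk_split[OF v(2)] by blast
    show ?thesis
      by (rule that[of "bs @ [(v, j, g j)]" "g j" "g j"]) (use v ab jR R_def in auto)
  qed
qed

section \<open>Optimal assignments, potentials and linear programming duality\<close>

definition optimal ::
  "(real^'n)^'k \<Rightarrow> ('k \<Rightarrow> nat) \<Rightarrow> ('k \<Rightarrow> nat) \<Rightarrow> ('n::finite \<Rightarrow> 'k::finite) \<Rightarrow> bool" where
  "optimal c lo up f \<longleftrightarrow> feasible_shape lo up (psize f) \<and>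
     (\<forall>g. feasible_shape lo up (psize g) \<longrightarrow> c \<bullet> avec g \<le> c \<bullet> avec f)"

text \<open>This is dual feasibility together with complementary slackness, in reduced form:
  \<open>\<gamma> i\<close> is the multiplier of the upper bound of cluster \<open>i\<close> minus
  that of its lower bound, and the multiplier of the equation for item \<open>j\<close> has been
  eliminated as \<open>c $ f j $ j - \<gamma> (f j)\<close>.\<close>

definition dual ::
  "(real^'n)^'k \<Rightarrow> ('k \<Rightarrow> nat) \<Rightarrow> ('k \<Rightarrow> nat) \<Rightarrow> ('n::finite \<Rightarrow> 'k::finite) \<Rightarrow> ('k \<Rightarrow> real) \<Rightarrow> bool" where
  "dual c lo up f \<gamma> \<longleftrightarrow>
     (\<forall>j l. c $ l $ j - c $ f j $ j \<le> \<gamma> l - \<gamma> (f j)) \<and>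
     (\<forall>i. psize f i < up i \<longrightarrow> \<gamma> i \<le> 0) \<and>
     (\<forall>i. lo i < psize f i \<longrightarrow> 0 \<le> \<gamma> i)"

text \<open>The potential of a cluster is minus the largest value of a path of moves that starts there,
  where a path is penalized unless it ends in a cluster that may grow.\<close>

lemma optimal_imp_dual:
  fixes f :: "'n::finite \<Rightarrow> 'k::finite"
  assumes "optimal c lo up f"
  obtains \<gamma> where "dual c lo up f \<gamma>"
proof -
  define w where "w = weight (\<lambda>i j. c $ i $ j)"
  define P where "P i = {(ps, v). set ps \<subseteq> arcs_from f \<and> walk i ps v \<and> distinct (map fst ps @ [v])}" for i
  have w_le: "w ps \<le> 0"
    if "set ps \<subseteq> arcs_from f" "distinct (map fst ps)" "walk u ps v"
      "u = v \<or> lo u < psize f u \<and> psize f v < up v" for ps u v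
  proof -
    have "feasible_shape lo up (psize (move ps f))"
      unfolding feasible_shape_def
    proof
      fix i
      have "lo i \<le> psize f i \<and> psize f i \<le> up i"
        using assms by (auto simp: optimal_def feasible_shape_def)
      then show "lo i \<le> psize (move ps f) i \<and> psize (move ps f) i \<le> up i"
        using psize_move[OF that(1-3), of i] that(4) by (auto simp: of_bool_def split: if_splits)
    qed
    then show ?thesis
      using assms inner_move[OF that(1,2), of c] by (auto simp: optimal_def w_def)
  qed
  have fin: "finite (P i)" for i
  proof -
    have "finite ({ps. set ps \<subseteq> arcs_from f \<and> distinct ps} \<times> (UNIV :: 'k set))"
      by (intro finite_cartesian_product finite_subset_distinct) auto
    then show ?thesis
      by (rule rev_finite_subset) (auto simp: P_def distinct_map)
  qed
  \<comment> \<open>The penalty is the largest weight of any path: subtracting it makes every path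
    that ends in a full cluster worth at most \<open>0\<close>, which is just enough for the sign
    condition at clusters that may shrink.\<close>
  define M where "M = Max (\<Union>i. (\<lambda>(ps, v). w ps) ` P i)"
  have M: "w ps \<le> M" if "(ps, v) \<in> P i" for ps v i
    unfolding M_def by (rule Max_ge) (use fin that in \<open>auto intro!: image_eqI[of _ _ "(ps, v)"]\<close>)
  define \<tau> where "\<tau> v = (if psize f v < up v then 0 else - M)" for v
  define \<delta> where "\<delta> i = Max ((\<lambda>(ps, v). w ps + \<tau> v) ` P i)" for i
  have \<delta>_ge: "w ps + \<tau> v \<le> \<delta> i" if "(ps, v) \<in> P i" for ps v i
    unfolding \<delta>_def by (rule Max_ge) (use fin that in \<open>auto intro!: image_eqI[of _ _ "(ps, v)"]\<close>)
  have nil: "([], i) \<in> P i" for i by (simp add: P_def)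
  have \<delta>_in: "\<exists>(ps, v)\<in>P i. \<delta> i = w ps + \<tau> v" for i
  proof -
    have "\<delta> i \<in> (\<lambda>(ps, v). w ps + \<tau> v) ` P i"
      unfolding \<delta>_def using fin nil by (intro Max_in) auto
    then show ?thesis by auto
  qed
  have "c $ l $ j - c $ f j $ j + \<delta> l \<le> \<delta> (f j)" for j l
  proof -
    obtain ps v where ps: "(ps, v) \<in> P l" "\<delta> l = w ps + \<tau> v" using \<delta>_in[of l] by blast
    show ?thesis
    proof (cases "f j \<in> set (map fst ps @ [v])")
      case False
      then have "((f j, j, l) # ps, v) \<in> P (f j)"
        using ps(1) by (auto simp: P_def arcs_from_def)
      then show ?thesis using \<delta>_ge ps(2) by (fastforce simp: w_def)
    next
      case True
      moreover have "walk l ps v" using ps(1) by (simp add: P_def)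
      ultimately obtain qs rs where qr: "ps = qs @ rs" "walk l qs (f j)" "walk (f j) rs v"
        "f j \<notin> set (map fst qs)" using walk_split by metis
      \<comment> \<open>The best path from \<open>l\<close> visits \<open>f j\<close>. Its part up
        to there forms a cycle with the new arc and cannot gain, while the rest is one of the paths
        over which \<open>\<delta> (f j)\<close> is the maximum.\<close>
      have "w ((f j, j, l) # qs) \<le> 0"
        by (rule w_le[of _ "f j" "f j"]) (use qr ps(1) in \<open>auto simp: P_def arcs_from_def\<close>)
      moreover have "(rs, v) \<in> P (f j)" using qr ps(1) by (auto simp: P_def)
      then have "w rs + \<tau> v \<le> \<delta> (f j)" by (rule \<delta>_ge)
      ultimately show ?thesis using ps(2) qr(1) by (simp add: w_def)
    qed
  qed
  moreover have "0 \<le> \<delta> i" if "psize f i < up i" for i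
    using \<delta>_ge[OF nil, of i] that by (simp add: w_def \<tau>_def)
  moreover have "\<delta> i \<le> 0" if "lo i < psize f i" for i
  proof -
    obtain ps v where ps: "(ps, v) \<in> P i" "\<delta> i = w ps + \<tau> v" using \<delta>_in[of i] by blast
    show ?thesis
    proof (cases "psize f v < up v")
      case True
      then have "w ps \<le> 0" using w_le[of ps i v] ps(1) that by (auto simp: P_def)
      then show ?thesis using True ps(2) by (simp add: \<tau>_def)
    next
      case False
      then show ?thesis using M[OF ps(1)] ps(2) by (simp add: \<tau>_def)
    qed
  qed
  ultimately have "dual c lo up f (\<lambda>i. - \<delta> i)" by (auto simp: dual_def algebra_simps)
  then show thesis by (rule that)
qed

lemma sum_comp_psize: "(\<Sum>j\<in>UNIV. r (f j)) = (\<Sum>i\<in>UNIV. r i * real (psize f i))"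
proof -
  have "(\<Sum>j\<in>UNIV. r (f j)) = (\<Sum>i\<in>UNIV. \<Sum>j\<in>{j\<in>UNIV. f j = i}. r (f j))"
    by (rule sum.group[symmetric]) auto
  also have "\<dots> = (\<Sum>i\<in>UNIV. r i * real (psize f i))"
    by (rule sum.cong) (auto simp: psize_def)
  finally show ?thesis .
qed

text \<open>An identity for every \<open>\<gamma>\<close>: since the entries of an item sum to
  \<open>1\<close>, the potentials in the first sum contribute exactly the negative of the second
  sum.\<close>

lemma dual_gap:
  fixes f :: "'n::finite \<Rightarrow> 'k::finite"
  assumes "\<And>j. (\<Sum>i\<in>UNIV. y $ i $ j) = 1"
  shows "c \<bullet> avec f - c \<bullet> y =
    (\<Sum>i\<in>UNIV. \<Sum>j\<in>UNIV. y $ i $ j * (\<gamma> i - \<gamma> (f j) - (c $ i $ j - c $ f j $ j))) +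
    (\<Sum>i\<in>UNIV. \<gamma> i * (real (psize f i) - (\<Sum>j\<in>UNIV. y $ i $ j)))"
proof -
  have 1: "(\<Sum>i\<in>UNIV. \<Sum>j\<in>UNIV. y $ i $ j * h j) = (\<Sum>j\<in>UNIV. h j)" for h :: "'n \<Rightarrow> real"
    by (subst sum.swap) (simp add: sum_distrib_right[symmetric] assms)
  have "(\<Sum>i\<in>UNIV. \<Sum>j\<in>UNIV. y $ i $ j * (\<gamma> i - \<gamma> (f j) - (c $ i $ j - c $ f j $ j))) =
    (\<Sum>i\<in>UNIV. \<Sum>j\<in>UNIV. \<gamma> i * y $ i $ j) - (\<Sum>i\<in>UNIV. \<Sum>j\<in>UNIV. y $ i $ j * \<gamma> (f j))
    - (\<Sum>i\<in>UNIV. \<Sum>j\<in>UNIV. c $ i $ j * y $ i $ j) + (\<Sum>i\<in>UNIV. \<Sum>j\<in>UNIV. y $ i $ j * c $ f j $ j)"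
    by (simp add: algebra_simps sum.distrib sum_subtractf)
  also have "\<dots> = (\<Sum>i\<in>UNIV. \<gamma> i * (\<Sum>j\<in>UNIV. y $ i $ j)) - (\<Sum>i\<in>UNIV. \<gamma> i * real (psize f i))
     - c \<bullet> y + c \<bullet> avec f"
    by (simp add: 1 sum_comp_psize inner_avec sum_distrib_left) (simp add: inner_vec_def)
  finally show ?thesis by (simp add: algebra_simps sum_subtractf)
qed

text \<open>If cluster \<open>i\<close> is at just one of its bounds under \<open>f\<close>, its row
  sum in \<open>y\<close> can deviate from \<open>psize f i\<close> in one direction only, and the
  sign of \<open>\<gamma> i\<close> fits that direction. Strictly between the bounds
  \<open>\<gamma> i\<close> is \<open>0\<close>; if both bounds coincide the deviation is
  \<open>0\<close>.\<close>

lemma dual_gap_nonneg: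
  assumes "dual c lo up f \<gamma>" "y \<in> transportation_polytope lo up"
  shows "0 \<le> y $ i $ j * (\<gamma> i - \<gamma> (f j) - (c $ i $ j - c $ f j $ j))"
    and "0 \<le> \<gamma> i * (real (psize f i) - (\<Sum>j\<in>UNIV. y $ i $ j))"
proof -
  show "0 \<le> y $ i $ j * (\<gamma> i - \<gamma> (f j) - (c $ i $ j - c $ f j $ j))"
    using assms by (auto simp: dual_def transportation_polytope_def)
  have b: "real (lo i) \<le> (\<Sum>j\<in>UNIV. y $ i $ j)" "(\<Sum>j\<in>UNIV. y $ i $ j) \<le> real (up i)"
    using assms(2) by (auto simp: transportation_polytope_def)
  consider "psize f i < up i" "lo i < psize f i" | "psize f i < up i" "psize f i \<le> lo i"
    | "up i \<le> psize f i" "lo i < psize f i" | "up i \<le> psize f i" "psize f i \<le> lo i" by linarith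
  then show "0 \<le> \<gamma> i * (real (psize f i) - (\<Sum>j\<in>UNIV. y $ i $ j))"
  proof cases
    case 1
    then have "\<gamma> i = 0" using assms(1) by (simp add: dual_def antisym)
    then show ?thesis by simp
  next
    case 2
    then show ?thesis using assms(1) b by (intro mult_nonpos_nonpos) (auto simp: dual_def)
  next
    case 3
    then show ?thesis using assms(1) b by (intro mult_nonneg_nonneg) (auto simp: dual_def)
  next
    case 4
    then have "real (psize f i) - (\<Sum>j\<in>UNIV. y $ i $ j) = 0" using b by linarith
    then show ?thesis by simp
  qed
qed

lemma sum_avec: "(\<Sum>j\<in>UNIV. avec f $ i $ j) = real (psize f i)"
  by (simp add: avec_def psize_def sum.If_cases)

lemma avec_in_transportation_iff:
  "avec f \<in> transportation_polytope lo up \<longleftrightarrow> feasible_shape lo up (psize f)"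
  unfolding transportation_polytope_def feasible_shape_def
  by (simp add: sum_avec) (simp add: avec_def)

text \<open>\<open>optimal\<close> compares with assignments only, yet the potentials obtained from
  exchanges bound \<open>c \<bullet> y\<close> for fractional \<open>y\<close> as well. This is
  where integrality of the polytope comes from.\<close>

lemma optimal_iff_maximizes:
  "optimal c lo up f \<longleftrightarrow> maximizes_over c (transportation_polytope lo up) (avec f)"
proof
  assume opt: "optimal c lo up f"
  then obtain \<gamma> where \<gamma>: "dual c lo up f \<gamma>" by (rule optimal_imp_dual)
  have "c \<bullet> y \<le> c \<bullet> avec f" if y: "y \<in> transportation_polytope lo up" for y
  proof -
    have "\<And>j. (\<Sum>i\<in>UNIV. y $ i $ j) = 1" using y by (auto simp: transportation_polytope_def)
    from dual_gap[OF this, of c f \<gamma>] have "0 \<le> c \<bullet> avec f - c \<bullet> y"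
      using dual_gap_nonneg[OF \<gamma> y] by (auto intro!: add_nonneg_nonneg sum_nonneg)
    then show ?thesis by simp
  qed
  then show "maximizes_over c (transportation_polytope lo up) (avec f)"
    using opt by (auto simp: maximizes_over_def optimal_def avec_in_transportation_iff)
qed (auto simp: maximizes_over_def optimal_def avec_in_transportation_iff)

lemma optimal_shared_dual:
  assumes "optimal c lo up f" "optimal c lo up g"
  obtains \<gamma> where "\<And>j l. c $ l $ j - c $ f j $ j \<le> \<gamma> l - \<gamma> (f j)"
    "\<And>j l. c $ l $ j - c $ g j $ j \<le> \<gamma> l - \<gamma> (g j)"
proof -
  obtain \<gamma> where \<gamma>: "dual c lo up f \<gamma>" using assms(1) by (rule optimal_imp_dual)
  have g: "avec g \<in> transportation_polytope lo up"
    using assms(2) by (simp add: optimal_def avec_in_transportation_iff)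
  have "c \<bullet> avec f = c \<bullet> avec g" using assms by (auto simp: optimal_def intro: antisym)
  moreover have "\<And>j. (\<Sum>i\<in>UNIV. avec g $ i $ j) = 1" by (simp add: avec_def)
  ultimately have "(\<Sum>i\<in>UNIV. \<Sum>j\<in>UNIV. avec g $ i $ j * (\<gamma> i - \<gamma> (f j) - (c $ i $ j - c $ f j $ j))) +
    (\<Sum>i\<in>UNIV. \<gamma> i * (real (psize f i) - (\<Sum>j\<in>UNIV. avec g $ i $ j))) = 0"
    using dual_gap[of "avec g" c f \<gamma>] by simp
  then have "(\<Sum>i\<in>UNIV. \<Sum>j\<in>UNIV. avec g $ i $ j * (\<gamma> i - \<gamma> (f j) - (c $ i $ j - c $ f j $ j))) = 0"
    using dual_gap_nonneg[OF \<gamma> g] by (subst (asm) add_nonneg_eq_0_iff) (auto intro!: sum_nonneg)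
  then have z: "avec g $ i $ j * (\<gamma> i - \<gamma> (f j) - (c $ i $ j - c $ f j $ j)) = 0" for i j
    using dual_gap_nonneg(1)[OF \<gamma> g] by (simp add: sum_nonneg_eq_0_iff sum_nonneg)
  \<comment> \<open>The entry of \<open>avec g\<close> at \<open>g j\<close> is \<open>1\<close>, so
    the reduced cost of item \<open>j\<close> vanishes there. Hence \<open>c - \<gamma>\<close>
    takes the same value for \<open>j\<close> in both of its clusters, and the inequalities for
    \<open>f\<close> carry over to \<open>g\<close>.\<close>
  have eq: "c $ g j $ j - \<gamma> (g j) = c $ f j $ j - \<gamma> (f j)" for j
    using z[of "g j" j] by (simp add: avec_def algebra_simps)
  have le: "c $ l $ j - c $ f j $ j \<le> \<gamma> l - \<gamma> (f j)" for j l using \<gamma> by (auto simp: dual_def)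
  have "c $ l $ j - c $ g j $ j \<le> \<gamma> l - \<gamma> (g j)" for j l
    using le[of l j] eq[of j] by linarith
  with le show thesis by (rule that)
qed

lemma ex_optimal:
  fixes f :: "'n::finite \<Rightarrow> 'k::finite"
  assumes "feasible_shape lo up (psize f)"
  obtains g :: "'n \<Rightarrow> 'k" where "optimal c lo up g"
proof -
  define S :: "('n \<Rightarrow> 'k) set" where "S = {g. feasible_shape lo up (psize g)}"
  have "\<exists>g\<in>S. \<forall>h\<in>S. c \<bullet> avec h \<le> c \<bullet> avec g"
  proof -
    have S: "finite S" "S \<noteq> {}" using assms by (auto simp: S_def)
    have "Max ((\<lambda>g. c \<bullet> avec g) ` S) \<in> (\<lambda>g. c \<bullet> avec g) ` S" using S by (intro Max_in) auto
    then obtain g where g: "g \<in> S" "Max ((\<lambda>g. c \<bullet> avec g) ` S) = c \<bullet> avec g" by auto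
    then show ?thesis using S by (intro bexI[of _ g]) (auto simp flip: g(2))
  qed
  then show thesis using that by (auto simp: S_def optimal_def)
qed

lemma convex_transportation:
  "convex (transportation_polytope lo up :: ((real^'n::finite)^'k::finite) set)"
proof (rule convexI)
  fix y z :: "(real^'n)^'k" and u v :: real
  assume y: "y \<in> transportation_polytope lo up" and z: "z \<in> transportation_polytope lo up"
    and uv: "0 \<le> u" "0 \<le> v" "u + v = 1"
  have s: "(\<Sum>j\<in>A. u * a j + v * b j) = u * (\<Sum>j\<in>A. a j) + v * (\<Sum>j\<in>A. b j)"
    for a b :: "'c \<Rightarrow> real" and A by (simp add: sum.distrib sum_distrib_left)
  have le: "u * a + v * b \<le> r" if "a \<le> r" "b \<le> r" for a b r :: real
    using convex_bound_le[OF that uv] .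
  have ge: "r \<le> u * a + v * b" if "r \<le> a" "r \<le> b" for a b r :: real
    using le[of "- a" "- r" "- b"] that by simp
  show "u *\<^sub>R y + v *\<^sub>R z \<in> transportation_polytope lo up"
    using y z uv unfolding transportation_polytope_def by (auto simp: s intro!: le ge)
qed

text \<open>A point of the polytope outside the hull could be strictly separated from it; but for
  the separating direction some assignment is at least as good as every point of the
  polytope.\<close>

lemma transportation_eq_hull:
  fixes f0 :: "'n::finite \<Rightarrow> 'k::finite"
  assumes "feasible_shape lo up (psize f0)"
  shows "transportation_polytope lo up = convex hull (avec ` {f :: 'n \<Rightarrow> 'k. feasible_shape lo up (psize f)})"
    (is "?T = convex hull ?V")
proof
  show "convex hull ?V \<subseteq> ?T"
    using convex_transportation by (intro hull_minimal) (auto simp: avec_in_transportation_iff)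
  show "?T \<subseteq> convex hull ?V"
  proof
    fix y :: "(real^'n)^'k" assume y: "y \<in> ?T"
    show "y \<in> convex hull ?V"
    proof (rule ccontr)
      assume "y \<notin> convex hull ?V"
      moreover have "closed (convex hull ?V)"
        by (intro compact_imp_closed compact_convex_hull finite_imp_compact) auto
      ultimately obtain a b where ab: "a \<bullet> y < b" "\<forall>z\<in>convex hull ?V. b < a \<bullet> z"
        using separating_hyperplane_closed_point[of "convex hull ?V" y] by auto
      obtain f :: "'n \<Rightarrow> 'k" where f: "optimal (- a) lo up f" using ex_optimal[OF assms] by metis
      then have "a \<bullet> avec f \<le> a \<bullet> y" using y by (auto simp: optimal_iff_maximizes maximizes_over_def)
      moreover have "avec f \<in> convex hull ?V" using f by (intro hull_inc) (auto simp: optimal_def)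
      ultimately show False using ab by fastforce
    qed
  qed
qed

section \<open>Edges of the transportation polytope\<close>

definition edge_joined ::
  "('k \<Rightarrow> nat) \<Rightarrow> ('k \<Rightarrow> nat) \<Rightarrow> ('n::finite \<Rightarrow> 'k::finite) \<Rightarrow> ('n \<Rightarrow> 'k) \<Rightarrow> bool" where
  "edge_joined lo up f g \<longleftrightarrow>
     feasible_shape lo up (psize f) \<and> feasible_shape lo up (psize g) \<and> f \<noteq> g \<and>
     (\<exists>e. e edge_of (transportation_polytope lo up :: ((real^'n)^'k) set) \<and> avec f \<in> e \<and> avec g \<in> e)"

text \<open>The exchange is cyclical if \<open>u = v\<close> and sequential otherwise.\<close>

definition simple_exchange ::
  "('n::finite \<Rightarrow> 'k::finite) \<Rightarrow> ('n \<Rightarrow> 'k) \<Rightarrow> 'k \<Rightarrow> ('k \<times> 'n \<times> 'k) list \<Rightarrow> 'k \<Rightarrow> bool" where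
  "simple_exchange f g u ps v \<longleftrightarrow> ps \<noteq> [] \<and> set ps = exchange_arcs f g \<and> walk u ps v \<and>
     distinct (map fst ps) \<and> (u = v \<or> distinct (map fst ps @ [v]))"

lemma avec_eq_iff [simp]: "avec f = avec g \<longleftrightarrow> f = g"
proof
  assume "avec f = avec g"
  show "f = g"
  proof
    fix j
    have "avec f $ f j $ j = avec g $ f j $ j" using \<open>avec f = avec g\<close> by simp
    then show "f j = g j" by (auto simp: avec_def split: if_splits)
  qed
qed simp

lemma override_on_eq_left: "override_on f g J = f \<longleftrightarrow> (\<forall>j\<in>J. f j = g j)"
  by (auto simp: override_on_def fun_eq_iff)

lemma override_on_eq_right: "override_on f g J = g \<longleftrightarrow> (\<forall>j. j \<notin> J \<longrightarrow> f j = g j)"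
  by (auto simp: override_on_def fun_eq_iff)

lemma avec_override_on: "avec (override_on f g J) + avec (override_on g f J) = avec f + avec g"
  by (auto simp: vec_eq_iff avec_def override_on_def)

text \<open>Exchanging a part of the differing items and its complement spans a parallelogram with
  the diagonal from \<open>f\<close> to \<open>g\<close>.\<close>

lemma edge_joined_override_on:
  assumes adj: "edge_joined lo up f g"
    and "feasible_shape lo up (psize (override_on f g J))" "feasible_shape lo up (psize (override_on g f J))"
  shows "override_on f g J = f \<or> override_on f g J = g"
proof -
  define h1 h2 where "h1 = override_on f g J" and "h2 = override_on g f J"
  obtain e where e: "e edge_of transportation_polytope lo up" "avec f \<in> e" "avec g \<in> e" and "f \<noteq> g"
    using adj by (auto simp: edge_joined_def)
  from e(1) have face: "e face_of transportation_polytope lo up" and dim: "aff_dim e = 1"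
    by (auto simp: edge_of_def)
  have "h1 \<noteq> h2"
  proof
    assume "h1 = h2"
    then have "h1 j = h2 j" for j by simp
    then have "f j = g j" for j by (metis h1_def h2_def override_on_def)
    with \<open>f \<noteq> g\<close> show False by auto
  qed
  have "midpoint (avec f) (avec g) \<in> e"
    using closed_segment_subset[OF e(2,3) face_of_imp_convex[OF face]] midpoint_in_closed_segment by blast
  moreover have "midpoint (avec f) (avec g) = midpoint (avec h1) (avec h2)"
    using avec_override_on[of f g J] by (simp add: midpoint_def h1_def h2_def)
  moreover have "midpoint (avec h1) (avec h2) \<in> open_segment (avec h1) (avec h2)"
    using \<open>h1 \<noteq> h2\<close> by simp
  moreover have "avec h1 \<in> transportation_polytope lo up" "avec h2 \<in> transportation_polytope lo up"
    using assms(2,3) by (auto simp: avec_in_transportation_iff h1_def h2_def)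
  ultimately have "avec h1 \<in> e" using face_ofD[OF face] by metis
  then have "{avec f, avec h1, avec g} \<subseteq> e" using e by simp
  moreover have "collinear e" using dim by (simp only: collinear_aff_dim)
  ultimately have "collinear {avec f, avec h1, avec g}" by (rule collinear_subset[rotated])
  then have "avec f = avec g \<or> (\<exists>t. avec h1 = t *\<^sub>R avec f + (1 - t) *\<^sub>R avec g)"
    by (simp only: collinear_3_expand)
  then obtain t where t: "avec h1 = t *\<^sub>R avec f + (1 - t) *\<^sub>R avec g"
    using \<open>f \<noteq> g\<close> by auto
  obtain j where j: "f j \<noteq> g j" using \<open>f \<noteq> g\<close> by auto
  \<comment> \<open>At a differing item the entry of cluster \<open>f j\<close> is \<open>1\<close>
    for \<open>f\<close> and \<open>0\<close> for \<open>g\<close>, so it displays the coefficient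
    \<open>t\<close>; being an entry of a 0/1-vector, it forces \<open>h1\<close> to be an
    endpoint.\<close>
  have "avec h1 $ f j $ j = t" using t j by (simp add: avec_def)
  then have "t = 0 \<or> t = 1" by (auto simp: avec_def split: if_splits)
  then show ?thesis using t by (auto simp: h1_def)
qed

lemma feasible_shape_between:
  assumes "feasible_shape lo up \<sigma>" "feasible_shape lo up \<sigma>'"
    and "\<And>i. min (\<sigma> i) (\<sigma>' i) \<le> \<rho> i \<and> \<rho> i \<le> max (\<sigma> i) (\<sigma>' i)"
  shows "feasible_shape lo up \<rho>"
  unfolding feasible_shape_def
proof
  fix i
  show "lo i \<le> \<rho> i \<and> \<rho> i \<le> up i"
    using assms(1,2) assms(3)[of i] unfolding feasible_shape_def
    by (meson le_max_iff_disj max.bounded_iff min.bounded_iff order_trans max_def min_def dual_order.trans min_le_iff_disj)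
qed

text \<open>The items on the simple walk form \<open>J\<close>. Moving only them is a single
  exchange, and if it is sequential it leads from a cluster that shrinks towards \<open>g\<close> to
  one that grows, so that neither this part nor the remaining one overshoots.\<close>

lemma ex_exchange_piece:
  fixes f g :: "'n::finite \<Rightarrow> 'k::finite"
  assumes "f \<noteq> g"
  obtains ps u v J where "simple_exchange f (override_on f g J) u ps v" "set ps \<subseteq> exchange_arcs f g"
    "override_on f g J \<noteq> f" "u = v \<or> psize g u < psize f u \<and> psize f v < psize g v"
proof -
  obtain ps u v where ps: "ps \<noteq> []" "set ps \<subseteq> exchange_arcs f g" "walk u ps v" "distinct (map fst ps)"
    "u = v \<or> distinct (map fst ps @ [v]) \<and> psize g u < psize f u \<and> psize f v < psize g v"
    using ex_simple_exchange[OF assms] by metis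
  define J where "J = (fst \<circ> snd) ` set ps"
  have J: "j \<in> J \<longleftrightarrow> (f j, j, g j) \<in> set ps" for j
    using ps(2) by (force simp: J_def exchange_arcs_def)
  have "set ps = exchange_arcs f (override_on f g J)"
    using ps(2) by (auto simp: exchange_arcs_def override_on_def J split: if_splits)
  moreover have "override_on f g J \<noteq> f"
  proof -
    have "hd ps \<in> set ps" using ps(1) by simp
    then obtain j where "f j \<noteq> g j" "hd ps = (f j, j, g j)" using ps(2) by (auto simp: exchange_arcs_def)
    then have "f j \<noteq> g j" "j \<in> J" using \<open>hd ps \<in> set ps\<close> J by simp_all
    then show ?thesis by (auto simp: override_on_eq_left)
  qed
  ultimately show thesis using ps that[of J u ps v] by (auto simp: simple_exchange_def)
qed

lemma simple_exchange_psize: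
  assumes "simple_exchange f g u ps v"
  shows "int (psize g i) = int (psize f i) + of_bool (v = i) - of_bool (u = i)"
proof -
  have ps: "set ps = exchange_arcs f g" "walk u ps v" "distinct (map fst ps)"
    using assms by (auto simp: simple_exchange_def)
  have "j \<in> (fst \<circ> snd) ` set ps \<longleftrightarrow> f j \<noteq> g j" for j
    unfolding ps(1) exchange_arcs_def by force
  then have "move ps f = g" using ps(1) move_exchange[of ps f g] by (auto simp: override_on_def fun_eq_iff)
  then show ?thesis using psize_move[of ps f u v i] ps exchange_arcs_subset by metis
qed

text \<open>The piece moves at most one unit of size, in the direction in which \<open>g\<close>
  differs from \<open>f\<close> anyway; so its sizes lie between those of \<open>f\<close> and
  \<open>g\<close>, and by the sum identity so do those of the complementary part.\<close>

lemma piece_feasible: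
  assumes "feasible_shape lo up (psize f)" "feasible_shape lo up (psize g)"
    and "simple_exchange f (override_on f g J) u ps v" "u = v \<or> psize g u < psize f u \<and> psize f v < psize g v"
  shows "feasible_shape lo up (psize (override_on f g J))" "feasible_shape lo up (psize (override_on g f J))"
proof -
  have b: "min (psize f i) (psize g i) \<le> psize (override_on f g J) i \<and>
      psize (override_on f g J) i \<le> max (psize f i) (psize g i)" for i
    using simple_exchange_psize[OF assms(3), of i] assms(4) by (auto simp: of_bool_def split: if_splits)
  show "feasible_shape lo up (psize (override_on f g J))"
    by (rule feasible_shape_between[OF assms(1,2) b])
  have "min (psize f i) (psize g i) \<le> psize (override_on g f J) i \<and>
      psize (override_on g f J) i \<le> max (psize f i) (psize g i)" for i
    using psize_override_on[of f g J i] b[of i] by linarith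
  then show "feasible_shape lo up (psize (override_on g f J))"
    by (rule feasible_shape_between[OF assms(1,2)])
qed

text \<open>A single exchange split off from the difference has a feasible complement; on an edge
  such a split is trivial, so the piece is the whole difference.\<close>

lemma edge_joined_imp_simple_exchange:
  assumes "edge_joined lo up f g"
  obtains u ps v where "simple_exchange f g u ps v"
proof -
  have "f \<noteq> g" "feasible_shape lo up (psize f)" "feasible_shape lo up (psize g)"
    using assms by (auto simp: edge_joined_def)
  moreover obtain ps u v J where J: "simple_exchange f (override_on f g J) u ps v"
    "override_on f g J \<noteq> f" "u = v \<or> psize g u < psize f u \<and> psize f v < psize g v"
    using ex_exchange_piece[OF \<open>f \<noteq> g\<close>] by metis
  ultimately show thesis
    using that edge_joined_override_on[OF assms, of J] piece_feasible[of lo up f g J u ps v] by auto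
qed

text \<open>Each cluster loses at most one item because the tails are distinct. It also receives at
  most one: the heads are the nodes of the walk shifted by one position, hence a permutation of the
  tails for a cycle and the nodes after the first for a path.\<close>

lemma simple_exchange_inj:
  assumes "simple_exchange f g u ps v"
  shows "inj_on f {j. f j \<noteq> g j}" "inj_on g {j. f j \<noteq> g j}"
proof -
  have ps: "set ps = exchange_arcs f g" "distinct (map fst ps)" "u = v \<or> distinct (map fst ps @ [v])"
    "walk u ps v" using assms by (auto simp: simple_exchange_def)
  have nodes: "u # map (snd \<circ> snd) ps = map fst ps @ [v]" using walk_nodes[OF ps(4)] .
  have "distinct (map (snd \<circ> snd) ps)"
  proof (cases "u = v")
    case True
    then have "mset (map (snd \<circ> snd) ps) = mset (map fst ps)"
      using arg_cong[OF nodes, of mset] by simp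
    then show ?thesis using ps(2) by (metis mset_eq_imp_distinct_iff)
  next
    case False
    then show ?thesis using ps(3) nodes by (metis distinct.simps(2))
  qed
  then have heads: "inj_on (snd \<circ> snd) (exchange_arcs f g)" and tails: "inj_on fst (exchange_arcs f g)"
    using ps(1,2) by (auto simp: distinct_map)
  have arc: "(f j, j, g j) \<in> exchange_arcs f g" if "f j \<noteq> g j" for j
    using that by (auto simp: exchange_arcs_def)
  show "inj_on f {j. f j \<noteq> g j}"
    using inj_onD[OF tails _ arc arc] by (intro inj_onI) auto
  show "inj_on g {j. f j \<noteq> g j}"
    using inj_onD[OF heads _ arc arc] by (intro inj_onI) auto
qed

lemma psize_override_on_card:
  "psize (override_on f g K) i + card {j\<in>K. f j = i} = psize f i + card {j\<in>K. g j = i}"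
  for f g :: "'n::finite \<Rightarrow> 'k::finite"
proof -
  have c: "int (card {j\<in>K. h j = i}) = (\<Sum>j\<in>UNIV. of_bool (j \<in> K \<and> h j = i))" for h :: "'n \<Rightarrow> 'k"
    by (simp add: of_bool_def sum.If_cases)
  have "int (psize (override_on f g K) i + card {j\<in>K. f j = i}) = int (psize f i + card {j\<in>K. g j = i})"
    unfolding of_nat_add psize_eq_sum c sum.distrib[symmetric]
    by (rule sum.cong) (auto simp: override_on_def)
  then show ?thesis by (simp only: of_nat_eq_iff)
qed

lemma inj_on_card_fibre:
  "inj_on f D \<Longrightarrow> card {j\<in>D. f j = i} \<le> 1" for f :: "'n::finite \<Rightarrow> 'k"
  by (auto simp: card_le_Suc0_iff_eq inj_on_def)

text \<open>Every cluster loses and gains at most one item between \<open>f\<close> and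
  \<open>g\<close>. Where the two sizes differ, each part of the exchange produces one of them.
  Where they agree, the two parts deviate by opposite amounts of at most \<open>1\<close>; this fits
  unless a bound is attained, and then \<open>tight\<close> excludes any deviation.\<close>

lemma mirror_feasible:
  fixes f g :: "'n::finite \<Rightarrow> 'k::finite"
  assumes feas: "feasible_shape lo up (psize f)" "feasible_shape lo up (psize g)"
    and inj: "inj_on f {j. f j \<noteq> g j}" "inj_on g {j. f j \<noteq> g j}"
    and K: "K \<subseteq> {j. f j \<noteq> g j}"
    and h: "feasible_shape lo up (psize (override_on f g K))"
    and tight: "\<And>i. psize f i = psize g i \<Longrightarrow> psize f i = lo i \<or> psize f i = up i \<Longrightarrow>
      psize (override_on f g K) i = psize f i"
  shows "feasible_shape lo up (psize (override_on g f K))"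
  unfolding feasible_shape_def
proof
  fix i
  let ?D = "{j. f j \<noteq> g j}"
  have g: "override_on f g ?D = g" by (auto simp: override_on_def)
  have 1: "psize (override_on f g K) i + card {j\<in>K. f j = i} = psize f i + card {j\<in>K. g j = i}"
    "psize g i + card {j\<in>?D. f j = i} = psize f i + card {j\<in>?D. g j = i}"
    using psize_override_on_card[of f g K i] psize_override_on_card[of f g ?D i] unfolding g by auto
  have 2: "card {j\<in>K. f j = i} \<le> card {j\<in>?D. f j = i}" "card {j\<in>K. g j = i} \<le> card {j\<in>?D. g j = i}"
    using K by (auto intro!: card_mono)
  have 3: "card {j\<in>?D. f j = i} \<le> 1" "card {j\<in>?D. g j = i} \<le> 1"
    using inj[THEN inj_on_card_fibre, of i] by simp_all
  have 4: "lo i \<le> psize f i" "psize f i \<le> up i" "lo i \<le> psize g i" "psize g i \<le> up i"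
    using feas by (auto simp: feasible_shape_def)
  have 5: "psize (override_on f g K) i + psize (override_on g f K) i = psize f i + psize g i"
    by (rule psize_override_on)
  show "lo i \<le> psize (override_on g f K) i \<and> psize (override_on g f K) i \<le> up i"
  proof (cases "psize f i = psize g i")
    case True
    then show ?thesis using tight[OF True] 1(1) 2 3 4 5 by linarith
  next
    case False
    then show ?thesis using 1 2 3 4 5 by linarith
  qed
qed

text \<open>The converse of \<open>edge_joined_override_on\<close>. The edge is exposed by the objective \<open>a\<close>, which
  penalizes the assignments used by neither \<open>f\<close> nor \<open>g\<close> and the deviations from tight sizes.\<close>

lemma edge_joinedI:
  fixes f g :: "'n::finite \<Rightarrow> 'k::finite"
  assumes feas: "feasible_shape lo up (psize f)" "feasible_shape lo up (psize g)" and "f \<noteq> g"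
    and prim: "\<And>J. feasible_shape lo up (psize (override_on f g J)) \<Longrightarrow>
      feasible_shape lo up (psize (override_on g f J)) \<Longrightarrow> override_on f g J = f \<or> override_on f g J = g"
  shows "edge_joined lo up f g"
proof -
  obtain ps u v J where J: "simple_exchange f (override_on f g J) u ps v"
    "override_on f g J \<noteq> f" "u = v \<or> psize g u < psize f u \<and> psize f v < psize g v"
    using ex_exchange_piece[OF \<open>f \<noteq> g\<close>] by metis
  then have "simple_exchange f g u ps v"
    using prim[of J] piece_feasible[OF feas J(1,3)] by auto
  note inj = simple_exchange_inj[OF this]
  \<comment> \<open>Sizes are rewarded only where \<open>f\<close> and \<open>g\<close> agree and
    attain a bound, with the sign that makes this bound best; thus \<open>f\<close> and
    \<open>g\<close> get the same value and no feasible assignment exceeds it.\<close>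
  define r where "r i = (if psize f i = psize g i \<and> psize f i = up i then 1 :: real
    else if psize f i = psize g i \<and> psize f i = lo i then - 1 else 0)" for i
  define a :: "(real^'n)^'k" where "a = (\<chi> i j. r i - of_bool (i \<noteq> f j \<and> i \<noteq> g j))"
  have val: "a \<bullet> avec h = (\<Sum>i\<in>UNIV. r i * real (psize h i)) - (\<Sum>j\<in>UNIV. of_bool (h j \<noteq> f j \<and> h j \<noteq> g j))" for h
    by (simp add: inner_avec a_def sum_subtractf sum_comp_psize del: of_bool_conj of_bool_not_iff)
  have r_le: "r i * real (psize h i) \<le> r i * real (psize f i)" if "feasible_shape lo up (psize h)" for h i
  proof -
    have "lo i \<le> psize h i" "psize h i \<le> up i" using that by (auto simp: feasible_shape_def)
    then show ?thesis by (simp add: r_def)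
  qed
  have gf: "a \<bullet> avec g = a \<bullet> avec f"
    unfolding val by (auto intro!: sum.cong simp: r_def)
  have sum_le: "(\<Sum>i\<in>UNIV. r i * real (psize h i)) \<le> (\<Sum>i\<in>UNIV. r i * real (psize f i))"
    if "feasible_shape lo up (psize h)" for h
    using r_le[OF that] by (rule sum_mono)
  have pen: "0 \<le> (\<Sum>j\<in>UNIV. of_bool (h j \<noteq> f j \<and> h j \<noteq> g j) :: real)" for h :: "'n \<Rightarrow> 'k"
    by (simp add: sum_nonneg)
  have pen_f: "(\<Sum>j\<in>UNIV. of_bool (f j \<noteq> f j \<and> f j \<noteq> g j) :: real) = 0" by simp
  have opt: "optimal a lo up f"
    unfolding optimal_def val using sum_le pen pen_f feas(1) by (smt (verit))
  have tight: "h = f \<or> h = g" if h: "feasible_shape lo up (psize h)" "a \<bullet> avec h = a \<bullet> avec f" for h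
  proof -
    have "(\<Sum>j\<in>UNIV. of_bool (h j \<noteq> f j \<and> h j \<noteq> g j) :: real) = 0"
      and s: "(\<Sum>i\<in>UNIV. r i * real (psize h i)) = (\<Sum>i\<in>UNIV. r i * real (psize f i))"
      using h(2) sum_le[OF h(1)] pen[of h] pen_f unfolding val by linarith+
    then have hfg: "h j = f j \<or> h j = g j" for j
      by (subst (asm) sum_nonneg_eq_0_iff) auto
    define K where "K = {j. h j \<noteq> f j}"
    have hK: "override_on f g K = h"
    proof
      show "override_on f g K j = h j" for j
        using hfg[of j] by (auto simp: override_on_def K_def)
    qed
    have KD: "K \<subseteq> {j. f j \<noteq> g j}" using hfg K_def by fastforce
    have "r i * real (psize h i) = r i * real (psize f i)" for i
      using sum_mono_inv[OF s r_le[OF h(1)]] by simp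
    then have "r i = 0 \<or> psize h i = psize f i" for i by simp
    then have "psize h i = psize f i" if "psize f i = psize g i" "psize f i = lo i \<or> psize f i = up i" for i
      using that by (metis r_def zero_neq_one neg_equal_0_iff_equal)
    then have "feasible_shape lo up (psize (override_on g f K))"
      using mirror_feasible[OF feas inj KD] h(1) unfolding hK by blast
    then show ?thesis using prim[of K] h(1) unfolding hK by blast
  qed
  define T :: "((real^'n)^'k) set" where "T = transportation_polytope lo up"
  define F where "F = T \<inter> {y. a \<bullet> y = a \<bullet> avec f}"
  have face: "F face_of T"
    unfolding F_def using opt convex_transportation
    by (intro face_of_Int_supporting_hyperplane_le)
       (auto simp: optimal_iff_maximizes maximizes_over_def T_def)
  have T: "T = convex hull (avec ` {f :: 'n \<Rightarrow> 'k. feasible_shape lo up (psize f)})"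
    using transportation_eq_hull[OF feas(1)] T_def by simp
  have "compact (avec ` {f :: 'n \<Rightarrow> 'k. feasible_shape lo up (psize f)})"
    by (intro finite_imp_compact) auto
  then obtain S where S: "S \<subseteq> avec ` {f :: 'n \<Rightarrow> 'k. feasible_shape lo up (psize f)}" "F = convex hull S"
    using face_of_convex_hull_subset face T by metis
  have "S \<subseteq> {avec f, avec g}"
  proof
    fix y assume "y \<in> S"
    then obtain h where h: "y = avec h" "feasible_shape lo up (psize h)" using S(1) by auto
    moreover have "y \<in> F" using \<open>y \<in> S\<close> S(2) by (simp add: hull_inc)
    ultimately show "y \<in> {avec f, avec g}" using tight by (auto simp: F_def)
  qed
  have fgF: "avec f \<in> F" "avec g \<in> F"
    using feas gf by (auto simp: F_def T_def avec_in_transportation_iff)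
  have "F = convex hull {avec f, avec g}"
  proof
    show "F \<subseteq> convex hull {avec f, avec g}"
      unfolding S(2) using \<open>S \<subseteq> {avec f, avec g}\<close> by (rule hull_mono)
    show "convex hull {avec f, avec g} \<subseteq> F"
      using fgF face_of_imp_convex[OF face] by (intro hull_minimal) auto
  qed
  then have "aff_dim F = 1"
    using \<open>f \<noteq> g\<close> by (simp add: aff_dim_convex_hull aff_dim_2)
  then show ?thesis
    using face fgF feas \<open>f \<noteq> g\<close> unfolding edge_joined_def edge_of_def T_def by blast
qed

section \<open>Extremal choices: improving edges, edges in optimal faces, neighbouring
  shapes\<close>

lemma card_differ_override_on:
  fixes f g :: "'n::finite \<Rightarrow> 'k"
  assumes "override_on f g J \<noteq> g"
  shows "card {j. f j \<noteq> override_on f g J j} < card {j. f j \<noteq> g j}"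
proof (rule psubset_card_mono)
  obtain j where "j \<notin> J" "f j \<noteq> g j" using assms by (auto simp: override_on_eq_right)
  then show "{j. f j \<noteq> override_on f g J j} \<subset> {j. f j \<noteq> g j}"
    by (intro psubsetI) (auto simp: override_on_def split: if_splits)
qed simp

lemma override_on_swap: "override_on g f J = override_on f g (- J)"
  by (auto simp: override_on_def)

text \<open>Take an improving \<open>g\<close> that differs from \<open>f\<close> in as few items as
  possible. If the difference splits into two feasible parts, their gains add up to a positive
  number, so one part improves on its own, and by minimality it is everything.\<close>

lemma ex_improving_adjacent:
  fixes f :: "'n::finite \<Rightarrow> 'k::finite"
  assumes f: "feasible_shape lo up (psize f)" and "\<not> optimal c lo up f"
  obtains g where "edge_joined lo up f g" "c \<bullet> avec f < c \<bullet> avec g"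
proof -
  define better where "better g \<longleftrightarrow> feasible_shape lo up (psize g) \<and> c \<bullet> avec f < c \<bullet> avec g" for g
  obtain g0 where "better g0" using assms by (auto simp: optimal_def better_def not_le)
  then obtain g where g: "better g"
    "\<And>h. better h \<Longrightarrow> card {j. f j \<noteq> g j} \<le> card {j. f j \<noteq> h j}"
    using ex_has_least_nat[of better g0 "\<lambda>h. card {j. f j \<noteq> h j}"] by metis
  have eq: "override_on f g J = g" if "better (override_on f g J)" for J
    using g(2)[OF that] card_differ_override_on[of f g J] by linarith
  have "edge_joined lo up f g"
  proof (rule edge_joinedI)
    fix J
    assume "feasible_shape lo up (psize (override_on f g J))" "feasible_shape lo up (psize (override_on g f J))"
    moreover have "c \<bullet> avec (override_on f g J) + c \<bullet> avec (override_on g f J) = c \<bullet> avec f + c \<bullet> avec g"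
      by (rule inner_avec_override_on)
    ultimately consider "better (override_on f g J)" | "better (override_on g f J)"
      using g(1) unfolding better_def by linarith
    then show "override_on f g J = f \<or> override_on f g J = g"
    proof cases
      case 1
      then show ?thesis using eq by blast
    next
      case 2
      then have "override_on g f J = g" using eq unfolding override_on_swap[of g f] by blast
      then show ?thesis by (auto simp: override_on_eq_left)
    qed
  qed (use f g(1) in \<open>auto simp: better_def\<close>)
  with g(1) that show thesis by (auto simp: better_def)
qed

text \<open>Both values are at most the maximum and they sum to twice the maximum.\<close>

lemma optimal_override_on:
  assumes "optimal c lo up f" "optimal c lo up g"
    and "feasible_shape lo up (psize (override_on f g J))" "feasible_shape lo up (psize (override_on g f J))"
  shows "optimal c lo up (override_on f g J)" "optimal c lo up (override_on g f J)"
proof -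
  have "c \<bullet> avec f = c \<bullet> avec g" using assms by (auto simp: optimal_def intro: antisym)
  moreover have "c \<bullet> avec (override_on f g J) \<le> c \<bullet> avec f" "c \<bullet> avec (override_on g f J) \<le> c \<bullet> avec f"
    using assms by (auto simp: optimal_def)
  ultimately have "c \<bullet> avec (override_on f g J) = c \<bullet> avec f" "c \<bullet> avec (override_on g f J) = c \<bullet> avec f"
    using inner_avec_override_on[of c f g J] by linarith+
  then show "optimal c lo up (override_on f g J)" "optimal c lo up (override_on g f J)"
    using assms by (auto simp: optimal_def)
qed

text \<open>Among the optimal hybrids of \<open>f\<close> and \<open>g\<close> other than
  \<open>f\<close>, one closest to \<open>f\<close> is joined to it by an edge, since a feasible
  split would give a closer optimal hybrid. A hybrid agrees with \<open>g\<close> wherever it leaves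
  \<open>f\<close>, so each such step brings the walk nearer to \<open>g\<close>.\<close>

lemma ex_optimal_adjacent_towards:
  fixes f g :: "'n::finite \<Rightarrow> 'k::finite"
  assumes f: "optimal c lo up f" and g: "optimal c lo up g" and "f \<noteq> g"
  obtains h where "edge_joined lo up f h" "optimal c lo up h" "card {j. h j \<noteq> g j} < card {j. f j \<noteq> g j}"
proof -
  define good where "good h \<longleftrightarrow> optimal c lo up h \<and> h \<noteq> f \<and> (\<exists>J. h = override_on f g J)" for h
  have "override_on f g UNIV = g" by (auto simp: override_on_def)
  then have "good g" using assms unfolding good_def by metis
  then obtain h where h: "good h"
    "\<And>h'. good h' \<Longrightarrow> card {j. f j \<noteq> h j} \<le> card {j. f j \<noteq> h' j}"
    using ex_has_least_nat[of good g "\<lambda>h. card {j. f j \<noteq> h j}"] by metis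
  then obtain J where J: "h = override_on f g J" and "optimal c lo up h" "h \<noteq> f" by (auto simp: good_def)
  have sub: "override_on f h K = override_on f g (K \<inter> J)" for K
    by (auto simp: J override_on_def)
  have eq: "override_on f h K = f \<or> override_on f h K = h" if "optimal c lo up (override_on f h K)" for K
  proof (rule ccontr)
    assume neq: "\<not> ?thesis"
    then have "good (override_on f h K)" using that sub[of K] unfolding good_def by metis
    then show False using h(2) card_differ_override_on[of f h K] neq by fastforce
  qed
  have "edge_joined lo up f h"
  proof (rule edge_joinedI)
    fix K
    assume "feasible_shape lo up (psize (override_on f h K))" "feasible_shape lo up (psize (override_on h f K))"
    then show "override_on f h K = f \<or> override_on f h K = h"
      using eq optimal_override_on[OF f \<open>optimal c lo up h\<close>] by blast
  qed (use f \<open>optimal c lo up h\<close> \<open>h \<noteq> f\<close> in \<open>auto simp: optimal_def\<close>)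
  moreover have "card {j. h j \<noteq> g j} < card {j. f j \<noteq> g j}"
  proof (rule psubset_card_mono)
    obtain j where "j \<in> J" "f j \<noteq> g j" using \<open>h \<noteq> f\<close> J by (auto simp: override_on_eq_left)
    then show "{j. h j \<noteq> g j} \<subset> {j. f j \<noteq> g j}"
      unfolding J by (intro psubsetI) (auto simp: override_on_def split: if_splits)
  qed simp
  ultimately show thesis using that \<open>optimal c lo up h\<close> by blast
qed

lemma feasible_shape_self [simp]: "feasible_shape \<sigma> \<sigma> \<rho> \<longleftrightarrow> \<rho> = \<sigma>"
  by (auto simp: feasible_shape_def fun_eq_iff intro: antisym)

lemma optimal_own_shape: "optimal c lo up f \<Longrightarrow> optimal c (psize f) (psize f) f"
  by (auto simp: optimal_def)

text \<open>Among the optimal assignments of the new shape take \<open>g\<close> closest to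
  \<open>f\<close>, and split off a single exchange. If it is a cycle, it cannot improve
  \<open>f\<close>, so omitting it from \<open>g\<close> loses nothing and contradicts minimality.
  If it is a path, the rest keeps the shape of \<open>f\<close> and cannot gain, so the path alone
  is already optimal and is all of \<open>g\<close>.\<close>

lemma ex_optimal_sequential:
  fixes f g0 :: "'n::finite \<Rightarrow> 'k::finite"
  assumes f: "optimal c (psize f) (psize f) f"
    and adj: "edge_joined lo up f g0" and less: "c \<bullet> avec f < c \<bullet> avec g0"
  obtains g u ps v where "optimal c (psize g0) (psize g0) g" "simple_exchange f g u ps v" "u \<noteq> v"
proof -
  obtain u0 ps0 v0 where "simple_exchange f g0 u0 ps0 v0" using edge_joined_imp_simple_exchange[OF adj] .
  note sz0 = simple_exchange_psize[OF this]
  have "psize g0 \<noteq> psize f" using f less by (auto simp: optimal_def)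
  then have "u0 \<noteq> v0" using sz0 by (auto simp: fun_eq_iff)
  define opt where "opt g \<longleftrightarrow> optimal c (psize g0) (psize g0) g" for g
  have "feasible_shape (psize g0) (psize g0) (psize g0)" by simp
  then obtain g1 where "opt g1" unfolding opt_def by (rule ex_optimal)
  then obtain g where g: "opt g" "\<And>h. opt h \<Longrightarrow> card {j. f j \<noteq> g j} \<le> card {j. f j \<noteq> h j}"
    using ex_has_least_nat[of opt g1 "\<lambda>h. card {j. f j \<noteq> h j}"] by metis
  have eq: "override_on f g J = g" if "opt (override_on f g J)" for J
    using g(2)[OF that] card_differ_override_on[of f g J] by linarith
  have sz: "psize g = psize g0" using g(1) by (simp add: opt_def optimal_def)
  then have "f \<noteq> g" using \<open>psize g0 \<noteq> psize f\<close> by auto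
  then obtain ps u v J where J: "simple_exchange f (override_on f g J) u ps v"
    "override_on f g J \<noteq> f" "u = v \<or> psize g u < psize f u \<and> psize f v < psize g v"
    using ex_exchange_piece by metis
  note szJ = simple_exchange_psize[OF J(1)]
  have val: "c \<bullet> avec (override_on f g J) + c \<bullet> avec (override_on g f J) = c \<bullet> avec f + c \<bullet> avec g"
    by (rule inner_avec_override_on)
  have psum: "psize (override_on f g J) i + psize (override_on g f J) i = psize f i + psize g i" for i
    by (rule psize_override_on)
  have optI: "opt h" if "psize h = psize g" "c \<bullet> avec g \<le> c \<bullet> avec h" for h
    using that g(1) sz unfolding opt_def optimal_def by (auto intro: order_trans)
  have f_max: "c \<bullet> avec h \<le> c \<bullet> avec f" if "psize h = psize f" for h
    using f that by (auto simp: optimal_def)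
  show thesis
  proof (cases "u = v")
    case True
    then have "psize (override_on f g J) = psize f" using szJ by (auto simp: fun_eq_iff)
    moreover from this have "psize (override_on g f J) = psize g" using psum by (auto simp: fun_eq_iff)
    ultimately have "opt (override_on g f J)" using f_max[of "override_on f g J"] val by (intro optI) auto
    then have "override_on g f J = g" using eq unfolding override_on_swap[of g f] by blast
    then show ?thesis using J(2) by (auto simp: override_on_eq_left)
  next
    case False
    \<comment> \<open>The shapes of \<open>f\<close> and \<open>g\<close> differ only at the ends of
      the original exchange, by one unit each, so every sequential piece has these same ends and
      reaches the full shape of \<open>g\<close>.\<close>
    have "u = u0" "v = v0"
      using J(3) False sz0[of u] sz0[of v] sz by (auto simp: of_bool_def split: if_splits)
    then have "int (psize (override_on f g J) i) = int (psize g i)" for i using szJ[of i] sz0[of i] sz by simp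
    then have "psize (override_on f g J) = psize g" by auto
    moreover from this have "psize (override_on g f J) = psize f" using psum by (auto simp: fun_eq_iff)
    ultimately have "opt (override_on f g J)" using f_max[of "override_on g f J"] val by (intro optI) auto
    then have "override_on f g J = g" using eq by blast
    then show ?thesis using J(1) False g(1) that by (auto simp: opt_def)
  qed
qed

text \<open>Raising the objective on the shrinking cluster \<open>u\<close> by the gain of the exchange makes both
  assignments optimal among the shapes between theirs, while potentials are only shifted at \<open>u\<close>.\<close>

lemma sequential_shared_dual:
  fixes f g :: "'n::finite \<Rightarrow> 'k::finite"
  assumes f: "optimal c (psize f) (psize f) f" and g: "optimal c (psize g) (psize g) g"
    and exch: "simple_exchange f g u ps v" "u \<noteq> v"
  obtains \<gamma> where "\<And>j l. c $ l $ j - c $ f j $ j \<le> \<gamma> l - \<gamma> (f j)"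
    "\<And>j l. c $ l $ j - c $ g j $ j \<le> \<gamma> l - \<gamma> (g j)"
proof -
  note sz = simple_exchange_psize[OF exch(1)]
  define \<theta> where "\<theta> = c \<bullet> avec g - c \<bullet> avec f"
  define r where "r i = (if i = u then \<theta> else 0)" for i
  define c' :: "(real^'n)^'k" where "c' = (\<chi> i j. c $ i $ j + r i)"
  define lo up where "lo i = min (psize f i) (psize g i)" and "up i = max (psize f i) (psize g i)" for i
  have val: "c' \<bullet> avec h = c \<bullet> avec h + \<theta> * real (psize h u)" for h
  proof -
    have "(\<Sum>i\<in>UNIV. r i * real (psize h i)) = \<theta> * real (psize h u)"
      by (simp add: r_def if_distrib[of "\<lambda>y. y * _"] cong: if_cong)
    then show ?thesis by (simp add: inner_avec c'_def sum.distrib sum_comp_psize)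
  qed
  have "int (psize g u) = int (psize f u) - 1" using sz[of u] exch(2) by simp
  then have su: "real (psize f u) = real (psize g u) + 1" by linarith
  have eq: "c' \<bullet> avec g = c' \<bullet> avec f"
    unfolding val su by (simp add: \<theta>_def algebra_simps)
  \<comment> \<open>The bounds leave one unit of freedom at \<open>u\<close> and at \<open>v\<close>
    and none elsewhere; as the total is fixed, the two choices are coupled.\<close>
  have shapes: "psize h = psize f \<or> psize h = psize g" if "feasible_shape lo up (psize h)" for h :: "'n \<Rightarrow> 'k"
  proof -
    have b: "lo i \<le> psize h i" "psize h i \<le> up i" for i using that by (auto simp: feasible_shape_def)
    have other: "psize h i = psize f i" if "i \<noteq> u" "i \<noteq> v" for i
      using b[of i] sz[of i] that by (simp add: lo_def up_def)
    have "(\<Sum>i\<in>UNIV. int (psize h i) - int (psize f i)) = 0"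
      using sum_psize[of h] sum_psize[of f] by (simp add: sum_subtractf flip: of_nat_sum)
    also have "(\<Sum>i\<in>UNIV. int (psize h i) - int (psize f i)) = (\<Sum>i\<in>{u, v}. int (psize h i) - int (psize f i))"
      by (rule sum.mono_neutral_right) (auto simp: other)
    finally have uv: "int (psize h u) - int (psize f u) + (int (psize h v) - int (psize f v)) = 0"
      using exch(2) by simp
    have "psize h u = psize f u \<or> psize h u = psize g u"
      using b[of u] sz[of u] exch(2) by (auto simp: lo_def up_def)
    then show ?thesis
    proof
      assume "psize h u = psize f u"
      then have "psize h i = psize f i" for i using uv other[of i] by (cases "i = u"; cases "i = v") auto
      then show ?thesis by auto
    next
      assume "psize h u = psize g u"
      then have "int (psize h i) = int (psize g i)" for i
        using uv other[of i] sz[of i] sz[of u] sz[of v] exch(2) by (cases "i = u"; cases "i = v") auto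
      then show ?thesis by auto
    qed
  qed
  have le: "c' \<bullet> avec h \<le> c' \<bullet> avec f" if "feasible_shape lo up (psize h)" for h
    using shapes[OF that]
  proof
    assume "psize h = psize f"
    then show ?thesis using f by (auto simp: val optimal_def)
  next
    assume "psize h = psize g"
    then have "c' \<bullet> avec h \<le> c' \<bullet> avec g" using g by (auto simp: val optimal_def)
    then show ?thesis by (simp add: eq)
  qed
  have feas: "feasible_shape lo up (psize f)" "feasible_shape lo up (psize g)"
    by (auto simp: feasible_shape_def lo_def up_def)
  have "optimal c' lo up f" "optimal c' lo up g" using le feas eq by (auto simp: optimal_def)
  then obtain \<gamma> where \<gamma>: "\<And>j l. c' $ l $ j - c' $ f j $ j \<le> \<gamma> l - \<gamma> (f j)"
    "\<And>j l. c' $ l $ j - c' $ g j $ j \<le> \<gamma> l - \<gamma> (g j)"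
    using optimal_shared_dual by blast
  show thesis
  proof (rule that[of "\<lambda>i. \<gamma> i - r i"])
    show "c $ l $ j - c $ f j $ j \<le> \<gamma> l - r l - (\<gamma> (f j) - r (f j))" for j l
      using \<gamma>(1)[of l j] by (simp add: c'_def)
    show "c $ l $ j - c $ g j $ j \<le> \<gamma> l - r l - (\<gamma> (g j) - r (g j))" for j l
      using \<gamma>(2)[of l j] by (simp add: c'_def)
  qed
qed

section \<open>Clusterings as assignments\<close>

definition clus :: "('n \<Rightarrow> real^'d::finite) \<Rightarrow> ('n::finite \<Rightarrow> 'k::finite) \<Rightarrow> ('d, 'k) clustering" where
  "clus x f = (\<lambda>i. x ` {j. f j = i})"

lemma clus_iff [simp]: "inj x \<Longrightarrow> x j \<in> clus x f i \<longleftrightarrow> f j = i"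
  by (auto simp: clus_def dest: injD)

lemma clus_eq_iff [simp]: "inj x \<Longrightarrow> clus x f = clus x g \<longleftrightarrow> f = g"
proof -
  assume x: "inj x"
  show "clus x f = clus x g \<longleftrightarrow> f = g"
  proof
  assume eq: "clus x f = clus x g"
  show "f = g"
  proof
    show "f j = g j" for j
      using clus_iff[OF x, of j f "f j"] clus_iff[OF x, of j g "f j"] eq by simp
  qed
qed simp
qed

lemma clustering_iff:
  assumes "inj x"
  shows "clustering (range x) C \<longleftrightarrow> (\<exists>f. C = clus x f)"
proof
  assume C: "clustering (range x) C"
  then have "\<exists>i. x j \<in> C i" for j by (auto simp: clustering_def)
  then obtain f where f: "x j \<in> C (f j)" for j by metis
  have "z \<in> C i \<longleftrightarrow> z \<in> clus x f i" for z i
  proof -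
    have "z \<in> range x" if "z \<in> C i" using that C by (auto simp: clustering_def)
    moreover have "x j \<in> C i \<longleftrightarrow> f j = i" for j
      using C f[of j] unfolding clustering_def by blast
    ultimately show ?thesis by (auto simp: clus_def)
  qed
  then show "\<exists>f. C = clus x f" by blast
next
  assume "\<exists>f. C = clus x f"
  then show "clustering (range x) C"
    using assms by (auto simp: clustering_def clus_def dest: injD)
qed

lemma card_clus [simp]: "inj x \<Longrightarrow> card (clus x f i) = psize f i"
  by (simp add: clus_def psize_def card_image inj_on_subset)

lemma shape_clus [simp]: "inj x \<Longrightarrow> shape (clus x f) = psize f"
  by (simp add: shape_def)

lemma assignment_vector_clus [simp]: "inj x \<Longrightarrow> assignment_vector x (clus x f) = avec f"
  by (simp add: assignment_vector_def avec_def)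

lemma feasible_clus:
  "inj x \<Longrightarrow> feasible_clustering (range x) lo up (clus x f) \<longleftrightarrow> feasible_shape lo up (psize f)"
  by (auto simp: feasible_clustering_def clustering_iff)

lemma adjacent_clus: "inj x \<Longrightarrow> adjacent x lo up (clus x f) (clus x g) \<longleftrightarrow> edge_joined lo up f g"
  by (simp add: adjacent_def edge_joined_def feasible_clus)

lemma sum_clus:
  assumes "inj x"
  shows "(\<Sum>i\<in>UNIV. \<Sum>z\<in>clus x f i. h i z) = (\<Sum>j\<in>UNIV. h (f j) (x j))"
proof -
  have "(\<Sum>i\<in>UNIV. \<Sum>z\<in>clus x f i. h i z) = (\<Sum>i\<in>UNIV. \<Sum>j\<in>{j\<in>UNIV. f j = i}. h (f j) (x j))"
    using assms by (intro sum.cong) (auto simp: clus_def sum.reindex inj_on_subset)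
  also have "\<dots> = (\<Sum>j\<in>UNIV. h (f j) (x j))" by (rule sum.group) auto
  finally show ?thesis .
qed

lemma inner_objective_avec: "objective x a \<bullet> avec f = (\<Sum>j\<in>UNIV. x j \<bullet> a $ f j)"
  by (simp add: inner_avec objective_def)

lemma inner_clustering_vector:
  assumes "inj x"
  shows "a \<bullet> clustering_vector (clus x f) = objective x a \<bullet> avec f"
proof -
  have "a \<bullet> clustering_vector (clus x f) = (\<Sum>i\<in>UNIV. \<Sum>z\<in>clus x f i. a $ i \<bullet> z)"
    unfolding inner_vec_def[of a] clustering_vector_def by (simp add: inner_sum_right)
  also have "\<dots> = (\<Sum>j\<in>UNIV. a $ f j \<bullet> x j)" by (rule sum_clus[OF assms])
  finally show ?thesis unfolding inner_objective_avec by (simp only: inner_commute)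
qed

text \<open>The first two terms depend only on the shape. Hence least cost within a shape means
  largest linear objective within that shape.\<close>

lemma lsa_cost_clus:
  assumes "inj x"
  shows "lsa_cost a (clus x f) = (\<Sum>j\<in>UNIV. (norm (x j))\<^sup>2) + (\<Sum>i\<in>UNIV. (norm (a $ i))\<^sup>2 * real (psize f i))
    - 2 * (objective x a \<bullet> avec f)"
proof -
  have "lsa_cost a (clus x f) = (\<Sum>j\<in>UNIV. (norm (x j - a $ f j))\<^sup>2)"
    unfolding lsa_cost_def by (rule sum_clus[OF assms])
  also have "\<dots> = (\<Sum>j\<in>UNIV. (norm (x j))\<^sup>2 + (norm (a $ f j))\<^sup>2 - 2 * (x j \<bullet> a $ f j))"
    by (rule sum.cong) (auto simp: power2_norm_eq_inner algebra_simps inner_commute)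
  finally show ?thesis
    by (simp add: sum.distrib sum_subtractf sum_distrib_left inner_objective_avec sum_comp_psize[of "\<lambda>i. (norm (a $ i))\<^sup>2"])
qed

lemma constrained_LSA_for_clus:
  assumes "inj x"
  shows "constrained_LSA_for (range x) a (clus x f) \<longleftrightarrow> optimal (objective x a) (psize f) (psize f) f"
proof -
  have "constrained_LSA_for (range x) a (clus x f) \<longleftrightarrow>
    (\<forall>g. psize g = psize f \<longrightarrow> lsa_cost a (clus x f) \<le> lsa_cost a (clus x g))"
    unfolding constrained_LSA_for_def clustering_iff[OF assms] using shape_clus[OF assms] by metis
  then show ?thesis by (auto simp: optimal_def lsa_cost_clus[OF assms])
qed

lemma radial_clus:
  assumes "inj x" and opt: "optimal (objective x a) lo up f"
  shows "radial_in_transportation x lo up a (clus x f)" "radial_in_partition (range x) lo up a (clus x f)"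
proof -
  have feas: "feasible_clustering (range x) lo up (clus x f)"
    using assms by (simp add: feasible_clus optimal_def)
  then show "radial_in_transportation x lo up a (clus x f)"
    using assms by (simp add: radial_in_transportation_def optimal_iff_maximizes)
  let ?V = "clustering_vector ` {C. feasible_clustering (range x) lo up C}"
  have "?V \<subseteq> {w. a \<bullet> w \<le> a \<bullet> clustering_vector (clus x f)}"
  proof clarsimp
    fix C assume C: "feasible_clustering (range x) lo up C"
    then obtain g where "C = clus x g" using assms(1) by (auto simp: feasible_clustering_def clustering_iff)
    then show "a \<bullet> clustering_vector C \<le> a \<bullet> clustering_vector (clus x f)"
      using C opt assms(1) by (auto simp: feasible_clus optimal_def inner_clustering_vector)
  qed
  then have "convex hull ?V \<subseteq> {w. a \<bullet> w \<le> a \<bullet> clustering_vector (clus x f)}"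
    by (intro hull_minimal convex_halfspace_le)
  then show "radial_in_partition (range x) lo up a (clus x f)"
    using feas unfolding radial_in_partition_def maximizes_over_def partition_polytope_def
    by (auto intro!: hull_inc)
qed

section \<open>Power diagrams of optimal assignments\<close>

lemma from_margin_LP_separating: "from_margin_LP i1 a C P \<Longrightarrow> separating_for a P C"
  unfolding from_margin_LP_def separating_for_def
proof (elim exE conjE, intro conjI)
  fix \<epsilon> \<gamma> assume *: "margin_feasible i1 a C \<epsilon> \<gamma>" "P = power_diagram a \<gamma>"
  then show "\<exists>\<gamma>. P = power_diagram a \<gamma>" by blast
  have "(a $ l - a $ i) \<bullet> z \<le> \<gamma> $ l - \<gamma> $ i" if "z \<in> C i" "l \<noteq> i" for i l z
  proof -
    have "0 \<le> \<epsilon> * norm (a $ l - a $ i)" using * by (auto simp: margin_feasible_def)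
    moreover have "(a $ l - a $ i) \<bullet> z + \<epsilon> * norm (a $ l - a $ i) \<le> \<gamma> $ l - \<gamma> $ i"
      using * that by (auto simp: margin_feasible_def)
    ultimately show ?thesis by linarith
  qed
  then show "\<forall>i. C i \<subseteq> P i" by (auto simp: * power_diagram_def)
qed

lemma from_shared_system_shared: "from_shared_system i1 a C D P \<Longrightarrow> shared_for a P C D"
  unfolding from_shared_system_def shared_for_def separating_for_def
  by (elim exE conjE) (auto simp: power_diagram_def intro!: exI)

text \<open>Potentials for the own shape of \<open>f\<close> solve the constraints with margin
  \<open>0\<close>. Only their differences matter, so subtracting \<open>\<gamma> i1\<close> gives
  the required normalization.\<close>

lemma ex_from_margin_LP:
  assumes "inj x" "optimal (objective x a) (psize f) (psize f) f"
  obtains P where "from_margin_LP i1 a (clus x f) P"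
proof -
  obtain \<gamma> where \<gamma>: "dual (objective x a) (psize f) (psize f) f \<gamma>" using optimal_imp_dual[OF assms(2)] .
  have feas: "margin_feasible i1 a (clus x f) 0 (\<chi> i. \<gamma> i - \<gamma> i1)"
    using \<gamma> by (auto simp: margin_feasible_def clus_def dual_def objective_def
        inner_diff_left inner_diff_right inner_commute)
  show thesis
  proof (cases "\<exists>\<epsilon> \<gamma>. margin_optimal i1 a (clus x f) \<epsilon> \<gamma>")
    case True
    then show ?thesis using that unfolding from_margin_LP_def margin_optimal_def by metis
  next
    case False
    then show ?thesis using that feas unfolding from_margin_LP_def by blast
  qed
qed

lemma ex_from_shared_system:
  assumes "\<And>j l. objective x a $ l $ j - objective x a $ f j $ j \<le> \<gamma> l - \<gamma> (f j)"
    and "\<And>j l. objective x a $ l $ j - objective x a $ g j $ j \<le> \<gamma> l - \<gamma> (g j)"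
  obtains Q where "from_shared_system i1 a (clus x f) (clus x g) Q"
proof
  show "from_shared_system i1 a (clus x f) (clus x g) (power_diagram a (\<chi> i. \<gamma> i - \<gamma> i1))"
    unfolding from_shared_system_def
    by (rule exI[of _ "\<chi> i. \<gamma> i - \<gamma> i1"])
      (use assms in \<open>auto simp: clus_def objective_def inner_diff_left inner_diff_right inner_commute\<close>)
qed

lemma constrained_LSA_separable:
  fixes x :: "'n::finite \<Rightarrow> real^'d::finite"
  assumes "inj x" "constrained_LSA_for (range x) a C"
  shows "constrained_LSA (range x) C" "separable C"
proof -
  show "constrained_LSA (range x) C" using assms(2) by (auto simp: constrained_LSA_def)
  obtain f where "C = clus x f"
    using assms by (auto simp: constrained_LSA_for_def clustering_iff)
  then obtain P where "from_margin_LP undefined a C P"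
    using ex_from_margin_LP assms constrained_LSA_for_clus by metis
  then show "separable C"
    using from_margin_LP_separating unfolding separable_def separating_def by blast
qed

section \<open>Exchanges of items\<close>

lemma verts_CDG [simp]: "verts (CDG C D) = UNIV"
  by (simp add: CDG_def)

lemma cas_CDG: "pre_digraph.cas (CDG C D) u p v \<longleftrightarrow> walk u p v"
proof (induction p arbitrary: u)
  case (Cons a p)
  then show ?case by (cases a) (auto simp: pre_digraph.cas.simps CDG_def)
qed (simp add: pre_digraph.cas.simps)

lemma awalk_verts_CDG: "walk u p v \<Longrightarrow> pre_digraph.awalk_verts (CDG C D) u p = map fst p @ [v]"
proof (induction p arbitrary: u)
  case (Cons a p)
  then show ?case by (cases a) (auto simp: pre_digraph.awalk_verts.simps CDG_def)
qed (simp add: pre_digraph.awalk_verts.simps)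

lemma sequential_exchange_iff:
  "sequential_exchange C D \<longleftrightarrow>
    (\<exists>u p v. p \<noteq> [] \<and> set p = arcs (CDG C D) \<and> walk u p v \<and> distinct (map fst p @ [v]))"
proof -
  have "pre_digraph.apath (CDG C D) u p v \<longleftrightarrow>
      set p \<subseteq> arcs (CDG C D) \<and> walk u p v \<and> distinct (map fst p @ [v])" for u p v
    unfolding pre_digraph.apath_def pre_digraph.awalk_def cas_CDG
    by (cases "walk u p v") (simp_all add: awalk_verts_CDG)
  then show ?thesis unfolding sequential_exchange_def by blast
qed

lemma cyclical_exchangeI:
  assumes "p \<noteq> []" "set p = arcs (CDG C D)" "walk u p u" "distinct (map fst p)"
  shows "cyclical_exchange C D"
proof -
  obtain a q where p: "p = a # q" using assms(1) by (cases p) auto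
  have "pre_digraph.awalk_verts (CDG C D) u p = map fst p @ [u]" by (rule awalk_verts_CDG[OF assms(3)])
  \<comment> \<open>Dropping the initial \<open>u\<close> leaves the tails of the later arcs
    followed by the final \<open>u\<close>, which is a rotation of the list of tails.\<close>
  then have "distinct (tl (pre_digraph.awalk_verts (CDG C D) u p))"
    using assms(3,4) p by (cases a) auto
  then show ?thesis
    unfolding cyclical_exchange_def pre_digraph.cycle_def pre_digraph.awalk_def cas_CDG
    using assms by (intro exI[of _ p] conjI exI[of _ u]) auto
qed

lemma walk_map_label: "walk u (map (\<lambda>(i, j, l). (i, h j, l)) ps) v \<longleftrightarrow> walk u ps v"
  by (induction ps arbitrary: u) auto

lemma map_fst_label: "map fst (map (\<lambda>(i, j, l). (i, h j, l)) ps) = map fst ps"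
  by (induction ps) auto

lemma arcs_CDG_clus:
  "inj x \<Longrightarrow> arcs (CDG (clus x f) (clus x g)) = (\<lambda>(i, j, l). (i, x j, l)) ` exchange_arcs f g"
proof -
  assume x: "inj x"
  have "(i, z, l) \<in> arcs (CDG (clus x f) (clus x g)) \<longleftrightarrow>
      (i, z, l) \<in> (\<lambda>(i, j, l). (i, x j, l)) ` exchange_arcs f g" for i z l
    using x by (auto simp: CDG_def exchange_arcs_def clus_def image_iff inj_eq)
  then show "arcs (CDG (clus x f) (clus x g)) = (\<lambda>(i, j, l). (i, x j, l)) ` exchange_arcs f g"
    by (intro set_eqI) (metis prod_cases3)
qed

lemma simple_exchange_imp_exchange:
  assumes "inj x" "simple_exchange f g u ps v"
  shows "u \<noteq> v \<Longrightarrow> sequential_exchange (clus x f) (clus x g)"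
    and "u = v \<Longrightarrow> cyclical_exchange (clus x f) (clus x g)"
proof -
  let ?p = "map (\<lambda>(i, j, l). (i, x j, l)) ps"
  have "?p \<noteq> []" "set ?p = arcs (CDG (clus x f) (clus x g))" "walk u ?p v" "distinct (map fst ?p)"
    using assms unfolding map_fst_label walk_map_label by (auto simp: simple_exchange_def arcs_CDG_clus)
  moreover have "distinct (map fst ?p @ [v])" if "u \<noteq> v"
    using assms(2) that unfolding map_fst_label by (auto simp: simple_exchange_def)
  ultimately show "u \<noteq> v \<Longrightarrow> sequential_exchange (clus x f) (clus x g)"
    and "u = v \<Longrightarrow> cyclical_exchange (clus x f) (clus x g)"
    using cyclical_exchangeI unfolding sequential_exchange_iff by blast+
qed

lemma walk_rev: "walk u p v \<Longrightarrow> walk v (rev (map (\<lambda>(i, z, l). (l, z, i)) p)) u"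
proof (induction p arbitrary: u)
  case (Cons a p)
  then show ?case by (cases a) auto
qed simp

text \<open>The difference graph of the swapped pair has all arcs reversed. This is needed because
  the clusterings obtained from \<open>t\<close> are output in reverse order.\<close>

lemma sequential_exchange_sym:
  assumes "sequential_exchange C D"
  shows "sequential_exchange D C"
proof -
  obtain u p v where p: "p \<noteq> []" "set p = arcs (CDG C D)" "walk u p v" "distinct (map fst p @ [v])"
    using assms by (auto simp: sequential_exchange_iff)
  let ?q = "rev (map (\<lambda>(i, z, l). (l, z, i)) p)"
  have "map fst ?q @ [u] = rev (u # map (snd \<circ> snd) p)" by (auto simp: rev_map)
  then have "distinct (map fst ?q @ [u])" using p(4) walk_nodes[OF p(3)] by (metis distinct_rev)
  moreover have "set ?q = arcs (CDG D C)" using p(2) by (force simp: CDG_def)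
  moreover have "walk v ?q u" using walk_rev[OF p(3)] .
  ultimately show ?thesis using p(1) unfolding sequential_exchange_iff
    by (intro exI[of _ v] exI[of _ ?q] exI[of _ u]) auto
qed

section \<open>The loops\<close>

lemma loop_invariant:
  assumes "iter\<^sup>*\<^sup>* \<sigma> \<sigma>'" "I \<sigma>" "\<And>\<sigma> \<sigma>'. I \<sigma> \<Longrightarrow> iter \<sigma> \<sigma>' \<Longrightarrow> I \<sigma>'"
  shows "I \<sigma>'"
  using assms by (induction rule: rtranclp_induct) auto

lemma loop_completesI:
  assumes "\<exists>\<sigma>. start \<sigma>" "\<And>\<sigma>. start \<sigma> \<Longrightarrow> I \<sigma>" "\<And>\<sigma> \<sigma>'. I \<sigma> \<Longrightarrow> iter \<sigma> \<sigma>' \<Longrightarrow> I \<sigma>'"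
    and "\<And>\<sigma>. I \<sigma> \<Longrightarrow> \<exists>\<sigma>'. iter\<^sup>*\<^sup>* \<sigma> \<sigma>' \<and> exit \<sigma>'"
  shows "loop_completes start iter exit"
  unfolding loop_completes_def using assms loop_invariant[of iter _ _ I] by blast

lemma infinite_run_invariant:
  assumes "infinite_run start iter F" "\<And>\<sigma>. start \<sigma> \<Longrightarrow> I \<sigma>" "\<And>\<sigma> \<sigma>'. I \<sigma> \<Longrightarrow> iter \<sigma> \<sigma>' \<Longrightarrow> I \<sigma>'"
  shows "I (F r)"
  using assms by (induction r) (auto simp: infinite_run_def)

section \<open>The loop from a constrained LSA to a radial clustering\<close>

text \<open>The list \<open>fs\<close> is not part of the state; it records the assignments behind
  the clusterings. The strict increase of the objective along it is the source of both termination
  and distinct shapes.\<close>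

definition LSA_inv ::
  "('n::finite \<Rightarrow> real^'d::finite) \<Rightarrow> ('d, 'k::finite) sites \<Rightarrow> ('k \<Rightarrow> nat) \<Rightarrow> ('k \<Rightarrow> nat) \<Rightarrow>
   ('d, 'k) clustering \<Rightarrow> ('n \<Rightarrow> 'k) list \<Rightarrow> ('d, 'k) LSA_state \<Rightarrow> bool" where
  "LSA_inv x a lo up C fs = (\<lambda>(Cs, Ps). fs \<noteq> [] \<and> Cs = map (clus x) fs \<and> hd Cs = C \<and>
     (\<forall>f\<in>set fs. feasible_shape lo up (psize f) \<and> optimal (objective x a) (psize f) (psize f) f) \<and>
     sorted_wrt (\<lambda>f g. objective x a \<bullet> avec f < objective x a \<bullet> avec g) fs \<and>
     successively sequential_exchange Cs \<and> length Ps = 2 * length Cs - 1 \<and>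
     (\<forall>i<length Cs. separating_for a (Ps ! (2 * i)) (Cs ! i)) \<and>
     (\<forall>i. Suc i < length Cs \<longrightarrow> shared_for a (Ps ! (2 * i + 1)) (Cs ! i) (Cs ! Suc i)))"

lemma LSA_inv_start:
  assumes "inj x" "constrained_LSA_for (range x) a C" "feasible_shape lo up (shape C)"
    and "LSAtoRad_start i1 a C \<sigma>"
  shows "\<exists>fs. LSA_inv x a lo up C fs \<sigma>"
proof -
  obtain f where f: "C = clus x f" using assms by (auto simp: constrained_LSA_for_def clustering_iff)
  obtain P where "\<sigma> = ([C], [P])" "from_margin_LP i1 a C P" using assms(4) by (auto simp: LSAtoRad_start_def)
  then have "LSA_inv x a lo up C [f] \<sigma>"
    using assms f from_margin_LP_separating by (auto simp: LSA_inv_def constrained_LSA_for_clus)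
  then show ?thesis by blast
qed

text \<open>The next clustering is optimal in the shape of the simplex neighbour \<open>D\<close>,
  hence at least as good as \<open>D\<close>, which is strictly better than the current
  clustering.\<close>

lemma LSA_inv_step:
  assumes x: "inj x" and inv: "LSA_inv x a lo up C fs \<sigma>" and step: "LSAtoRad_iter x i1 a lo up \<sigma> \<sigma>'"
  obtains g where "LSA_inv x a lo up C (fs @ [g]) \<sigma>'"
    "objective x a \<bullet> avec (last fs) < objective x a \<bullet> avec g"
  using step
proof cases
  case (1 Cs Ps D C' Q P)
  let ?c = "objective x a"
  have fs: "fs \<noteq> []" "Cs = map (clus x) fs" "hd Cs = C"
    "\<And>f. f \<in> set fs \<Longrightarrow> feasible_shape lo up (psize f) \<and> optimal ?c (psize f) (psize f) f"
    "sorted_wrt (\<lambda>f g. ?c \<bullet> avec f < ?c \<bullet> avec g) fs"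
    "successively sequential_exchange Cs" "length Ps = 2 * length Cs - 1"
    "\<And>i. i < length Cs \<Longrightarrow> separating_for a (Ps ! (2 * i)) (Cs ! i)"
    "\<And>i. Suc i < length Cs \<Longrightarrow> shared_for a (Ps ! (2 * i + 1)) (Cs ! i) (Cs ! Suc i)"
    using inv 1(1) by (auto simp: LSA_inv_def)
  define f where "f = last fs"
  have f: "f \<in> set fs" "last Cs = clus x f" using fs(1,2) by (auto simp: f_def last_map)
  obtain g0 where g0: "D = clus x g0"
    using 1(4) x by (auto simp: adjacent_def feasible_clustering_def clustering_iff)
  obtain g where g: "C' = clus x g" using 1(6) x by (auto simp: clustering_iff)
  have adj: "edge_joined lo up f g0" using 1(4) x f g0 by (simp add: adjacent_clus)
  have opt: "optimal ?c (psize g0) (psize g0) g"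
    using 1(7) x g g0 by (simp add: optimal_iff_maximizes)
  then have sz: "psize g = psize g0" by (simp add: optimal_def)
  have "?c \<bullet> avec f < ?c \<bullet> avec g0" using 1(5) x f g0 by simp
  also have "?c \<bullet> avec g0 \<le> ?c \<bullet> avec g" using opt by (simp add: optimal_def)
  finally have less: "?c \<bullet> avec f < ?c \<bullet> avec g" .
  have "?c \<bullet> avec f' \<le> ?c \<bullet> avec f" if "f' \<in> set fs" for f'
  proof -
    have "fs = butlast fs @ [f]" using fs(1) by (simp add: f_def)
    then have "f' = f \<or> f' \<in> set (butlast fs)"
      "sorted_wrt (\<lambda>f g. ?c \<bullet> avec f < ?c \<bullet> avec g) (butlast fs @ [f])"
      using that fs(5) by (metis Un_iff empty_iff insert_iff list.set(1,2) set_append, metis)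
    then show ?thesis by (auto simp: sorted_wrt_append)
  qed
  then have sorted: "sorted_wrt (\<lambda>f g. ?c \<bullet> avec f < ?c \<bullet> avec g) (fs @ [g])"
    using fs(5) less by (force simp: sorted_wrt_append)
  have "feasible_shape lo up (psize g)" using adj sz by (simp add: edge_joined_def)
  then have set_inv: "\<forall>f\<in>set (fs @ [g]). feasible_shape lo up (psize f) \<and> optimal ?c (psize f) (psize f) f"
    using fs(4) opt sz by auto
  \<comment> \<open>Before the step there are \<open>2 * length Cs - 1\<close> diagrams, so
    \<open>Q\<close> lands on an odd position and \<open>P\<close> on the even position
    \<open>2 * length Cs\<close> of the new clustering.\<close>
  have sep: "separating_for a ((Ps @ [Q, P]) ! (2 * i)) ((Cs @ [C']) ! i)" if "i < Suc (length Cs)" for i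
  proof (cases "i = length Cs")
    case True
    moreover have "2 * length Cs = Suc (length Ps)" using fs(1,2,7) by (cases fs) auto
    ultimately show ?thesis using 1(10) from_margin_LP_separating by (auto simp: nth_append)
  next
    case False
    then have "i < length Cs" "2 * i < length Ps" using that fs(7) by auto
    then show ?thesis using fs(8) by (simp add: nth_append)
  qed
  have shared: "shared_for a ((Ps @ [Q, P]) ! (2 * i + 1)) ((Cs @ [C']) ! i) ((Cs @ [C']) ! Suc i)"
    if "Suc i < Suc (length Cs)" for i
  proof (cases "Suc i = length Cs")
    case True
    then have "2 * i + 1 = length Ps" "Cs \<noteq> []" using fs(7) by auto
    then have "2 * i + 1 = length Ps" "last Cs = Cs ! i" using True last_conv_nth[of Cs] by (auto simp flip: True)
    then show ?thesis using True 1(9) from_shared_system_shared by (auto simp: nth_append)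
  next
    case False
    then have "Suc i < length Cs" "2 * i + 1 < length Ps" using that fs(7) by auto
    then show ?thesis using fs(9) by (simp add: nth_append)
  qed
  have "Cs \<noteq> []" using fs(1,2) by simp
  then have lists: "hd (Cs @ [C']) = C" "successively sequential_exchange (Cs @ [C'])"
    "length (Ps @ [Q, P]) = 2 * length (Cs @ [C']) - 1"
    using fs(3,6,7) 1(8) by (auto simp: successively_append_iff Suc_diff_Suc)
  have "LSA_inv x a lo up C (fs @ [g]) \<sigma>'"
    unfolding LSA_inv_def 1(2) prod.case
    using set_inv sorted lists sep shared by (intro conjI allI impI) (simp_all add: fs(2) g)
  with less that show thesis by (simp add: f_def)
qed

lemma LSA_exit_iff:
  assumes "inj x" "LSA_inv x a lo up C fs \<sigma>"
  shows "LSAtoRad_exit x a lo up \<sigma> \<longleftrightarrow> optimal (objective x a) lo up (last fs)"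
  using assms by (auto simp: LSAtoRad_exit_def LSA_inv_def optimal_iff_maximizes last_map split: prod.splits)

text \<open>A run never gets stuck: an improving edge, an optimal clustering one path away in its
  shape, a shared diagram and a margin diagram all exist.\<close>

lemma LSA_inv_progress:
  assumes x: "inj x" and inv: "LSA_inv x a lo up C fs \<sigma>" and "\<not> LSAtoRad_exit x a lo up \<sigma>"
  obtains \<sigma>' where "LSAtoRad_iter x i1 a lo up \<sigma> \<sigma>'"
proof -
  obtain Cs Ps where \<sigma>: "\<sigma> = (Cs, Ps)" by (cases \<sigma>)
  define f where "f = last fs"
  have f: "last Cs = clus x f" "feasible_shape lo up (psize f)" "optimal (objective x a) (psize f) (psize f) f"
    using inv by (auto simp: LSA_inv_def \<sigma> f_def last_map)
  have "\<not> optimal (objective x a) lo up f" using assms LSA_exit_iff f_def by blast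
  then obtain g0 where g0: "edge_joined lo up f g0" "objective x a \<bullet> avec f < objective x a \<bullet> avec g0"
    using ex_improving_adjacent[OF f(2)] by metis
  obtain g u ps v where g: "optimal (objective x a) (psize g0) (psize g0) g" "simple_exchange f g u ps v" "u \<noteq> v"
    using ex_optimal_sequential[OF f(3) g0] .
  then have own: "optimal (objective x a) (psize g) (psize g) g" using optimal_own_shape by blast
  obtain \<gamma> where "\<And>j l. objective x a $ l $ j - objective x a $ f j $ j \<le> \<gamma> l - \<gamma> (f j)"
    "\<And>j l. objective x a $ l $ j - objective x a $ g j $ j \<le> \<gamma> l - \<gamma> (g j)"
    using sequential_shared_dual[OF f(3) own g(2,3)] by blast
  then obtain Q where Q: "from_shared_system i1 a (clus x f) (clus x g) Q"
    using ex_from_shared_system by metis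
  obtain P where P: "from_margin_LP i1 a (clus x g) P" using ex_from_margin_LP[OF x own] .
  have "LSAtoRad_iter x i1 a lo up (Cs, Ps) (Cs @ [clus x g], Ps @ [Q, P])"
  proof (rule LSAtoRad_iter.intros)
    show "adjacent x lo up (last Cs) (clus x g0)" using g0 f x by (simp add: adjacent_clus)
    show "sequential_exchange (last Cs) (clus x g)"
      using simple_exchange_imp_exchange(1)[OF x g(2,3)] f(1) by simp
  qed (use assms(3) g0 g P Q f(1) x in \<open>auto simp: \<sigma> clustering_iff optimal_iff_maximizes\<close>)
  then show thesis using that \<sigma> by blast
qed

text \<open>The number of strictly better assignments serves as the termination measure of the first
  loop.\<close>

lemma LSA_measure:
  "objective x a \<bullet> avec f < objective x a \<bullet> avec g \<Longrightarrow>
    card {h. objective x a \<bullet> avec g < objective x a \<bullet> avec h} < card {h. objective x a \<bullet> avec f < objective x a \<bullet> avec h}"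
  for f g :: "'n::finite \<Rightarrow> 'k::finite"
  by (rule psubset_card_mono) auto

lemma LSA_reaches_exit:
  assumes x: "inj x" and "LSA_inv x a lo up C fs \<sigma>"
  shows "\<exists>\<sigma>'. (LSAtoRad_iter x i1 a lo up)\<^sup>*\<^sup>* \<sigma> \<sigma>' \<and> LSAtoRad_exit x a lo up \<sigma>'"
  using assms(2)
proof (induction "card {h. objective x a \<bullet> avec (last fs) < objective x a \<bullet> avec h}" arbitrary: fs \<sigma> rule: less_induct)
  case less
  show ?case
  proof (cases "LSAtoRad_exit x a lo up \<sigma>")
    case False
    then obtain \<sigma>1 where \<sigma>1: "LSAtoRad_iter x i1 a lo up \<sigma> \<sigma>1" using LSA_inv_progress[OF x less.prems] by metis
    then obtain g where g: "LSA_inv x a lo up C (fs @ [g]) \<sigma>1"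
      "objective x a \<bullet> avec (last fs) < objective x a \<bullet> avec g"
      using LSA_inv_step[OF x less.prems] by metis
    then obtain \<sigma>' where "(LSAtoRad_iter x i1 a lo up)\<^sup>*\<^sup>* \<sigma>1 \<sigma>'" "LSAtoRad_exit x a lo up \<sigma>'"
      using less.hyps[OF _ g(1)] LSA_measure[OF g(2)] by auto
    then show ?thesis using \<sigma>1 by (meson converse_rtranclp_into_rtranclp)
  next
    case True
    then show ?thesis by blast
  qed
qed

lemma LSA_loop_completes:
  assumes x: "inj x" and C: "constrained_LSA_for (range x) a C" and feas: "feasible_shape lo up (shape C)"
  shows "loop_completes (LSAtoRad_start i1 a C) (LSAtoRad_iter x i1 a lo up) (LSAtoRad_exit x a lo up)"
proof (rule loop_completesI[where I = "\<lambda>\<sigma>. \<exists>fs. LSA_inv x a lo up C fs \<sigma>"])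
  obtain f where "C = clus x f" using x C by (auto simp: constrained_LSA_for_def clustering_iff)
  then obtain P where "from_margin_LP i1 a C P"
    using ex_from_margin_LP x C constrained_LSA_for_clus by metis
  then show "\<exists>\<sigma>. LSAtoRad_start i1 a C \<sigma>" by (auto simp: LSAtoRad_start_def)
next
  show "\<exists>fs. LSA_inv x a lo up C fs \<sigma>" if "LSAtoRad_start i1 a C \<sigma>" for \<sigma>
    using LSA_inv_start[OF x C feas that] .
  show "\<exists>fs. LSA_inv x a lo up C fs \<sigma>'"
    if "\<exists>fs. LSA_inv x a lo up C fs \<sigma>" "LSAtoRad_iter x i1 a lo up \<sigma> \<sigma>'" for \<sigma> \<sigma>'
    using that LSA_inv_step[OF x] by metis
  show "\<exists>\<sigma>'. (LSAtoRad_iter x i1 a lo up)\<^sup>*\<^sup>* \<sigma> \<sigma>' \<and> LSAtoRad_exit x a lo up \<sigma>'"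
    if "\<exists>fs. LSA_inv x a lo up C fs \<sigma>" for \<sigma>
    using that LSA_reaches_exit[OF x] by metis
qed

lemma LSA_no_infinite_run:
  assumes x: "inj x" and C: "constrained_LSA_for (range x) a C" and feas: "feasible_shape lo up (shape C)"
  shows "\<not> infinite_run (LSAtoRad_start i1 a C) (LSAtoRad_iter x i1 a lo up) F"
proof
  assume run: "infinite_run (LSAtoRad_start i1 a C) (LSAtoRad_iter x i1 a lo up) F"
  define m where "m r = card {h. objective x a \<bullet> assignment_vector x (last (fst (F r))) < objective x a \<bullet> avec h}" for r
  have dec: "m (Suc r) < m r" for r
  proof -
    obtain fs where fs: "LSA_inv x a lo up C fs (F r)"
      using infinite_run_invariant[OF run, of "\<lambda>\<sigma>. \<exists>fs. LSA_inv x a lo up C fs \<sigma>"]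
        LSA_inv_start[OF x C feas] LSA_inv_step[OF x] by metis
    moreover have "LSAtoRad_iter x i1 a lo up (F r) (F (Suc r))" using run by (simp add: infinite_run_def)
    ultimately obtain g where g: "LSA_inv x a lo up C (fs @ [g]) (F (Suc r))"
      "objective x a \<bullet> avec (last fs) < objective x a \<bullet> avec g"
      using LSA_inv_step[OF x] by metis
    have "assignment_vector x (last (fst (F r))) = avec (last fs)"
      "assignment_vector x (last (fst (F (Suc r)))) = avec g"
      using fs g(1) x by (auto simp: LSA_inv_def last_map split: prod.splits)
    then show ?thesis using LSA_measure[OF g(2)] by (simp add: m_def)
  qed
  have "m r + r \<le> m 0" for r
  proof (induction r)
    case (Suc r)
    then show ?case using dec[of r] by linarith
  qed simp
  from this[of "Suc (m 0)"] show False by simp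
qed

text \<open>Each clustering is optimal in its own shape, so a strictly better later one must have a
  different shape.\<close>

lemma LSA_inv_distinct_shapes:
  fixes x :: "'n::finite \<Rightarrow> real^'d::finite" and Cs :: "('d, 'k::finite) clustering list"
  assumes x: "inj x" and inv: "LSA_inv x a lo up C fs (Cs, Ps)"
  shows "distinct (map shape Cs)" "length Cs \<le> card (feasible_shapes (range x) lo up)"
proof -
  have fs: "Cs = map (clus x) fs"
    "\<And>f. f \<in> set fs \<Longrightarrow> feasible_shape lo up (psize f) \<and> optimal (objective x a) (psize f) (psize f) f"
    "sorted_wrt (\<lambda>f g. objective x a \<bullet> avec f < objective x a \<bullet> avec g) fs"
    using inv by (auto simp: LSA_inv_def)
  have shapes: "map shape Cs = map psize fs" using fs(1) x by simp
  have ne: "psize (fs ! i) \<noteq> psize (fs ! j)" if "i < j" "j < length fs" for i j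
  proof
    assume "psize (fs ! i) = psize (fs ! j)"
    moreover have "fs ! i \<in> set fs" using that by simp
    ultimately have "objective x a \<bullet> avec (fs ! j) \<le> objective x a \<bullet> avec (fs ! i)"
      using fs(2)[of "fs ! i"] by (auto simp: optimal_def)
    then show False using sorted_wrt_nth_less[OF fs(3) that] by simp
  qed
  then show d: "distinct (map shape Cs)"
    unfolding shapes distinct_conv_nth
  proof (intro allI impI)
    fix i j assume "i < length (map psize fs)" "j < length (map psize fs)" "i \<noteq> j"
    then show "map psize fs ! i \<noteq> map psize fs ! j" using ne[of i j] ne[of j i] by (cases i j rule: linorder_cases) auto
  qed
  have "shape (clus x f) \<in> feasible_shapes (range x) lo up" if "f \<in> set fs" for f
    using fs(2)[OF that] x unfolding feasible_shapes_def by (intro imageI) (simp add: feasible_clus)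
  then have "set (map shape Cs) \<subseteq> feasible_shapes (range x) lo up" unfolding fs(1) by auto
  moreover have "finite (feasible_shapes (range x) lo up)"
  proof (rule finite_subset)
    show "feasible_shapes (range x) lo up \<subseteq> range (psize :: ('n \<Rightarrow> 'k) \<Rightarrow> 'k \<Rightarrow> nat)"
      using x by (auto simp: feasible_shapes_def feasible_clustering_def clustering_iff)
  qed simp
  ultimately have "card (set (map shape Cs)) \<le> card (feasible_shapes (range x) lo up)"
    by (intro card_mono)
  then show "length Cs \<le> card (feasible_shapes (range x) lo up)"
    using distinct_card[OF d] by simp
qed

section \<open>Optimality along the segment from \<open>s\<close> to \<open>t\<close>\<close>

lemma objective_sites_at:
  "objective x (sites_at s t \<nu>) = (1 - \<nu>) *\<^sub>R objective x s + \<nu> *\<^sub>R objective x t"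
  by (simp add: vec_eq_iff objective_def sites_at_def inner_add_right)

lemma objective_midpoint:
  "objective x ((1/2) *\<^sub>R (a + b)) = (1/2) *\<^sub>R (objective x a + objective x b)"
  by (simp add: vec_eq_iff objective_def inner_add_right)

lemma normal_cone_avec:
  "c \<in> normal_cone (transportation_polytope lo up) (avec f) \<longleftrightarrow> optimal c lo up f"
  by (simp add: normal_cone_def optimal_iff_maximizes)

text \<open>Normal cones are convex. This makes the margin LP of the second loop feasible, which is
  posed at the midpoint of two parameters at which the clustering is optimal.\<close>

lemma optimal_midpoint:
  assumes "optimal c lo up f" "optimal c' lo up f"
  shows "optimal ((1/2) *\<^sub>R (c + c')) lo up f"
  using assms unfolding optimal_def by (auto simp: inner_add_left intro: add_mono)

text \<open>The ranging breakpoint, stated without the current parameter: it depends on the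
  assignment alone, which is why only finitely many breakpoints can occur.\<close>

definition last_optimal ::
  "('n::finite \<Rightarrow> real^'d::finite) \<Rightarrow> ('k::finite \<Rightarrow> nat) \<Rightarrow> ('k \<Rightarrow> nat) \<Rightarrow> ('d, 'k) sites \<Rightarrow> ('d, 'k) sites \<Rightarrow>
   ('n \<Rightarrow> 'k) \<Rightarrow> real \<Rightarrow> bool" where
  "last_optimal x lo up s t f \<tau> \<longleftrightarrow> \<tau> \<in> {0..1} \<and> optimal (objective x (sites_at s t \<tau>)) lo up f \<and>
     (\<forall>\<nu>\<in>{\<tau><..1}. \<not> optimal (objective x (sites_at s t \<nu>)) lo up f)"

lemma last_optimal_le:
  assumes "last_optimal x lo up s t f \<tau>" "optimal (objective x (sites_at s t \<nu>)) lo up f" "\<nu> \<le> 1"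
  shows "\<nu> \<le> \<tau>"
  using assms by (force simp: last_optimal_def)

lemma last_optimal_unique:
  assumes "last_optimal x lo up s t f \<tau>" "last_optimal x lo up s t f \<tau>'"
  shows "\<tau> = \<tau>'"
proof (rule antisym)
  show "\<tau> \<le> \<tau>'" by (rule last_optimal_le[OF assms(2)]) (use assms(1) in \<open>simp_all add: last_optimal_def\<close>)
  show "\<tau>' \<le> \<tau>" by (rule last_optimal_le[OF assms(1)]) (use assms(2) in \<open>simp_all add: last_optimal_def\<close>)
qed

lemma ranging_breakpoint_clus:
  assumes "inj x" "0 \<le> \<mu>"
  shows "ranging_breakpoint x lo up s t (clus x f) \<mu> \<tau> \<longleftrightarrow> \<mu> \<le> \<tau> \<and> last_optimal x lo up s t f \<tau>"
  using assms by (auto simp: ranging_breakpoint_def last_optimal_def normal_cone_avec Let_def)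

text \<open>Closedness serves twice: the largest parameter of optimality is attained, and the
  parameters of assignments not optimal at \<open>\<tau>\<close> keep a distance from
  \<open>\<tau>\<close>.\<close>

lemma closed_optimal_parameters: "closed {\<nu>. optimal (objective x (sites_at s t \<nu>)) lo up f}"
proof (cases "feasible_shape lo up (psize f)")
  case True
  have "{\<nu>. optimal (objective x (sites_at s t \<nu>)) lo up f} =
    (\<Inter>g\<in>{g. feasible_shape lo up (psize g)}.
      {\<nu>. objective x (sites_at s t \<nu>) \<bullet> avec g \<le> objective x (sites_at s t \<nu>) \<bullet> avec f})"
    using True by (auto simp: optimal_def)
  moreover have "closed {\<nu>. objective x (sites_at s t \<nu>) \<bullet> avec g \<le> objective x (sites_at s t \<nu>) \<bullet> avec f}" for g
    unfolding objective_sites_at by (intro closed_Collect_le continuous_intros)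
  ultimately show ?thesis by (auto intro!: closed_INT)
qed (simp add: optimal_def)

lemma ex_last_optimal:
  assumes "\<mu> \<in> {0..1}" "optimal (objective x (sites_at s t \<mu>)) lo up f"
  obtains \<tau> where "last_optimal x lo up s t f \<tau>" "\<mu> \<le> \<tau>"
proof -
  define S where "S = {\<mu>..1} \<inter> {\<nu>. optimal (objective x (sites_at s t \<nu>)) lo up f}"
  have "compact S" unfolding S_def by (intro compact_Int_closed compact_Icc closed_optimal_parameters)
  moreover have "\<mu> \<in> S" using assms by (auto simp: S_def)
  ultimately obtain \<tau> where \<tau>: "\<tau> \<in> S" "\<forall>\<nu>\<in>S. \<nu> \<le> \<tau>" using compact_attains_sup[of S] by blast
  have "\<not> optimal (objective x (sites_at s t \<nu>)) lo up f" if "\<nu> \<in> {\<tau><..1}" for \<nu>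
  proof
    assume "optimal (objective x (sites_at s t \<nu>)) lo up f"
    then have "\<nu> \<in> S" using that \<tau>(1) by (auto simp: S_def)
    then show False using that \<tau>(2) by auto
  qed
  then have "last_optimal x lo up s t f \<tau>"
    using assms(1) \<tau>(1) by (auto simp: last_optimal_def S_def)
  with \<tau>(1) that show thesis by (auto simp: S_def)
qed

text \<open>The parameters at which some assignment not optimal for \<open>\<tau>\<close> is optimal form a closed set,
  so they stay away from \<open>\<tau>\<close>.\<close>

lemma ex_optimal_beyond:
  fixes f :: "'n::finite \<Rightarrow> 'k::finite" and x :: "'n \<Rightarrow> real^'d::finite"
  assumes "feasible_shape lo up (psize f)" "0 \<le> \<tau>" "\<tau> < 1"
  obtains g :: "'n \<Rightarrow> 'k" and \<tau>' where "optimal (objective x (sites_at s t \<tau>)) lo up g"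
    "last_optimal x lo up s t g \<tau>'" "\<tau> < \<tau>'"
proof -
  define S where "S g = {\<nu>. optimal (objective x (sites_at s t \<nu>)) lo up g}" for g :: "'n \<Rightarrow> 'k"
  define U where "U = (\<Union>g\<in>{g. \<tau> \<notin> S g}. S g)"
  have "closed U" unfolding U_def S_def by (intro closed_UN ballI closed_optimal_parameters) auto
  moreover have "\<tau> \<notin> U" by (auto simp: U_def)
  ultimately obtain e where e: "e > 0" "ball \<tau> e \<subseteq> - U"
    using openE[of "- U" \<tau>] by (auto simp: open_Compl)
  define \<nu> where "\<nu> = min 1 (\<tau> + e / 2)"
  have \<nu>: "\<tau> < \<nu>" "\<nu> \<le> 1" "\<nu> \<in> ball \<tau> e"
    using e(1) assms(3) by (auto simp: \<nu>_def dist_real_def)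
  obtain g :: "'n \<Rightarrow> 'k" where g: "optimal (objective x (sites_at s t \<nu>)) lo up g"
    using ex_optimal[OF assms(1)] .
  then have "\<tau> \<in> S g" using e(2) \<nu>(3) by (auto simp: U_def S_def)
  moreover obtain \<tau>' where "last_optimal x lo up s t g \<tau>'" "\<nu> \<le> \<tau>'"
    using ex_last_optimal[OF _ g] \<nu> assms(2) by auto
  ultimately show thesis using that \<nu>(1) by (auto simp: S_def)
qed

section \<open>The loop between radial clusterings\<close>

text \<open>Each clustering is optimal at the parameter where it was entered, and the diagram shared
  with its predecessor belongs to that same parameter. Truncated subtraction makes the number of
  diagrams \<open>0\<close> at the start.\<close>

definition Rad_inv ::
  "('n::finite \<Rightarrow> real^'d::finite) \<Rightarrow> ('k::finite \<Rightarrow> nat) \<Rightarrow> ('k \<Rightarrow> nat) \<Rightarrow> ('d, 'k) sites \<Rightarrow> ('d, 'k) sites \<Rightarrow>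
   ('d, 'k) clustering \<Rightarrow> ('n \<Rightarrow> 'k) list \<Rightarrow> ('d, 'k) Rad_state \<Rightarrow> bool" where
  "Rad_inv x lo up s t C fs = (\<lambda>(Ls, Cs, Ps). fs \<noteq> [] \<and> Cs = map (clus x) fs \<and> hd Cs = C \<and>
     length Ls = length fs \<and> last Ls \<in> {0..1} \<and>
     (\<forall>i<length fs. optimal (objective x (sites_at s t (Ls ! i))) lo up (fs ! i)) \<and>
     successively (\<lambda>C D. cyclical_exchange C D \<or> sequential_exchange C D) Cs \<and>
     length Ps = 2 * (length fs - 1) - 1 \<and>
     (\<forall>i. Suc i < length fs \<longrightarrow> shared_for (sites_at s t (Ls ! Suc i)) (Ps ! (2 * i)) (Cs ! i) (Cs ! Suc i)) \<and>
     (\<forall>i. 0 < i \<and> Suc i < length fs \<longrightarrow> separating (Ps ! (2 * i - 1)) (Cs ! i)))"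

lemma Rad_inv_start:
  assumes "inj x" "optimal (objective x s) lo up f" "RadToRad_start (clus x f) \<sigma>"
  shows "\<exists>fs. Rad_inv x lo up s t (clus x f) fs \<sigma>"
proof -
  have "Rad_inv x lo up s t (clus x f) [f] \<sigma>"
    using assms by (simp add: Rad_inv_def RadToRad_start_def sites_at_def)
  then show ?thesis by blast
qed

lemma Rad_inv_last:
  assumes "Rad_inv x lo up s t C fs (Ls, Cs, Ps)"
  shows "last Cs = clus x (last fs)" "last Ls \<in> {0..1}"
    "optimal (objective x (sites_at s t (last Ls))) lo up (last fs)"
proof -
  have fs: "fs \<noteq> []" "length Ls = length fs" "Ls \<noteq> []"
    "\<And>i. i < length fs \<Longrightarrow> optimal (objective x (sites_at s t (Ls ! i))) lo up (fs ! i)"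
    using assms by (auto simp: Rad_inv_def)
  show "last Cs = clus x (last fs)" "last Ls \<in> {0..1}" using assms by (auto simp: Rad_inv_def last_map)
  show "optimal (objective x (sites_at s t (last Ls))) lo up (last fs)"
    using fs(4)[of "length fs - 1"] fs(1-3) by (simp add: last_conv_nth)
qed

lemma Rad_inv_step:
  assumes x: "inj x" and inv: "Rad_inv x lo up s t C fs \<sigma>" and step: "RadToRad_iter x i1 s t lo up Ct \<sigma> \<sigma>'"
  obtains g where "Rad_inv x lo up s t C (fs @ [g]) \<sigma>'"
    "last (fst \<sigma>) \<le> last (fst \<sigma>')" "last_optimal x lo up s t (last fs) (last (fst \<sigma>'))"
  using step
proof cases
  case (1 Ls Cs Ps \<tau> C' Q Ms)
  define f where "f = last fs"
  have fs: "fs \<noteq> []" "Cs = map (clus x) fs" "hd Cs = C" "length Ls = length fs"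
     "\<And>i. i < length fs \<Longrightarrow> optimal (objective x (sites_at s t (Ls ! i))) lo up (fs ! i)"
     "successively (\<lambda>C D. cyclical_exchange C D \<or> sequential_exchange C D) Cs"
     "length Ps = 2 * (length fs - 1) - 1"
     "\<And>i. Suc i < length fs \<Longrightarrow> shared_for (sites_at s t (Ls ! Suc i)) (Ps ! (2 * i)) (Cs ! i) (Cs ! Suc i)"
     "\<And>i. 0 < i \<Longrightarrow> Suc i < length fs \<Longrightarrow> separating (Ps ! (2 * i - 1)) (Cs ! i)"
    using inv 1(1) by (auto simp: Rad_inv_def)
  have last: "last Cs = clus x f" "last Ls \<in> {0..1}"
    using Rad_inv_last(1,2)[OF inv[unfolded 1(1)]] by (simp_all add: f_def)
  obtain g where g: "C' = clus x g"
    using 1(5) x by (auto simp: adjacent_def feasible_clustering_def clustering_iff)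
  have bp: "last Ls \<le> \<tau>" "last_optimal x lo up s t f \<tau>"
    using 1(4) x last by (auto simp: ranging_breakpoint_clus)
  have "edge_joined lo up f g" using 1(5) x last(1) g by (simp add: adjacent_clus)
  then obtain u ps v where ex: "simple_exchange f g u ps v" by (rule edge_joined_imp_simple_exchange)
  have exch: "cyclical_exchange (last Cs) C' \<or> sequential_exchange (last Cs) C'"
    using simple_exchange_imp_exchange[OF x ex] unfolding last(1) g by blast
  have opt: "optimal (objective x (sites_at s t \<tau>)) lo up g"
    using 1(6) x g by (simp add: normal_cone_avec)
  have ne: "Cs \<noteq> []" "length Cs = length fs" using fs(1,2) by auto
  \<comment> \<open>The first iteration adds no margin diagram, as the initial clustering gets none
    in this loop; every later one adds exactly one. So \<open>Q\<close> always lands on an even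
    position.\<close>
  have lenMs: "length (Ps @ Ms) = 2 * (length fs - 1)"
  proof (cases "length fs = 1")
    case True
    then show ?thesis using 1(8) fs(7) ne by simp
  next
    case False
    then have "length Ms = 1" using 1(8) ne by auto
    moreover have "length fs \<noteq> 0" using fs(1) by simp
    ultimately show ?thesis using fs(7) False unfolding length_append by linarith
  qed
  have opts: "optimal (objective x (sites_at s t ((Ls @ [\<tau>]) ! i))) lo up ((fs @ [g]) ! i)"
    if "i < length (fs @ [g])" for i
    using that fs(4,5) opt by (cases "i = length fs") (auto simp: nth_append)
  have shared: "shared_for (sites_at s t ((Ls @ [\<tau>]) ! Suc i)) ((Ps @ Ms @ [Q]) ! (2 * i)) ((Cs @ [C']) ! i) ((Cs @ [C']) ! Suc i)"
    if "Suc i < length (fs @ [g])" for i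
  proof (cases "Suc i = length fs")
    case True
    then have "2 * i = length (Ps @ Ms)" "last Cs = Cs ! i" "i < length Cs"
      using lenMs ne last_conv_nth[of Cs] by (auto simp flip: True)
    moreover from this have "(Ps @ Ms @ [Q]) ! (2 * i) = Q"
      by (metis append.assoc nth_append_length)
    ultimately show ?thesis using True 1(7) from_shared_system_shared ne fs(4) by (auto simp: nth_append)
  next
    case False
    then have "Suc i < length fs" "2 * i < length Ps" using that fs(7) by auto
    then show ?thesis using fs(4,8) ne by (simp add: nth_append)
  qed
  have sep: "separating ((Ps @ Ms @ [Q]) ! (2 * i - 1)) ((Cs @ [C']) ! i)"
    if "0 < i" "Suc i < length (fs @ [g])" for i
  proof (cases "Suc i = length fs")
    case True
    then have "length Cs \<noteq> 1" using that(1) ne by simp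
    then obtain P where P: "Ms = [P]" "from_margin_LP i1 ((1/2) *\<^sub>R (sites_at s t (last Ls) + sites_at s t \<tau>)) (last Cs) P"
      using 1(8) by auto
    have "2 * i - 1 = length Ps" "last Cs = Cs ! i" "i < length Cs"
      using True fs(7) ne last_conv_nth[of Cs] by (auto simp flip: True)
    then have "(Ps @ Ms @ [Q]) ! (2 * i - 1) = P" "(Cs @ [C']) ! i = last Cs"
      using P(1) by (simp_all add: nth_append)
    then show ?thesis using from_margin_LP_separating[OF P(2)] by (auto simp: separating_def)
  next
    case False
    then have "Suc i < length fs" "2 * i - 1 < length Ps" using that fs(7) by auto
    then show ?thesis using fs(9)[OF that(1)] ne by (simp add: nth_append)
  qed
  have lists: "hd (Cs @ [C']) = C" "length (Ls @ [\<tau>]) = length (fs @ [g])"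
    "successively (\<lambda>C D. cyclical_exchange C D \<or> sequential_exchange C D) (Cs @ [C'])"
    "last (Ls @ [\<tau>]) \<in> {0..1}"
    using fs(3,4,6) exch ne bp(2) by (auto simp: successively_append_iff last_optimal_def)
  have "0 < length fs" using fs(1) by simp
  then have len: "length (Ps @ Ms @ [Q]) = 2 * (length (fs @ [g]) - 1) - 1"
    using lenMs unfolding append.assoc[symmetric] length_append[of _ "[Q]"] length_append[of fs]
    by (simp; linarith)
  have "Rad_inv x lo up s t C (fs @ [g]) \<sigma>'"
    unfolding Rad_inv_def 1(2) prod.case
    using lists len opts shared sep by (intro conjI allI impI) (simp_all add: fs(2) g)
  then show thesis using that bp 1(1,2) by (simp add: f_def)
qed

text \<open>Any neighbour that is optimal at the current breakpoint can become the next clustering;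
  this freedom is what allows a run to be steered to the exit.\<close>

lemma Rad_progress:
  assumes x: "inj x" and inv: "Rad_inv x lo up s t C fs \<sigma>" and "\<not> RadToRad_exit Ct \<sigma>"
    and \<tau>: "last_optimal x lo up s t (last fs) \<tau>"
    and adj: "edge_joined lo up (last fs) h" and h: "optimal (objective x (sites_at s t \<tau>)) lo up h"
  obtains \<sigma>' where "RadToRad_iter x i1 s t lo up Ct \<sigma> \<sigma>'" "Rad_inv x lo up s t C (fs @ [h]) \<sigma>'"
proof -
  obtain Ls Cs Ps where \<sigma>: "\<sigma> = (Ls, Cs, Ps)" by (cases \<sigma>)
  define f where "f = last fs"
  note last = Rad_inv_last[OF inv[unfolded \<sigma>], folded f_def]
  have f\<tau>: "last_optimal x lo up s t f \<tau>" using \<tau> by (simp add: f_def)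
  then have f: "optimal (objective x (sites_at s t \<tau>)) lo up f" by (simp add: last_optimal_def)
  have le: "last Ls \<le> \<tau>" using last_optimal_le[OF f\<tau> last(3)] last(2) by simp
  obtain \<gamma> where "\<And>j l. objective x (sites_at s t \<tau>) $ l $ j - objective x (sites_at s t \<tau>) $ f j $ j \<le> \<gamma> l - \<gamma> (f j)"
    "\<And>j l. objective x (sites_at s t \<tau>) $ l $ j - objective x (sites_at s t \<tau>) $ h j $ j \<le> \<gamma> l - \<gamma> (h j)"
    using optimal_shared_dual[OF f h] by blast
  then obtain Q where Q: "from_shared_system i1 (sites_at s t \<tau>) (clus x f) (clus x h) Q"
    using ex_from_shared_system by metis
  have "optimal (objective x ((1/2) *\<^sub>R (sites_at s t (last Ls) + sites_at s t \<tau>))) lo up f"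
    unfolding objective_midpoint using last(3) f by (rule optimal_midpoint)
  then obtain P where P: "from_margin_LP i1 ((1/2) *\<^sub>R (sites_at s t (last Ls) + sites_at s t \<tau>)) (clus x f) P"
    using ex_from_margin_LP[OF x optimal_own_shape] by metis
  define Ms where "Ms = (if length Cs = 1 then [] else [P])"
  have step: "RadToRad_iter x i1 s t lo up Ct (Ls, Cs, Ps) (Ls @ [\<tau>], Cs @ [clus x h], Ps @ Ms @ [Q])"
  proof (rule RadToRad_iter.intros)
    show "ranging_breakpoint x lo up s t (last Cs) (last Ls) \<tau>"
      using le f\<tau> last(1,2) x by (simp add: ranging_breakpoint_clus)
    show "adjacent x lo up (last Cs) (clus x h)"
      using adj last(1) x by (simp add: adjacent_clus f_def)
  qed (use assms(3) \<sigma> Q P f h last(1) x in \<open>auto simp: Ms_def normal_cone_avec\<close>)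
  obtain g where g: "Rad_inv x lo up s t C (fs @ [g]) (Ls @ [\<tau>], Cs @ [clus x h], Ps @ Ms @ [Q])"
    using Rad_inv_step[OF x inv[unfolded \<sigma>] step] .
  \<comment> \<open>The invariant is preserved with some assignment for the new clustering;
    injectivity of \<open>clus x\<close> identifies it.\<close>
  then have "g = h" using Rad_inv_last(1)[OF g] x by simp
  then show thesis using that step g \<sigma> by blast
qed

lemma finite_last_optimal: "finite {\<tau>. \<exists>f :: 'n::finite \<Rightarrow> 'k::finite. last_optimal x lo up s t f \<tau>}"
proof -
  have "finite {\<tau>. last_optimal x lo up s t f \<tau>}" for f :: "'n \<Rightarrow> 'k"
    using last_optimal_unique[of x lo up s t f]
    by (cases "\<exists>\<tau>. last_optimal x lo up s t f \<tau>") (auto intro: finite_subset[of _ "{_}"])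
  then have "finite (\<Union>f :: 'n \<Rightarrow> 'k. {\<tau>. last_optimal x lo up s t f \<tau>})" by auto
  then show ?thesis by (rule rev_finite_subset) auto
qed

text \<open>At a breakpoint \<open>\<tau> < 1\<close> the run is steered towards an assignment that stays optimal beyond
  \<open>\<tau>\<close>, and at \<open>1\<close> towards the target. The run may thereby meet an assignment with a larger
  breakpoint; hence the lexicographic induction on the number of larger breakpoints and the distance.\<close>

lemma Rad_reaches_exit:
  fixes x :: "'n::finite \<Rightarrow> real^'d::finite" and ft :: "'n \<Rightarrow> 'k::finite"
  assumes x: "inj x" and ft: "optimal (objective x t) lo up ft"
    and "Rad_inv x lo up s t C fs \<sigma>"
  shows "\<exists>\<sigma>'. (RadToRad_iter x i1 s t lo up (clus x ft))\<^sup>*\<^sup>* \<sigma> \<sigma>' \<and> RadToRad_exit (clus x ft) \<sigma>'"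
proof -
  define B where "B = {\<tau>. \<exists>f :: 'n \<Rightarrow> 'k. last_optimal x lo up s t f \<tau>}"
  have "finite B" unfolding B_def by (rule finite_last_optimal)
  have ex_\<tau>: "\<exists>\<tau>. last_optimal x lo up s t (last fs) \<tau>" if "Rad_inv x lo up s t C fs \<sigma>" for fs \<sigma>
  proof -
    obtain Ls Cs Ps where "\<sigma> = (Ls, Cs, Ps)" by (cases \<sigma>)
    note last = Rad_inv_last(2,3)[OF that[unfolded this]]
    show ?thesis by (rule ex_last_optimal[OF last]) blast
  qed
  have "\<exists>\<sigma>'. (RadToRad_iter x i1 s t lo up (clus x ft))\<^sup>*\<^sup>* \<sigma> \<sigma>' \<and> RadToRad_exit (clus x ft) \<sigma>'"
    if "Rad_inv x lo up s t C fs \<sigma>" "last_optimal x lo up s t (last fs) \<tau>" for fs \<sigma> \<tau>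
    using that
  proof (induction "card {\<tau>'\<in>B. \<tau> < \<tau>'}" arbitrary: fs \<sigma> \<tau> rule: less_induct)
    case (less \<tau> fs \<sigma>)
    note larger = less.hyps
    have \<tau>: "0 \<le> \<tau>" "\<tau> \<le> 1" "optimal (objective x (sites_at s t \<tau>)) lo up (last fs)"
      using less.prems(2) by (auto simp: last_optimal_def)
    obtain g :: "'n \<Rightarrow> 'k" where g: "optimal (objective x (sites_at s t \<tau>)) lo up g"
      "g = ft \<or> (\<exists>\<tau>'>\<tau>. last_optimal x lo up s t g \<tau>')"
    proof (cases "\<tau> = 1")
      case True
      then show ?thesis using that[of ft] ft by (simp add: sites_at_def)
    next
      case False
      then have "\<tau> < 1" using \<tau>(2) by simp
      moreover have "feasible_shape lo up (psize ft)" using ft by (simp add: optimal_def)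
      ultimately obtain g :: "'n \<Rightarrow> 'k" and \<tau>' where "optimal (objective x (sites_at s t \<tau>)) lo up g"
        "last_optimal x lo up s t g \<tau>'" "\<tau> < \<tau>'"
        using ex_optimal_beyond \<tau>(1) by metis
      then show ?thesis using that[of g] by blast
    qed
    show ?case using less.prems
    proof (induction "card {j. last fs j \<noteq> g j}" arbitrary: fs \<sigma> rule: less_induct)
      case (less fs \<sigma>)
      show ?case
      proof (cases "RadToRad_exit (clus x ft) \<sigma>")
        case True
        then show ?thesis by blast
      next
        case False
        have "last fs \<noteq> ft"
          using False less.prems(1) by (auto simp: RadToRad_exit_def Rad_inv_def last_map split: prod.splits)
        \<comment> \<open>Either the goal \<open>g\<close> is the target, which has not been
          reached, or its breakpoint is larger than \<open>\<tau>\<close>, the breakpoint of the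
          current assignment.\<close>
        then have ne: "last fs \<noteq> g" using g(2) last_optimal_unique less.prems(2) by (metis less_irrefl)
        have "optimal (objective x (sites_at s t \<tau>)) lo up (last fs)"
          using less.prems(2) by (simp add: last_optimal_def)
        then obtain h where h: "edge_joined lo up (last fs) h" "optimal (objective x (sites_at s t \<tau>)) lo up h"
          "card {j. h j \<noteq> g j} < card {j. last fs j \<noteq> g j}"
          using ex_optimal_adjacent_towards[OF _ g(1) ne] by metis
        obtain \<sigma>1 where \<sigma>1: "RadToRad_iter x i1 s t lo up (clus x ft) \<sigma> \<sigma>1" "Rad_inv x lo up s t C (fs @ [h]) \<sigma>1"
          using Rad_progress[OF x less.prems(1) False less.prems(2) h(1,2)] .
        obtain \<tau>h where \<tau>h: "last_optimal x lo up s t h \<tau>h" "\<tau> \<le> \<tau>h"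
          using ex_last_optimal[OF _ h(2)] \<tau> by auto
        have "\<exists>\<sigma>'. (RadToRad_iter x i1 s t lo up (clus x ft))\<^sup>*\<^sup>* \<sigma>1 \<sigma>' \<and> RadToRad_exit (clus x ft) \<sigma>'"
        proof (cases "\<tau>h = \<tau>")
          case True
          then show ?thesis using less.hyps[OF _ \<sigma>1(2)] h(3) \<tau>h by simp
        next
          case False
          then have "{\<tau>'\<in>B. \<tau>h < \<tau>'} \<subset> {\<tau>'\<in>B. \<tau> < \<tau>'}"
            using \<tau>h by (intro psubsetI) (auto simp: B_def)
          then have "card {\<tau>'\<in>B. \<tau>h < \<tau>'} < card {\<tau>'\<in>B. \<tau> < \<tau>'}"
            using \<open>finite B\<close> by (intro psubset_card_mono) auto
          then show ?thesis using larger[OF _ \<sigma>1(2)] \<tau>h(1) by simp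
        qed
        then show ?thesis using \<sigma>1(1) by (meson converse_rtranclp_into_rtranclp)
      qed
    qed
  qed
  then show ?thesis using ex_\<tau> assms(3) by blast
qed

lemma Rad_loop_completes:
  assumes x: "inj x" and fs: "optimal (objective x s) lo up fs" and ft: "optimal (objective x t) lo up ft"
  shows "loop_completes (RadToRad_start (clus x fs)) (RadToRad_iter x i1 s t lo up (clus x ft)) (RadToRad_exit (clus x ft))"
proof (rule loop_completesI[where I = "\<lambda>\<sigma>. \<exists>gs. Rad_inv x lo up s t (clus x fs) gs \<sigma>"])
  show "\<exists>\<sigma>. RadToRad_start (clus x fs) \<sigma>" by (simp add: RadToRad_start_def)
  show "\<exists>gs. Rad_inv x lo up s t (clus x fs) gs \<sigma>" if "RadToRad_start (clus x fs) \<sigma>" for \<sigma>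
    using Rad_inv_start[OF x fs that] .
  show "\<exists>gs. Rad_inv x lo up s t (clus x fs) gs \<sigma>'"
    if "\<exists>gs. Rad_inv x lo up s t (clus x fs) gs \<sigma>" "RadToRad_iter x i1 s t lo up (clus x ft) \<sigma> \<sigma>'" for \<sigma> \<sigma>'
    using that Rad_inv_step[OF x] by metis
  show "\<exists>\<sigma>'. (RadToRad_iter x i1 s t lo up (clus x ft))\<^sup>*\<^sup>* \<sigma> \<sigma>' \<and> RadToRad_exit (clus x ft) \<sigma>'"
    if "\<exists>gs. Rad_inv x lo up s t (clus x fs) gs \<sigma>" for \<sigma>
    using that Rad_reaches_exit[OF x ft] by metis
qed

text \<open>The rule lets a run alternate between neighbours with a common breakpoint, so infinite
  runs are not excluded. Their parameters are nondecreasing and, after the initial one, lie in the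
  finite set of breakpoints.\<close>

lemma Rad_parameters_stabilize:
  fixes f :: "'n::finite \<Rightarrow> 'k::finite" and x :: "'n \<Rightarrow> real^'d::finite"
  assumes x: "inj x" and f: "optimal (objective x s) lo up f"
    and run: "infinite_run (RadToRad_start (clus x f)) (RadToRad_iter x i1 s t lo up Ct) F"
  shows "\<exists>N. \<forall>r\<ge>N. last (fst (F r)) = last (fst (F N))"
proof -
  define L where "L r = last (fst (F r))" for r
  define B where "B = {\<tau>. \<exists>f :: 'n \<Rightarrow> 'k. last_optimal x lo up s t f \<tau>}"
  have step: "L r \<le> L (Suc r) \<and> L (Suc r) \<in> B" for r
  proof -
    obtain fs where "Rad_inv x lo up s t (clus x f) fs (F r)"
      using infinite_run_invariant[OF run, of "\<lambda>\<sigma>. \<exists>fs. Rad_inv x lo up s t (clus x f) fs \<sigma>"]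
        Rad_inv_start[OF x f] Rad_inv_step[OF x] by metis
    moreover have "RadToRad_iter x i1 s t lo up Ct (F r) (F (Suc r))" using run by (simp add: infinite_run_def)
    ultimately show ?thesis using Rad_inv_step[OF x] unfolding L_def B_def by blast
  qed
  have mono: "L r \<le> L r'" if "r \<le> r'" for r r'
    using lift_Suc_mono_le[of L, OF _ that] step by blast
  have "range L \<subseteq> insert (L 0) B"
  proof clarify
    fix r assume "L r \<notin> B"
    then show "L r = L 0" using step by (cases r) auto
  qed
  then have fin: "finite (range L)" using finite_last_optimal unfolding B_def by (metis finite_insert finite_subset)
  then have "Max (range L) \<in> range L" by (intro Max_in) auto
  then obtain N where N: "L N = Max (range L)" by (metis imageE)
  have "L r = L N" if "r \<ge> N" for r
    using mono[OF that] Max_ge[OF fin, of "L r"] N by simp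
  then show ?thesis unfolding L_def by blast
qed

section \<open>Outputs of the loops and their concatenation\<close>

lemma LSA_returns:
  assumes x: "inj x" and C: "constrained_LSA_for (range x) a C" and feas: "feasible_shape lo up (shape C)"
    and ret: "loop_returns (LSAtoRad_start i1 a C) (LSAtoRad_iter x i1 a lo up) (LSAtoRad_exit x a lo up) \<sigma>"
  obtains fs where "LSA_inv x a lo up C fs \<sigma>" "optimal (objective x a) lo up (last fs)"
proof -
  obtain \<sigma>0 where \<sigma>0: "LSAtoRad_start i1 a C \<sigma>0" "(LSAtoRad_iter x i1 a lo up)\<^sup>*\<^sup>* \<sigma>0 \<sigma>"
    and exit: "LSAtoRad_exit x a lo up \<sigma>" using ret by (auto simp: loop_returns_def)
  have "\<exists>fs. LSA_inv x a lo up C fs \<sigma>"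
    by (rule loop_invariant[where I = "\<lambda>\<sigma>. \<exists>fs. LSA_inv x a lo up C fs \<sigma>", OF \<sigma>0(2)])
      (metis LSA_inv_start[OF x C feas \<sigma>0(1)], metis LSA_inv_step[OF x])
  then obtain fs where "LSA_inv x a lo up C fs \<sigma>" by blast
  then show thesis using that exit LSA_exit_iff[OF x] by blast
qed

lemma Rad_returns:
  assumes x: "inj x" and f: "optimal (objective x s) lo up f"
    and ret: "loop_returns (RadToRad_start (clus x f)) (RadToRad_iter x i1 s t lo up Ct) (RadToRad_exit Ct) (Ls, CL, PL)"
  obtains fs where "Rad_inv x lo up s t (clus x f) fs (Ls, CL, PL)" "last CL = Ct"
proof -
  obtain \<sigma>0 where \<sigma>0: "RadToRad_start (clus x f) \<sigma>0" "(RadToRad_iter x i1 s t lo up Ct)\<^sup>*\<^sup>* \<sigma>0 (Ls, CL, PL)"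
    and exit: "last CL = Ct" using ret by (auto simp: loop_returns_def RadToRad_exit_def)
  have "\<exists>fs. Rad_inv x lo up s t (clus x f) fs (Ls, CL, PL)"
    by (rule loop_invariant[where I = "\<lambda>\<sigma>. \<exists>fs. Rad_inv x lo up s t (clus x f) fs \<sigma>", OF \<sigma>0(2)])
      (metis Rad_inv_start[OF x f \<sigma>0(1)], metis Rad_inv_step[OF x])
  then show thesis using that exit by blast
qed

text \<open>Adjacent output lists overlap in one clustering, which is dropped from the second list;
  the formulation also covers a second list of length \<open>1\<close>, from a loop left at
  once.\<close>

lemma successively_append_tl:
  assumes "successively P xs" "successively P ys" "xs \<noteq> []" "ys \<noteq> []" "last xs = hd ys"
  shows "successively P (xs @ tl ys)" "last (xs @ tl ys) = last ys"
  using assms by (cases ys; auto simp: successively_append_iff successively_Cons)+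

lemma successively_nth: "successively P xs \<Longrightarrow> Suc j < length xs \<Longrightarrow> P (xs ! j) (xs ! Suc j)"
proof (induction xs arbitrary: j)
  case (Cons a xs)
  then show ?case by (cases j) (auto simp: successively_Cons hd_conv_nth)
qed simp

lemma LSA_inv_output:
  fixes x :: "'n::finite \<Rightarrow> real^'d::finite"
  assumes x: "inj x" and inv: "LSA_inv x a lo up C fs (Cs, Ps)"
  obtains p where "length Cs = p + 1" "length Ps = 2 * p + 1" "Cs ! 0 = C" "last Cs = Cs ! p"
    "\<forall>i\<le>p. constrained_LSA_for (range x) a (Cs ! i)"
    "\<forall>D\<in>set Cs. constrained_LSA (range x) D \<and> separable D \<and> feasible_shape lo up (shape D)"
    "\<forall>i\<le>p. separating_for a (Ps ! (2 * i)) (Cs ! i)"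
    "\<forall>i\<in>{1..p}. shared_for a (Ps ! (2 * i - 1)) (Cs ! (i - 1)) (Cs ! i)"
    "successively sequential_exchange Cs"
proof -
  have fs: "Cs \<noteq> []" "Cs = map (clus x) fs" "hd Cs = C"
    "\<And>f. f \<in> set fs \<Longrightarrow> feasible_shape lo up (psize f) \<and> optimal (objective x a) (psize f) (psize f) f"
    "successively sequential_exchange Cs" "length Ps = 2 * length Cs - 1"
    "\<And>i. i < length Cs \<Longrightarrow> separating_for a (Ps ! (2 * i)) (Cs ! i)"
    "\<And>i. Suc i < length Cs \<Longrightarrow> shared_for a (Ps ! (2 * i + 1)) (Cs ! i) (Cs ! Suc i)"
    using inv by (auto simp: LSA_inv_def)
  define p where "p = length Cs - 1"
  have p: "length Cs = p + 1" using fs(1) by (cases Cs) (auto simp: p_def)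
  have D: "constrained_LSA_for (range x) a D \<and> feasible_shape lo up (shape D)" if "D \<in> set Cs" for D
    using that fs(2,4) x by (auto simp: constrained_LSA_for_clus)
  show thesis
  proof
    show "length Cs = p + 1" "length Ps = 2 * p + 1" using p fs(6) by simp_all
    show "Cs ! 0 = C" using fs(1,3) by (simp add: hd_conv_nth)
    show "last Cs = Cs ! p" using fs(1) by (simp add: last_conv_nth p_def)
    show "\<forall>i\<le>p. constrained_LSA_for (range x) a (Cs ! i)" using D p by simp
    show "\<forall>D\<in>set Cs. constrained_LSA (range x) D \<and> separable D \<and> feasible_shape lo up (shape D)"
      using D constrained_LSA_separable[OF x] by blast
    show "\<forall>i\<le>p. separating_for a (Ps ! (2 * i)) (Cs ! i)" using fs(7) p by simp
    show "\<forall>i\<in>{1..p}. shared_for a (Ps ! (2 * i - 1)) (Cs ! (i - 1)) (Cs ! i)"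
    proof
      fix i assume "i \<in> {1..p}"
      then show "shared_for a (Ps ! (2 * i - 1)) (Cs ! (i - 1)) (Cs ! i)"
        using fs(8)[of "i - 1"] p by (cases i) auto
    qed
    show "successively sequential_exchange Cs" by (rule fs(5))
  qed
qed

lemma Rad_inv_output:
  fixes x :: "'n::finite \<Rightarrow> real^'d::finite"
  assumes x: "inj x" and inv: "Rad_inv x lo up s t C fs (Ls, Cs, Ps)"
  obtains m where "length Ls = m + 1" "length Cs = m + 1" "length Ps = 2 * m - 1" "Cs ! 0 = C" "last Cs = Cs ! m"
    "\<forall>D\<in>set Cs. constrained_LSA (range x) D \<and> separable D \<and> feasible_shape lo up (shape D)"
    "\<forall>i\<in>{1..<m}. separating (Ps ! (2 * i - 1)) (Cs ! i)"
    "\<forall>i\<in>{1..m}. shared_for (sites_at s t (Ls ! i)) (Ps ! (2 * (i - 1))) (Cs ! (i - 1)) (Cs ! i)"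
    "\<forall>i\<le>m. radial_in_partition (range x) lo up (sites_at s t (Ls ! i)) (Cs ! i) \<and>
       radial_in_transportation x lo up (sites_at s t (Ls ! i)) (Cs ! i)"
    "successively (\<lambda>C D. cyclical_exchange C D \<or> sequential_exchange C D) Cs"
proof -
  have fs: "fs \<noteq> []" "Cs = map (clus x) fs" "hd Cs = C" "length Ls = length fs"
     "\<And>i. i < length fs \<Longrightarrow> optimal (objective x (sites_at s t (Ls ! i))) lo up (fs ! i)"
     "successively (\<lambda>C D. cyclical_exchange C D \<or> sequential_exchange C D) Cs"
     "length Ps = 2 * (length fs - 1) - 1"
     "\<And>i. Suc i < length fs \<Longrightarrow> shared_for (sites_at s t (Ls ! Suc i)) (Ps ! (2 * i)) (Cs ! i) (Cs ! Suc i)"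
     "\<And>i. 0 < i \<Longrightarrow> Suc i < length fs \<Longrightarrow> separating (Ps ! (2 * i - 1)) (Cs ! i)"
    using inv by (auto simp: Rad_inv_def)
  define m where "m = length fs - 1"
  have m: "length fs = m + 1" using fs(1) by (cases fs) (auto simp: m_def)
  have ne: "Cs \<noteq> []" "length Cs = m + 1" using fs(1,2) m by auto
  have opt: "optimal (objective x (sites_at s t (Ls ! i))) lo up (fs ! i)" "Cs ! i = clus x (fs ! i)"
    if "i \<le> m" for i using that fs(2,5) m by simp_all
  show thesis
  proof
    show "length Ls = m + 1" "length Cs = m + 1" "length Ps = 2 * m - 1" using fs(4,7) m ne by simp_all
    show "Cs ! 0 = C" using ne fs(3) by (simp add: hd_conv_nth)
    show "last Cs = Cs ! m" using ne by (simp add: last_conv_nth)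
    show "\<forall>D\<in>set Cs. constrained_LSA (range x) D \<and> separable D \<and> feasible_shape lo up (shape D)"
    proof
      fix D assume "D \<in> set Cs"
      then obtain i where i: "D = Cs ! i" "i \<le> m" using ne by (auto simp: in_set_conv_nth less_Suc_eq_le)
      then have "constrained_LSA_for (range x) (sites_at s t (Ls ! i)) D"
        using optimal_own_shape[OF opt(1)[OF i(2)]] opt(2)[OF i(2)] i(1) x
        by (simp add: constrained_LSA_for_clus)
      moreover have "feasible_shape lo up (shape D)" using opt[OF i(2)] i(1) x by (simp add: optimal_def)
      ultimately show "constrained_LSA (range x) D \<and> separable D \<and> feasible_shape lo up (shape D)"
        using constrained_LSA_separable[OF x] by blast
    qed
    show "\<forall>i\<in>{1..<m}. separating (Ps ! (2 * i - 1)) (Cs ! i)" using fs(9) m by simp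
    show "\<forall>i\<in>{1..m}. shared_for (sites_at s t (Ls ! i)) (Ps ! (2 * (i - 1))) (Cs ! (i - 1)) (Cs ! i)"
    proof
      fix i assume "i \<in> {1..m}"
      then show "shared_for (sites_at s t (Ls ! i)) (Ps ! (2 * (i - 1))) (Cs ! (i - 1)) (Cs ! i)"
        using fs(8)[of "i - 1"] m by (cases i) auto
    qed
    show "\<forall>i\<le>m. radial_in_partition (range x) lo up (sites_at s t (Ls ! i)) (Cs ! i) \<and>
       radial_in_transportation x lo up (sites_at s t (Ls ! i)) (Cs ! i)"
      using radial_clus[OF x opt(1)] opt(2) by auto
    show "successively (\<lambda>C D. cyclical_exchange C D \<or> sequential_exchange C D) Cs" by (rule fs(6))
  qed
qed

lemma shared_for_sym: "shared_for a P C D \<longleftrightarrow> shared_for a P D C"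
  by (auto simp: shared_for_def)

theorem theorem1:
  fixes x :: "'n::finite \<Rightarrow> real^'d::finite"
    and i1 :: "'k::finite"
    and s t :: "('d, 'k) sites"
    and Cs Ct :: "('d, 'k) clustering"
  assumes "inj x"
    and "(\<Sum>j\<in>UNIV. x j) = 0"
    and "constrained_LSA_for (range x) s Cs"
    and "constrained_LSA_for (range x) t Ct"
  shows
    \<comment> \<open>The algorithm returns.\<close>
    "(let lo = lower_sizes Cs Ct; up = upper_sizes Cs Ct in
      (\<forall>(a, C) \<in> {(s, Cs), (t, Ct)}.
        loop_completes (LSAtoRad_start i1 a C) (LSAtoRad_iter x i1 a lo up)
          (LSAtoRad_exit x a lo up) \<and>
        (\<nexists>f. infinite_run (LSAtoRad_start i1 a C) (LSAtoRad_iter x i1 a lo up) f)) \<and>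
      (\<forall>CS PS CT PT.
        loop_returns (LSAtoRad_start i1 s Cs) (LSAtoRad_iter x i1 s lo up)
          (LSAtoRad_exit x s lo up) (CS, PS) \<and>
        loop_returns (LSAtoRad_start i1 t Ct) (LSAtoRad_iter x i1 t lo up)
          (LSAtoRad_exit x t lo up) (CT, PT) \<longrightarrow>
        loop_completes (RadToRad_start (last CS)) (RadToRad_iter x i1 s t lo up (last CT))
          (RadToRad_exit (last CT)) \<and>
        (\<forall>f. infinite_run (RadToRad_start (last CS)) (RadToRad_iter x i1 s t lo up (last CT)) f \<longrightarrow>
          (\<exists>N. \<forall>r\<ge>N. last (fst (f r)) = last (fst (f N)))))) \<and>
    \<comment> \<open>Whatever it returns has the stated properties.\<close>
    (\<forall>CS PS CT PT Ls CL PL Cout Pout.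
      transition_returns x i1 Cs Ct s t (CS, PS) (CT, PT) (Ls, CL, PL) (Cout, Pout) \<longrightarrow>
      (let X = range x; lo = lower_sizes Cs Ct; up = upper_sizes Cs Ct in
       \<exists>p q m.
        length CS = p + 1 \<and> length PS = 2 * p + 1 \<and>
        length CT = q + 1 \<and> length PT = 2 * q + 1 \<and>
        length Ls = m + 1 \<and> length CL = m + 1 \<and> length PL = 2 * m - 1 \<and>
        \<comment> \<open>1\<close>
        CS ! 0 = Cs \<and> CT ! 0 = Ct \<and>
        \<comment> \<open>2\<close>
        (\<forall>C \<in> set Cout. constrained_LSA X C \<and> separable C) \<and>
        \<comment> \<open>3\<close>
        (\<forall>C \<in> set Cout. \<forall>i. lo i \<le> card (C i) \<and> card (C i) \<le> up i) \<and>
        \<comment> \<open>4\<close>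
        (\<forall>j. j + 1 < length Cout \<longrightarrow>
          cyclical_exchange (Cout ! j) (Cout ! (j + 1)) \<or>
          sequential_exchange (Cout ! j) (Cout ! (j + 1))) \<and>
        \<comment> \<open>5\<close>
        (\<forall>i\<le>p. separating_for s (PS ! (2 * i)) (CS ! i)) \<and>
        (\<forall>i\<in>{1..<m}. separating (PL ! (2 * i - 1)) (CL ! i)) \<and>
        (\<forall>i\<le>q. separating_for t (PT ! (2 * i)) (CT ! i)) \<and>
        \<comment> \<open>6\<close>
        (\<forall>i\<in>{1..p}. shared_for s (PS ! (2 * i - 1)) (CS ! (i - 1)) (CS ! i)) \<and>
        (\<forall>i\<in>{1..m}.
          shared_for (sites_at s t (Ls ! i)) (PL ! (2 * (i - 1))) (CL ! (i - 1)) (CL ! i)) \<and>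
        (\<forall>i\<in>{1..q}. shared_for t (PT ! (2 * i - 1)) (CT ! i) (CT ! (i - 1))) \<and>
        \<comment> \<open>7\<close>
        CS ! p = CL ! 0 \<and> CL ! m = CT ! q \<and>
        (\<forall>i\<le>m. radial_in_partition X lo up (sites_at s t (Ls ! i)) (CL ! i) \<and>
                radial_in_transportation x lo up (sites_at s t (Ls ! i)) (CL ! i)) \<and>
        \<comment> \<open>8\<close>
        (\<forall>i\<le>p. constrained_LSA_for X s (CS ! i)) \<and>
        \<comment> \<open>9\<close>
        (\<forall>i<q. constrained_LSA_for X t (CT ! i)) \<and>
        \<comment> \<open>10\<close>
        distinct (map shape CS) \<and> length CS \<le> card (feasible_shapes X lo up) \<and>
        \<comment> \<open>11\<close>
        distinct (map shape CT) \<and> length CT \<le> card (feasible_shapes X lo up)))"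
proof -
  define lo up where "lo = lower_sizes Cs Ct" and "up = upper_sizes Cs Ct"
  have feas: "feasible_shape lo up (shape Cs)" "feasible_shape lo up (shape Ct)"
    by (auto simp: feasible_shape_def lo_def up_def lower_sizes_def upper_sizes_def shape_def)
  note x = \<open>inj x\<close> and s = assms(3) and t = assms(4)
  have completes: "loop_completes (LSAtoRad_start i1 a C) (LSAtoRad_iter x i1 a lo up) (LSAtoRad_exit x a lo up) \<and>
      (\<nexists>f. infinite_run (LSAtoRad_start i1 a C) (LSAtoRad_iter x i1 a lo up) f)"
    if "(a, C) \<in> {(s, Cs), (t, Ct)}" for a C
  proof -
    have "constrained_LSA_for (range x) a C" "feasible_shape lo up (shape C)" using that s t feas by auto
    then show ?thesis using LSA_loop_completes[OF x] LSA_no_infinite_run[OF x] by blast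
  qed
  then have all_complete: "\<forall>(a, C)\<in>{(s, Cs), (t, Ct)}.
      loop_completes (LSAtoRad_start i1 a C) (LSAtoRad_iter x i1 a lo up) (LSAtoRad_exit x a lo up) \<and>
      (\<nexists>f. infinite_run (LSAtoRad_start i1 a C) (LSAtoRad_iter x i1 a lo up) f)"
    by (intro ballI case_prodI2) blast
  have rad: "loop_completes (RadToRad_start (last CS)) (RadToRad_iter x i1 s t lo up (last CT)) (RadToRad_exit (last CT)) \<and>
        (\<forall>f. infinite_run (RadToRad_start (last CS)) (RadToRad_iter x i1 s t lo up (last CT)) f \<longrightarrow>
          (\<exists>N. \<forall>r\<ge>N. last (fst (f r)) = last (fst (f N))))"
    if CS: "loop_returns (LSAtoRad_start i1 s Cs) (LSAtoRad_iter x i1 s lo up) (LSAtoRad_exit x s lo up) (CS, PS)"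
      and CT: "loop_returns (LSAtoRad_start i1 t Ct) (LSAtoRad_iter x i1 t lo up) (LSAtoRad_exit x t lo up) (CT, PT)"
    for CS PS CT PT
  proof -
    obtain fs where fs: "LSA_inv x s lo up Cs fs (CS, PS)" "optimal (objective x s) lo up (last fs)"
      using LSA_returns[OF x s feas(1) CS] .
    obtain ft where ft: "LSA_inv x t lo up Ct ft (CT, PT)" "optimal (objective x t) lo up (last ft)"
      using LSA_returns[OF x t feas(2) CT] .
    have "last CS = clus x (last fs)" "last CT = clus x (last ft)"
      using fs(1) ft(1) by (auto simp: LSA_inv_def last_map)
    then show ?thesis
      using Rad_loop_completes[OF x fs(2) ft(2)] Rad_parameters_stabilize[OF x fs(2)] by simp
  qed
  have properties: "\<exists>p q m.
        length CS = p + 1 \<and> length PS = 2 * p + 1 \<and>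
        length CT = q + 1 \<and> length PT = 2 * q + 1 \<and>
        length Ls = m + 1 \<and> length CL = m + 1 \<and> length PL = 2 * m - 1 \<and>
        CS ! 0 = Cs \<and> CT ! 0 = Ct \<and>
        (\<forall>C \<in> set Cout. constrained_LSA (range x) C \<and> separable C) \<and>
        (\<forall>C \<in> set Cout. \<forall>i. lo i \<le> card (C i) \<and> card (C i) \<le> up i) \<and>
        (\<forall>j. j + 1 < length Cout \<longrightarrow>
          cyclical_exchange (Cout ! j) (Cout ! (j + 1)) \<or>
          sequential_exchange (Cout ! j) (Cout ! (j + 1))) \<and>
        (\<forall>i\<le>p. separating_for s (PS ! (2 * i)) (CS ! i)) \<and>
        (\<forall>i\<in>{1..<m}. separating (PL ! (2 * i - 1)) (CL ! i)) \<and>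
        (\<forall>i\<le>q. separating_for t (PT ! (2 * i)) (CT ! i)) \<and>
        (\<forall>i\<in>{1..p}. shared_for s (PS ! (2 * i - 1)) (CS ! (i - 1)) (CS ! i)) \<and>
        (\<forall>i\<in>{1..m}.
          shared_for (sites_at s t (Ls ! i)) (PL ! (2 * (i - 1))) (CL ! (i - 1)) (CL ! i)) \<and>
        (\<forall>i\<in>{1..q}. shared_for t (PT ! (2 * i - 1)) (CT ! i) (CT ! (i - 1))) \<and>
        CS ! p = CL ! 0 \<and> CL ! m = CT ! q \<and>
        (\<forall>i\<le>m. radial_in_partition (range x) lo up (sites_at s t (Ls ! i)) (CL ! i) \<and>
                radial_in_transportation x lo up (sites_at s t (Ls ! i)) (CL ! i)) \<and>
        (\<forall>i\<le>p. constrained_LSA_for (range x) s (CS ! i)) \<and>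
        (\<forall>i<q. constrained_LSA_for (range x) t (CT ! i)) \<and>
        distinct (map shape CS) \<and> length CS \<le> card (feasible_shapes (range x) lo up) \<and>
        distinct (map shape CT) \<and> length CT \<le> card (feasible_shapes (range x) lo up)"
    if ret: "transition_returns x i1 Cs Ct s t (CS, PS) (CT, PT) (Ls, CL, PL) (Cout, Pout)"
    for CS PS CT PT Ls CL PL Cout Pout
  proof -
    have CS: "loop_returns (LSAtoRad_start i1 s Cs) (LSAtoRad_iter x i1 s lo up) (LSAtoRad_exit x s lo up) (CS, PS)"
      and CT: "loop_returns (LSAtoRad_start i1 t Ct) (LSAtoRad_iter x i1 t lo up) (LSAtoRad_exit x t lo up) (CT, PT)"
      and CL: "loop_returns (RadToRad_start (last CS)) (RadToRad_iter x i1 s t lo up (last CT))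
        (RadToRad_exit (last CT)) (Ls, CL, PL)"
      and Cout: "Cout = CS @ tl CL @ tl (rev CT)"
      using ret by (auto simp: transition_returns_def lo_def up_def Let_def)
    obtain fs where fs: "LSA_inv x s lo up Cs fs (CS, PS)" "optimal (objective x s) lo up (last fs)"
      using LSA_returns[OF x s feas(1) CS] .
    obtain ft where ft: "LSA_inv x t lo up Ct ft (CT, PT)" "optimal (objective x t) lo up (last ft)"
      using LSA_returns[OF x t feas(2) CT] .
    have lastCS: "last CS = clus x (last fs)" using fs(1) by (auto simp: LSA_inv_def last_map)
    obtain gs where gs: "Rad_inv x lo up s t (last CS) gs (Ls, CL, PL)" "last CL = last CT"
      using Rad_returns[OF x fs(2) CL[unfolded lastCS]] lastCS by metis
    obtain p where p: "length CS = p + 1" "length PS = 2 * p + 1" "CS ! 0 = Cs" "last CS = CS ! p"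
      "\<forall>i\<le>p. constrained_LSA_for (range x) s (CS ! i)"
      "\<forall>D\<in>set CS. constrained_LSA (range x) D \<and> separable D \<and> feasible_shape lo up (shape D)"
      "\<forall>i\<le>p. separating_for s (PS ! (2 * i)) (CS ! i)"
      "\<forall>i\<in>{1..p}. shared_for s (PS ! (2 * i - 1)) (CS ! (i - 1)) (CS ! i)"
      "successively sequential_exchange CS"
      using LSA_inv_output[OF x fs(1)] .
    obtain q where q: "length CT = q + 1" "length PT = 2 * q + 1" "CT ! 0 = Ct" "last CT = CT ! q"
      "\<forall>i\<le>q. constrained_LSA_for (range x) t (CT ! i)"
      "\<forall>D\<in>set CT. constrained_LSA (range x) D \<and> separable D \<and> feasible_shape lo up (shape D)"
      "\<forall>i\<le>q. separating_for t (PT ! (2 * i)) (CT ! i)"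
      "\<forall>i\<in>{1..q}. shared_for t (PT ! (2 * i - 1)) (CT ! (i - 1)) (CT ! i)"
      "successively sequential_exchange CT"
      using LSA_inv_output[OF x ft(1)] .
    obtain m where m: "length Ls = m + 1" "length CL = m + 1" "length PL = 2 * m - 1" "CL ! 0 = last CS" "last CL = CL ! m"
      "\<forall>D\<in>set CL. constrained_LSA (range x) D \<and> separable D \<and> feasible_shape lo up (shape D)"
      "\<forall>i\<in>{1..<m}. separating (PL ! (2 * i - 1)) (CL ! i)"
      "\<forall>i\<in>{1..m}. shared_for (sites_at s t (Ls ! i)) (PL ! (2 * (i - 1))) (CL ! (i - 1)) (CL ! i)"
      "\<forall>i\<le>m. radial_in_partition (range x) lo up (sites_at s t (Ls ! i)) (CL ! i) \<and>
         radial_in_transportation x lo up (sites_at s t (Ls ! i)) (CL ! i)"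
      "successively (\<lambda>C D. cyclical_exchange C D \<or> sequential_exchange C D) CL"
      using Rad_inv_output[OF x gs(1)] .
    have ne: "CS \<noteq> []" "CL \<noteq> []" "CT \<noteq> []" using p(1) q(1) m(2) by auto
    let ?E = "\<lambda>C D. cyclical_exchange C D \<or> sequential_exchange C D"
    \<comment> \<open>The parts are glued at the two radial clusterings: \<open>CS\<close> ends
      where \<open>CL\<close> starts, and \<open>CL\<close> ends where the reversed
      \<open>CT\<close> starts.\<close>
    have "successively ?E CS" using p(9) by (rule successively_mono) auto
    moreover have "last CS = hd CL" using m(4) ne by (simp add: hd_conv_nth)
    ultimately have "successively ?E (CS @ tl CL)" "last (CS @ tl CL) = last CL"
      using successively_append_tl[of ?E CS CL] m(10) ne by auto
    moreover have "successively ?E (rev CT)"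
      unfolding successively_rev using q(9) by (rule successively_mono) (simp add: sequential_exchange_sym)
    moreover have "last CL = hd (rev CT)" using gs(2) by (simp add: hd_rev)
    ultimately have "successively ?E Cout"
      using successively_append_tl(1)[of ?E "CS @ tl CL" "rev CT"] ne Cout by auto
    then have exch: "\<forall>j. j + 1 < length Cout \<longrightarrow>
        cyclical_exchange (Cout ! j) (Cout ! (j + 1)) \<or> sequential_exchange (Cout ! j) (Cout ! (j + 1))"
      using successively_nth[of ?E Cout] by simp
    have "set Cout \<subseteq> set CS \<union> set CL \<union> set CT"
      using list.set_sel(2)[OF ne(2)] list.set_sel(2)[of "rev CT"] ne(3) unfolding Cout by auto
    then have out: "constrained_LSA (range x) D \<and> separable D \<and> feasible_shape lo up (shape D)" if "D \<in> set Cout" for D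
      using that p(6) q(6) m(6) by blast
    then have "\<forall>C\<in>set Cout. constrained_LSA (range x) C \<and> separable C"
      "\<forall>C\<in>set Cout. \<forall>i. lo i \<le> card (C i) \<and> card (C i) \<le> up i"
      by (auto simp: feasible_shape_def shape_def)
    moreover have "\<forall>i\<in>{1..q}. shared_for t (PT ! (2 * i - 1)) (CT ! i) (CT ! (i - 1))"
      using q(8) shared_for_sym by blast
    moreover have "CS ! p = CL ! 0" "CL ! m = CT ! q" using p(4) q(4) m(4,5) gs(2) by simp_all
    moreover have "\<forall>i<q. constrained_LSA_for (range x) t (CT ! i)" using q(5) by simp
    ultimately show ?thesis
      using p q m exch LSA_inv_distinct_shapes[OF x fs(1)] LSA_inv_distinct_shapes[OF x ft(1)]
      by (intro exI[of _ p] exI[of _ q] exI[of _ m] conjI) assumption+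
  qed
  show ?thesis
    unfolding Let_def lo_def[symmetric] up_def[symmetric]
    by (rule conjI, rule conjI[OF all_complete]; intro allI impI; (elim conjE)?; (rule rad properties); assumption)
qed

end
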